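(* For each real $\alpha>N-1$, the function $$f(x)=\Gamma_M(2\alpha)\,\Delta^\alpha\!\left(x(\mathrm{id}+x)^{-2}\right),\qquad x\in M,$$ is $U$-invariant, integrable with respect to $\mathrm{vol}$, and positive definite, and its spherical transform is $$\hat f(t)=\left|\Gamma_M(\alpha+\delta+\mathrm{i}t)\right|^2,\qquad t\in\mathbb{R}^N .$$ The corresponding kernel $\mathcal{K}(x,y)=f(y^{-1/2}xy^{-1/2})$ is an invariant kernel on $M$, and $$\mathcal{K}(x,y)=\Gamma_M(2\alpha)\left[\frac{\Delta(x)\,\Delta(y)}{\Delta(x+y)^2}\right]^\alpha,\qquad x,y\in M .$$
   Context: $N\ge1$ is an integer and $\mathrm{i}=\sqrt{-1}$. $M$ is the space of $N\times N$ Hermitian positive definite complex matrices, $\mathrm{id}$ is the identity matrix, $\Delta(x)=\det(x)$, $\Delta^\alpha(x)=(\det x)^\alpha$. $G=GL(N,\mathbb{C})$ acts on $M$ by $g\cdot x=gxg^\dagger$, and $U\subset G$ is the unitary group. A function $f:M\to\mathbb{C}$ is $U$-invariant if $f(u\cdot x)=f(x)$ for all $u\in U$, $x\in M$. It is positive definite if it is continuous and, for every $n\ge2$ and $x_1,\dots,x_n\in M$, the $n\times n$ matrix with entries $f(x_i^{-1/2}x_jx_i^{-1/2})$ is Hermitian positive semidefinite. A kernel is a continuous function $\mathcal{K}:M\times M\to\mathbb{C}$ such that for all $n\ge2$ and $x_1,\dots,x_n\in M$ the matrix with entries $\mathcal{K}(x_i,x_j)$ is Hermitian positive semidefinite; it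 is invariant if $\mathcal{K}(g\cdot x,g\cdot y)=\mathcal{K}(x,y)$ for all $g\in G$, $x,y\in M$. $\mathrm{vol}$ is the Riemannian volume measure of the metric $\langle v,w\rangle_x=\mathrm{Re}[\mathrm{tr}(x^{-1}vx^{-1}w)]$ on $M$ ($v,w$ Hermitian matrices). For $s\in\mathbb{C}^N$, $\Delta_s(x)=\Delta_1(x)^{s_1-s_2}\Delta_2(x)^{s_2-s_3}\cdots\Delta_N(x)^{s_N}$ with $\Delta_k(x)$ the $k$-th leading principal minor of $x$; $\delta_k=\tfrac12(2k-N-1)$; the spherical function is $\Phi_\lambda(x)=\int_U\Delta_{\lambda+\delta}(u\cdot x)\,du$ ($du$ normalized Haar measure on $U$), $\lambda\in\mathbb{C}^N$. The spherical transform of an integrable $U$-invariant $f$ is $\hat f(t)=\int_M f(x)\Phi_{-\mathrm{i}t}(x)\,\mathrm{vol}(dx)$, $t\in\mathbb{R}^N$. $\Gamma_M(\lambda)=(2\pi)^{N(N-1)/2}\prod_{k=1}^N\Gamma(\lambda_k-k+1)$ for $\lambda\in\mathbb{C}^N$, with $\Gamma$ Euler's Gamma function; adding a number to a vector means adding it to each component, and $\Gamma_M(2\alpha)=\Gamma_M((2\alpha,\dots,2\alpha))$. *)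

theory Defs
  imports "HOL-Analysis.Analysis"
begin

text \<open>
  Matrices are indexed by a finite linearly ordered type \<open>'n\<close>, with \<open>N = CARD('n)\<close>; the order is what
  gives a meaning to leading principal minors. The index \<open>k :: 'n\<close> corresponds to the number
  \<open>card {..k}\<close> in \<open>{1..N}\<close>. Functions on \<open>M\<close> are total functions on matrices of which only the
  values on \<open>M = hpd\<close> matter.
\<close>

definition ctranspose :: "complex^'n^'m \<Rightarrow> complex^'m^'n" where
  "ctranspose A = (\<chi> i j. cnj (A $ j $ i))"

definition hpd :: "(complex^'n^'n) set" where
  "hpd = {x. ctranspose x = x \<and>
     (\<forall>v. v \<noteq> 0 \<longrightarrow> 0 < Re (\<Sum>i\<in>UNIV. \<Sum>j\<in>UNIV. cnj (v $ i) * x $ i $ j * v $ j))}"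

definition unitary_group :: "(complex^'n^'n) set" where
  "unitary_group = {u. ctranspose u ** u = mat 1 \<and> u ** ctranspose u = mat 1}"

definition act :: "complex^'n^'n \<Rightarrow> complex^'n^'n \<Rightarrow> complex^'n^'n" where
  "act g x = g ** x ** ctranspose g"

definition hpd_sqrt :: "complex^'n^'n \<Rightarrow> complex^'n^'n" where
  "hpd_sqrt x = (THE y. y \<in> hpd \<and> y ** y = x)"

definition inv_sqrt :: "complex^'n^'n \<Rightarrow> complex^'n^'n" where
  "inv_sqrt x = matrix_inv (hpd_sqrt x)"

definition Delta_pow :: "real \<Rightarrow> complex^'n^'n \<Rightarrow> complex" where
  "Delta_pow \<alpha> x = det x powr of_real \<alpha>"


subsection \<open>Positive definite functions and kernels\<close>

text \<open>Hermitian positive semidefiniteness of the \<open>n \<times> n\<close> matrix with entries \<open>a i j\<close>, \<open>i, j < n\<close>;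
  the quadratic form is real by the first conjunct.\<close>

definition hermitian_psd :: "nat \<Rightarrow> (nat \<Rightarrow> nat \<Rightarrow> complex) \<Rightarrow> bool" where
  "hermitian_psd n a \<longleftrightarrow>
     (\<forall>i<n. \<forall>j<n. a j i = cnj (a i j)) \<and>
     (\<forall>c. 0 \<le> Re (\<Sum>i<n. \<Sum>j<n. cnj (c i) * a i j * c j))"

definition U_invariant :: "(complex^'n^'n \<Rightarrow> complex) \<Rightarrow> bool" where
  "U_invariant f \<longleftrightarrow> (\<forall>u\<in>unitary_group. \<forall>x\<in>hpd. f (act u x) = f x)"

definition positive_definite_fun :: "(complex^'n^'n \<Rightarrow> complex) \<Rightarrow> bool" where
  "positive_definite_fun f \<longleftrightarrow>
     continuous_on hpd f \<and>
     (\<forall>n\<ge>2. \<forall>x::nat \<Rightarrow> complex^'n^'n. (\<forall>i<n. x i \<in> hpd) \<longrightarrow>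
        hermitian_psd n (\<lambda>i j. f (inv_sqrt (x i) ** x j ** inv_sqrt (x i))))"

definition is_kernel :: "(complex^'n^'n \<Rightarrow> complex^'n^'n \<Rightarrow> complex) \<Rightarrow> bool" where
  "is_kernel K \<longleftrightarrow>
     continuous_on (hpd \<times> hpd) (\<lambda>(x, y). K x y) \<and>
     (\<forall>n\<ge>2. \<forall>x::nat \<Rightarrow> complex^'n^'n. (\<forall>i<n. x i \<in> hpd) \<longrightarrow>
        hermitian_psd n (\<lambda>i j. K (x i) (x j)))"

definition invariant_kernel :: "(complex^'n^'n \<Rightarrow> complex^'n^'n \<Rightarrow> complex) \<Rightarrow> bool" where
  "invariant_kernel K \<longleftrightarrow>
     is_kernel K \<and>
     (\<forall>g x y. invertible g \<longrightarrow> x \<in> hpd \<longrightarrow> y \<in> hpd \<longrightarrow> K (act g x) (act g y) = K x y)"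


subsection \<open>The Riemannian volume\<close>

definition riem_metric :: "complex^'n^'n \<Rightarrow> complex^'n^'n \<Rightarrow> complex^'n^'n \<Rightarrow> real" where
  "riem_metric x v w = Re (trace (matrix_inv x ** v ** matrix_inv x ** w))"

definition mat_entry :: "'n \<Rightarrow> 'n \<Rightarrow> complex \<Rightarrow> complex^'n^'n" where
  "mat_entry i j c = (\<chi> k l. if k = i \<and> l = j then c else 0)"

text \<open>A real basis of the space of Hermitian matrices, which provides a global (linear) chart of
  \<open>M\<close> by an open subset of \<open>\<real>\<^sup>N\<^sup>\<times>\<^sup>N\<close>. The volume is the push-forward under this chart of
  \<open>sqrt (det (g\<^sub>p\<^sub>q))\<close> times Lebesgue measure; its underlying space is \<open>hpd\<close>.\<close>

definition herm_basis :: "'n::{finite,linorder} \<times> 'n \<Rightarrow> complex^'n::{finite,linorder}^'n::{finite,linorder}" where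
  "herm_basis = (\<lambda>(i, j).
     if i = j then mat_entry i i 1
     else if i < j then mat_entry i j 1 + mat_entry j i 1
     else mat_entry i j \<i> + mat_entry j i (- \<i>))"

definition herm_chart :: "real^('n \<times> 'n) \<Rightarrow> complex^'n::{finite,linorder}^'n::{finite,linorder}" where
  "herm_chart a = (\<Sum>p\<in>UNIV. (a $ p) *\<^sub>R herm_basis p)"

definition gram :: "complex^'n::{finite,linorder}^'n::{finite,linorder} \<Rightarrow> real^('n \<times> 'n)^('n \<times> 'n)" where
  "gram x = (\<chi> p q. riem_metric x (herm_basis p) (herm_basis q))"

definition vol :: "(complex^'n::{finite,linorder}^'n::{finite,linorder}) measure" where
  "vol = distr
     (density (restrict_space lborel (herm_chart -` hpd))
        (\<lambda>a. ennreal (sqrt (det (gram (herm_chart a))))))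
     (restrict_space borel hpd) herm_chart"


subsection \<open>Spherical functions\<close>

definition haar_unitary :: "(complex^'n^'n) measure" where
  "haar_unitary = (THE \<mu>.
     sets \<mu> = sets (restrict_space borel unitary_group) \<and>
     emeasure \<mu> unitary_group = 1 \<and>
     (\<forall>u\<in>unitary_group. distr \<mu> \<mu> (\<lambda>v. u ** v) = \<mu>))"

text \<open>Determinant of the submatrix with rows and columns in \<open>S\<close>, by the Leibniz formula; it is
  \<open>det x\<close> for \<open>S = UNIV\<close>.\<close>

definition principal_minor :: "'n set \<Rightarrow> complex^'n^'n \<Rightarrow> complex" where
  "principal_minor S x = (\<Sum>p | p permutes S. of_int (sign p) * (\<Prod>i\<in>S. x $ i $ p i))"

text \<open>\<open>Min {k<..}\<close> is the successor of \<open>k\<close>, so that the exponents are \<open>s\<^sub>k - s\<^sub>k\<^sub>+\<^sub>1\<close> for \<open>k < N\<close>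
  and \<open>s\<^sub>N\<close> for \<open>k = N\<close>.\<close>

definition Delta_gen :: "complex^'n::{finite,linorder} \<Rightarrow> complex^'n::{finite,linorder}^'n::{finite,linorder} \<Rightarrow> complex" where
  "Delta_gen s x = (\<Prod>k\<in>UNIV. principal_minor {..k} x powr
     (if {k<..} = {} then s $ k else s $ k - s $ Min {k<..}))"

definition delta :: "real^'n::{finite,linorder}" where
  "delta = (\<chi> k. (2 * real (card {..k}) - real CARD('n) - 1) / 2)"

definition spherical_fun :: "complex^'n::{finite,linorder} \<Rightarrow> complex^'n::{finite,linorder}^'n::{finite,linorder} \<Rightarrow> complex" where
  "spherical_fun l x =
     (\<integral>u. Delta_gen (\<chi> k. l $ k + of_real (delta $ k)) (act u x) \<partial>haar_unitary)"

definition spherical_transform ::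
    "(complex^'n::{finite,linorder}^'n::{finite,linorder} \<Rightarrow> complex) \<Rightarrow> real^'n::{finite,linorder} \<Rightarrow> complex" where
  "spherical_transform f t =
     (\<integral>x. f x * spherical_fun (\<chi> k. - \<i> * of_real (t $ k)) x \<partial>vol)"

definition Gamma_M :: "complex^'n::{finite,linorder} \<Rightarrow> complex" where
  "Gamma_M l = of_real (2 * pi) ^ (CARD('n) * (CARD('n) - 1) div 2) *
     (\<Prod>k\<in>UNIV. Gamma (l $ k - of_nat (card {..k}) + 1))"

end

(*
  In Cholesky coordinates x = L L^H (^H is the conjugate transpose) the passage from the
  off-diagonal entries of L and the pivots d_k = L_kk^2 to the entries of x is a triangular
  substitution, so the Riemannian volume becomes Lebesgue measure times powers of the pivots.
  As tr x is a sum and Delta_s(x) a product over the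
  coordinates, the integral of e^(-tr x) Delta_s(x) splits into one-dimensional Gamma and Gaussian
  integrals.  If y = L L^H is instead decomposed starting from the last row, then G = (L^H)^(-1) is
  lower triangular, and x = G x' G^H turns the integral of e^(-tr xy) Delta_s(x) over x into
  Gamma_M(s) times powers of the pivots of y.

  For constant exponents, Gamma_M(2a) det(z)^(-2a) is the integral of e^(-tr zy) det(y)^(2a) over y.
  At z = x_i + x_j this writes the kernel as an L^2 inner product of the functions
  det(x_i)^a e^(-tr x_i y), which is its positivity.  At z = 1 + x, integrating against
  det(x)^a Delta_s(x) and exchanging the two integrals gives a Beta integral, a product of two
  Gamma_M values.  The average over U in the spherical function drops out, as f and the volume are
  invariant under U.
*)
theory Submission
  imports Defs "HOL-Probability.Probability"
begin

text \<open>The square root and the Haar measure are given by definite descriptions, so existence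
  and uniqueness of both have to be proved before either can be used. All questions of absolute
  convergence reduce to exact evaluations: determinants and leading minors are positive on M, so the
  absolute value of the Beta integrand is the same integrand with every exponent replaced by its
  real part, and the hypothesis of Fubini's theorem is the real case of the computation itself. The
  evaluation of the integral of f(x) Delta_s(x) converges when k - 1 < Re s_k + \<alpha> and Re s_k
  < \<alpha> + k - N for all k. Integrability of f is the case s = 0; the first condition at k = N
  and the second at k = 1 then both read \<alpha> > N - 1, which is the origin of the bound. The
  spherical transform is the case s = \<delta> - i t of the same formula.\<close>

type_synonym 'n cmat = "((complex, 'n) vec, 'n) vec"

subsection \<open>Matrices and positive definiteness\<close>

lemma ctranspose_nth [simp]: "ctranspose A $ i $ j = cnj (A $ j $ i)"
  by (simp add: ctranspose_def)

lemma ctranspose_ctranspose [simp]: "ctranspose (ctranspose A) = A"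
  by (simp add: vec_eq_iff)

lemma ctranspose_mult: "ctranspose (A ** B) = ctranspose B ** ctranspose A"
  by (simp add: vec_eq_iff matrix_matrix_mult_def cnj_sum mult.commute)

lemma ctranspose_mat_1 [simp]: "ctranspose (mat 1) = mat 1"
  by (simp add: vec_eq_iff mat_def)

lemma ctranspose_add: "ctranspose (A + B) = ctranspose A + ctranspose B"
  by (simp add: vec_eq_iff)

lemma ctranspose_diff: "ctranspose (A - B) = ctranspose A - ctranspose B"
  by (simp add: vec_eq_iff)

lemma ctranspose_scaleR: "ctranspose (c *\<^sub>R A) = c *\<^sub>R ctranspose A"
  by (simp add: vec_eq_iff)

lemma det_ctranspose: "det (ctranspose A) = cnj (det A)"
proof -
  have "det (ctranspose A) = det (\<chi> i j. cnj (A $ i $ j))"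
    by (subst det_transpose [symmetric]) (simp add: transpose_def ctranspose_def)
  also have "\<dots> = cnj (det A)"
    by (simp add: det_def cnj_sum cnj_prod)
  finally show ?thesis .
qed

lemma inner_complex_vec: "v \<bullet> w = Re (\<Sum>i\<in>UNIV. cnj (v $ i) * w $ i)" for v w :: "complex^'n"
  by (simp add: inner_vec_def inner_complex_def)

lemma quadratic_form_eq_inner:
  "Re (\<Sum>i\<in>UNIV. \<Sum>j\<in>UNIV. cnj (v $ i) * x $ i $ j * v $ j) = v \<bullet> (x *v v)"
  for x :: "complex^'n^'n"
  by (simp add: inner_complex_vec matrix_vector_mult_def sum_distrib_left mult.assoc)

lemma inner_ctranspose: "v \<bullet> (ctranspose A *v w) = (A *v v) \<bullet> w" for A :: "complex^'n^'m"
proof -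
  have "(\<Sum>i\<in>UNIV. cnj (v $ i) * (\<Sum>j\<in>UNIV. cnj (A $ j $ i) * w $ j))
      = (\<Sum>i\<in>UNIV. \<Sum>j\<in>UNIV. cnj (v $ i) * cnj (A $ j $ i) * w $ j)"
    by (simp add: sum_distrib_left mult.assoc)
  also have "\<dots> = (\<Sum>j\<in>UNIV. \<Sum>i\<in>UNIV. cnj (v $ i) * cnj (A $ j $ i) * w $ j)"
    by (rule sum.swap)
  also have "\<dots> = (\<Sum>j\<in>UNIV. cnj (\<Sum>i\<in>UNIV. A $ j $ i * v $ i) * w $ j)"
    by (simp add: sum_distrib_left sum_distrib_right cnj_sum mult_ac)
  finally show ?thesis
    by (simp add: inner_complex_vec matrix_vector_mult_def)
qed

lemma hpd_iff:
  "x \<in> hpd \<longleftrightarrow> ctranspose x = x \<and> (\<forall>v. v \<noteq> 0 \<longrightarrow> 0 < v \<bullet> (x *v v))" for x :: "complex^'n^'n"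
  unfolding hpd_def quadratic_form_eq_inner by simp

lemma hpd_ctranspose: "x \<in> hpd \<Longrightarrow> ctranspose x = x"
  by (simp add: hpd_iff)

lemma hpd_inner_pos: "x \<in> hpd \<Longrightarrow> v \<noteq> 0 \<Longrightarrow> 0 < v \<bullet> (x *v v)"
  by (simp add: hpd_iff)

lemma mat_1_hpd [simp]: "mat 1 \<in> hpd"
  by (simp add: hpd_iff)

lemma hpd_add: "x \<in> hpd \<Longrightarrow> y \<in> hpd \<Longrightarrow> x + y \<in> hpd"
  by (auto simp: hpd_iff ctranspose_add matrix_vector_mult_add_rdistrib inner_add_right intro: add_pos_pos)

lemma matrix_vector_mult_scaleR_left: "(c *\<^sub>R A) *v v = c *\<^sub>R (A *v v)" for A :: "complex^'n^'m"
  by (simp add: vec_eq_iff matrix_vector_mult_def scaleR_sum_right)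

lemma hpd_scaleR: "x \<in> hpd \<Longrightarrow> 0 < c \<Longrightarrow> c *\<^sub>R x \<in> hpd"
  by (simp add: hpd_iff ctranspose_scaleR matrix_vector_mult_scaleR_left)

lemma convex_hpd: "convex (hpd :: (complex^'n^'n) set)"
proof (rule convexI)
  fix x y :: "complex^'n^'n" and u v :: real
  assume *: "x \<in> hpd" "y \<in> hpd" "0 \<le> u" "0 \<le> v" "u + v = 1"
  then consider "u = 0" "v = 1" | "v = 0" "u = 1" | "u > 0" "v > 0"
    by (cases "u = 0"; cases "v = 0") auto
  then show "u *\<^sub>R x + v *\<^sub>R y \<in> hpd"
    using * by cases (auto intro: hpd_add hpd_scaleR)
qed

lemma invertible_iff_inj: "invertible A \<longleftrightarrow> (\<forall>v. A *v v = 0 \<longrightarrow> v = 0)" for A :: "complex^'n^'n"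
  using matrix_left_invertible_ker[of A] invertible_left_inverse[of A] by simp

lemma hpd_invertible: "x \<in> hpd \<Longrightarrow> invertible x" for x :: "complex^'n^'n"
  unfolding invertible_iff_inj using hpd_inner_pos by fastforce

lemma act_hpd:
  assumes "x \<in> hpd" "invertible g"
  shows "act g x \<in> hpd"
proof -
  have "invertible (ctranspose g)"
    using \<open>invertible g\<close> by (simp add: invertible_det_nz det_ctranspose)
  then have "v \<noteq> 0 \<Longrightarrow> ctranspose g *v v \<noteq> 0" for v
    unfolding invertible_iff_inj by blast
  moreover have "v \<bullet> (act g x *v v) = (ctranspose g *v v) \<bullet> (x *v (ctranspose g *v v))" for v
    using inner_ctranspose[of v "ctranspose g" "x *v (ctranspose g *v v)"]
    by (simp add: act_def matrix_vector_mul_assoc matrix_mul_assoc)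
  ultimately show ?thesis
    using assms by (simp add: hpd_iff act_def ctranspose_mult matrix_mul_assoc)
qed

lemma act_act: "act g (act h x) = act (g ** h) x"
  by (simp add: act_def ctranspose_mult matrix_mul_assoc)

lemma matrix_add_rdistrib: "(A + B) ** C = A ** C + B ** C" for A :: "complex^'n^'m"
  by (simp add: vec_eq_iff matrix_matrix_mult_def distrib_right sum.distrib)

lemma act_add: "act g (x + y) = act g x + act g y"
  by (simp add: act_def matrix_add_ldistrib matrix_add_rdistrib)

lemma act_mat_1_left [simp]: "act (mat 1) x = x"
  by (simp add: act_def)

lemma act_hpd_iff: "invertible g \<Longrightarrow> act g x \<in> hpd \<longleftrightarrow> x \<in> hpd"
proof
  assume g: "invertible g" and "act g x \<in> hpd"
  obtain h where h: "h ** g = mat 1" "g ** h = mat 1"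
    using g by (auto simp: invertible_def)
  then have "invertible h" by (auto simp: invertible_def)
  then have "act h (act g x) \<in> hpd"
    using \<open>act g x \<in> hpd\<close> act_hpd by blast
  then show "x \<in> hpd" by (simp add: act_act h)
qed (rule act_hpd)

lemma det_act: "det (act g x) = of_real ((cmod (det g))\<^sup>2) * det x"
  unfolding complex_norm_square by (simp add: act_def det_mul det_ctranspose)

section \<open>Continuity of matrix operations, and the sign of the determinant\<close>

lemma continuous_on_matrix_mult [continuous_intros]:
  fixes A :: "'a::topological_space \<Rightarrow> 'b::real_normed_field^'n^'m"
  assumes "continuous_on S A" "continuous_on S B"
  shows "continuous_on S (\<lambda>x. A x ** B x)"
  unfolding matrix_matrix_mult_def
  by (intro continuous_intros continuous_on_vec_lambda assms continuous_on_component)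

lemma continuous_on_det [continuous_intros]:
  fixes f :: "'a::topological_space \<Rightarrow> 'b::real_normed_field^'n^'n"
  assumes "continuous_on S f"
  shows "continuous_on S (\<lambda>x. det (f x))"
  unfolding det_def by (intro continuous_intros assms)

lemma continuous_on_ctranspose [continuous_intros]:
  "continuous_on S f \<Longrightarrow> continuous_on S (\<lambda>x. ctranspose (f x))"
  unfolding ctranspose_def by (intro continuous_intros continuous_on_vec_lambda)

lemma continuous_on_matrix_vector_mult [continuous_intros]:
  fixes A :: "'a::topological_space \<Rightarrow> 'b::real_normed_field^'n^'m"
  assumes "continuous_on S A" "continuous_on S v"
  shows "continuous_on S (\<lambda>x. A x *v v x)"
  unfolding matrix_vector_mult_def
  by (intro continuous_intros continuous_on_vec_lambda assms continuous_on_component)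

text \<open>A Hermitian matrix has a determinant equal to its own conjugate. Positivity needs no
  eigenvalues: on the segment from the identity to x, which stays in the convex set
  \<open>hpd\<close>, the determinant is continuous, starts at 1 and never vanishes.\<close>

lemma hpd_det_pos:
  fixes x :: "complex^'n^'n"
  assumes "x \<in> hpd"
  shows "Im (det x) = 0" "0 < Re (det x)"
proof -
  have real: "Im (det y) = 0" if "y \<in> hpd" for y :: "complex^'n^'n"
    using det_ctranspose[of y] that by (simp add: hpd_ctranspose complex_eq_iff)
  show "Im (det x) = 0" by (rule real) fact
  define p where "p = (\<lambda>s::real. (1 - s) *\<^sub>R mat 1 + s *\<^sub>R x)"
  have p: "p s \<in> hpd" if "0 \<le> s" "s \<le> 1" for s
    unfolding p_def using convexD[OF convex_hpd mat_1_hpd assms] that by auto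
  have cont: "continuous_on {0..1} (\<lambda>s. Re (det (p s)))"
    unfolding p_def by (intro continuous_intros)
  have nz: "Re (det (p s)) \<noteq> 0" if "0 \<le> s" "s \<le> 1" for s
    using p[OF that] hpd_invertible real by (metis complex_eq_iff invertible_det_nz zero_complex.simps)
  show "0 < Re (det x)"
  proof (rule ccontr)
    assume "\<not> 0 < Re (det x)"
    then have "Re (det (p 1)) \<le> 0" "0 \<le> Re (det (p 0))"
      by (auto simp: p_def)
    then obtain s where "0 \<le> s" "s \<le> 1" "Re (det (p s)) = 0"
      using IVT2'[of "\<lambda>s. Re (det (p s))" 1 0 0] cont by auto
    then show False using nz by blast
  qed
qed

lemma hpd_det_eq: "x \<in> hpd \<Longrightarrow> det x = of_real (Re (det x))"
  using hpd_det_pos(1) by (simp add: complex_eq_iff)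

subsection \<open>Square roots\<close>

lemma inner_matrix_eq_trace: "A \<bullet> B = Re (trace (ctranspose A ** B))" for A B :: "complex^'n^'m"
proof -
  have "A \<bullet> B = (\<Sum>i\<in>UNIV. \<Sum>j\<in>UNIV. Re (cnj (A $ i $ j) * B $ i $ j))"
    by (simp add: inner_vec_def inner_complex_def)
  also have "\<dots> = (\<Sum>j\<in>UNIV. \<Sum>i\<in>UNIV. Re (cnj (A $ i $ j) * B $ i $ j))"
    by (rule sum.swap)
  finally show ?thesis
    by (simp add: trace_def matrix_matrix_mult_def)
qed

text \<open>The Frobenius form is the sum of the quadratic forms of y at the columns of w, and some
  column is nonzero.\<close>

lemma hpd_inner_matrix_pos:
  fixes y :: "complex^'n^'n" and w :: "complex^'m^'n"
  assumes "y \<in> hpd" "w \<noteq> 0"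
  shows "0 < w \<bullet> (y ** w)"
proof -
  have "w \<bullet> (y ** w) = (\<Sum>i\<in>UNIV. \<Sum>j\<in>UNIV. w $ i $ j \<bullet> (y ** w) $ i $ j)"
    by (simp add: inner_vec_def)
  also have "\<dots> = (\<Sum>j\<in>UNIV. \<Sum>i\<in>UNIV. w $ i $ j \<bullet> (y ** w) $ i $ j)"
    by (rule sum.swap)
  also have "\<dots> = (\<Sum>j\<in>UNIV. column j w \<bullet> (y *v column j w))"
    by (simp add: inner_vec_def column_def matrix_matrix_mult_def matrix_vector_mult_def)
  also have "0 < \<dots>"
  proof -
    obtain j where "column j w \<noteq> 0"
      using \<open>w \<noteq> 0\<close> by (auto simp: vec_eq_iff column_def)
    then have "0 < column j w \<bullet> (y *v column j w)"
      using hpd_inner_pos assms by blast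
    moreover have "0 \<le> column j w \<bullet> (y *v column j w)" for j
      using hpd_inner_pos[OF \<open>y \<in> hpd\<close>, of "column j w"] by (cases "column j w = 0") auto
    ultimately show ?thesis
      by (intro sum_pos2[of _ j]) auto
  qed
  finally show ?thesis .
qed

lemma matrix_diff_ldistrib: "A ** (B - C) = A ** B - A ** C" for A :: "complex^'n^'m"
  by (simp add: vec_eq_iff matrix_matrix_mult_def right_diff_distrib sum_subtractf)

lemma matrix_diff_rdistrib: "(A - B) ** C = A ** C - B ** C" for A :: "complex^'n^'m"
  by (simp add: vec_eq_iff matrix_matrix_mult_def left_diff_distrib sum_subtractf)

lemma trace_zero [simp]: "trace (0 :: complex^'n^'n) = 0"
  by (simp add: trace_def)

text \<open>The difference w = y - z satisfies y w + w z = 0. Multiplying by w and taking the trace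
  gives the Frobenius forms of y and of z at w, which would both be positive if w were
  nonzero.\<close>

lemma hpd_square_inj:
  fixes y z :: "complex^'n^'n"
  assumes "y \<in> hpd" "z \<in> hpd" "y ** y = z ** z"
  shows "y = z"
proof (rule ccontr)
  assume "y \<noteq> z"
  define w where "w = y - z"
  have w: "w \<noteq> 0" "ctranspose w = w"
    using \<open>y \<noteq> z\<close> assms by (auto simp: w_def ctranspose_diff hpd_ctranspose)
  have "y ** w + w ** z = 0"
    using assms(3) by (simp add: w_def matrix_diff_ldistrib matrix_diff_rdistrib)
  then have "0 = Re (trace (w ** (y ** w + w ** z)))"
    by simp
  also have "\<dots> = Re (trace (w ** (y ** w))) + Re (trace (w ** (w ** z)))"
    by (simp add: matrix_add_ldistrib trace_add)
  also have "trace (w ** (w ** z)) = trace (w ** (z ** w))"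
    using trace_mul_sym[of w "w ** z"] by (simp add: matrix_mul_assoc)
  also have "Re (trace (w ** (y ** w))) + Re (trace (w ** (z ** w))) = w \<bullet> (y ** w) + w \<bullet> (z ** w)"
    by (simp add: inner_matrix_eq_trace w)
  also have "\<dots> > 0"
    using hpd_inner_matrix_pos w assms by (intro add_pos_pos) auto
  finally show False by simp
qed

abbreviation hermitian_matrices :: "(complex^'n^'n) set" where
  "hermitian_matrices \<equiv> {x. ctranspose x = x}"

lemma subspace_hermitian: "subspace hermitian_matrices"
  by (auto simp: subspace_def ctranspose_add ctranspose_scaleR vec_eq_iff)

lemma hpd_subset_hermitian: "hpd \<subseteq> hermitian_matrices"
  by (auto simp: hpd_iff)

lemma matrix_vector_mult_scaleR_right: "A *v (c *\<^sub>R v) = c *\<^sub>R (A *v v)" for A :: "complex^'n^'m"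
  by (simp add: vec_eq_iff matrix_vector_mult_def scaleR_sum_right)

text \<open>By homogeneity, positivity of the form needs testing only on the unit sphere. The sphere
  is compact, so the matrices that fail the test form the projection of a closed set along a compact
  factor, which is closed.\<close>

lemma hpd_eq_open_Int: "\<exists>T. open T \<and> (hpd :: (complex^'n^'n) set) = hermitian_matrices \<inter> T"
proof (intro exI conjI)
  let ?B = "{x :: complex^'n^'n. \<exists>v. v \<in> sphere 0 1 \<and> (v, x) \<in> {(v, x). v \<bullet> (x *v v) \<le> 0}}"
  have "closed {(v :: complex^'n, x). v \<bullet> (x *v v) \<le> 0}"
    unfolding case_prod_unfold by (intro closed_Collect_le continuous_intros)
  then have "closed ?B"
    by (intro closed_compact_projection) auto
  then show "open (- ?B)" by blast
  have "x \<in> hpd \<longleftrightarrow> x \<in> hermitian_matrices \<inter> - ?B" for x :: "complex^'n^'n"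
  proof -
    have "v \<noteq> 0 \<longrightarrow> 0 < v \<bullet> (x *v v)" if *: "\<And>v. norm v = 1 \<Longrightarrow> 0 < v \<bullet> (x *v v)" for v
    proof
      assume "v \<noteq> 0"
      then have "0 < (norm v)\<^sup>2 * (((1 / norm v) *\<^sub>R v) \<bullet> (x *v ((1 / norm v) *\<^sub>R v)))"
        by (intro mult_pos_pos *) auto
      also have "x *v ((1 / norm v) *\<^sub>R v) = (1 / norm v) *\<^sub>R (x *v v)"
        by (simp add: vec_eq_iff matrix_vector_mult_def scaleR_sum_right)
      also have "(norm v)\<^sup>2 * (((1 / norm v) *\<^sub>R v) \<bullet> ((1 / norm v) *\<^sub>R (x *v v))) = v \<bullet> (x *v v)"
        using \<open>v \<noteq> 0\<close> by (simp add: power2_eq_square)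
      finally show "0 < v \<bullet> (x *v v)" .
    qed
    moreover have "v \<noteq> 0" if "norm v = 1" for v :: "complex^'n"
      using that by auto
    ultimately show ?thesis
      unfolding hpd_iff by (auto simp: not_le)
  qed
  then show "(hpd :: (complex^'n^'n) set) = hermitian_matrices \<inter> - ?B" by blast
qed

lemma openin_hpd: "openin (top_of_set hermitian_matrices) hpd"
  using hpd_eq_open_Int openin_open by blast

lemma square_hpd: "y \<in> hpd \<Longrightarrow> y ** y \<in> hpd"
  using act_hpd[OF mat_1_hpd hpd_invertible, of y] by (simp add: act_def hpd_ctranspose)

text \<open>\<open>hpd\<close> is open only relative to the real subspace of Hermitian matrices, and
  squaring maps this subspace to itself; hence invariance of domain is used in the form for
  subspaces.\<close>

lemma openin_square_image:
  assumes "openin (top_of_set hpd) U"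
  shows "openin (top_of_set (hpd :: (complex^'n^'n) set)) ((\<lambda>y. y ** y) ` U)"
proof -
  have U: "U \<subseteq> hpd" "openin (top_of_set hermitian_matrices) U"
    using assms openin_hpd openin_imp_subset openin_trans by blast+
  have "openin (top_of_set hermitian_matrices) ((\<lambda>y. y ** y) ` U)"
  proof (rule invariance_of_domain_subspaces)
    show "continuous_on U (\<lambda>y. y ** y)"
      by (intro continuous_intros)
    show "inj_on (\<lambda>y. y ** y) U"
      using U hpd_square_inj by (auto intro!: inj_onI)
    show "(\<lambda>y. y ** y) \<in> U \<rightarrow> hermitian_matrices"
      using U by (auto simp: ctranspose_mult hpd_ctranspose)
  qed (use U subspace_hermitian in auto)
  moreover have "(\<lambda>y. y ** y) ` U \<subseteq> hpd"
    using U(1) square_hpd by blast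
  ultimately show ?thesis
    by (rule openin_subset_trans[OF _ _ hpd_subset_hermitian])
qed

text \<open>Limits of elements of \<open>hpd\<close> are a priori only semidefinite. If the form
  vanishes at v, put w = y v; at v - t w the form equals -2 t |w|^2 + t^2 <w, y w>. Being
  nonnegative for all small t > 0, it forces w = 0, and then v = 0 by invertibility.\<close>

lemma psd_invertible_imp_hpd:
  fixes y :: "complex^'n^'n"
  assumes "ctranspose y = y" "\<And>v. 0 \<le> v \<bullet> (y *v v)" "invertible y"
  shows "y \<in> hpd"
proof -
  have "v = 0" if v: "v \<bullet> (y *v v) = 0" for v
  proof -
    define w where "w = y *v v"
    have le: "2 * (w \<bullet> w) \<le> t * (w \<bullet> (y *v w))" if "t > 0" for t
    proof -
      have "0 \<le> (v - t *\<^sub>R w) \<bullet> (y *v (v - t *\<^sub>R w))" by (rule assms)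
      also have "y *v (v - t *\<^sub>R w) = w - t *\<^sub>R (y *v w)"
        by (simp add: matrix_vector_mult_diff_distrib matrix_vector_mult_scaleR_right w_def[symmetric])
      also have "(v - t *\<^sub>R w) \<bullet> (w - t *\<^sub>R (y *v w)) = v \<bullet> w - t * (w \<bullet> w) - t * (v \<bullet> (y *v w)) + t * (t * (w \<bullet> (y *v w)))"
        by (simp add: inner_diff_left inner_diff_right algebra_simps)
      also have "v \<bullet> (y *v w) = w \<bullet> w"
        using inner_ctranspose[of v y w] assms(1) by (simp add: w_def)
      also have "v \<bullet> w = 0" by (simp add: w_def v)
      finally have "t * (2 * (w \<bullet> w)) \<le> t * (t * (w \<bullet> (y *v w)))" by simp
      then show ?thesis using \<open>t > 0\<close> by simp
    qed
    have "2 * (w \<bullet> w) \<le> 0"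
    proof (rule tendsto_lowerbound)
      show "((\<lambda>t. t * (w \<bullet> (y *v w))) \<longlongrightarrow> 0) (at_right 0)"
        by (auto intro!: tendsto_eq_intros)
      show "\<forall>\<^sub>F t in at_right 0. 2 * (w \<bullet> w) \<le> t * (w \<bullet> (y *v w))"
        using eventually_at_right_less[of 0] by (rule eventually_mono) (rule le)
    qed simp
    then have "w \<bullet> w = 0" using inner_ge_zero[of w] by linarith
    then have "w = 0" by simp
    then show "v = 0"
      using assms(3) by (simp add: w_def invertible_iff_inj)
  qed
  then show ?thesis
    using assms by (auto simp: hpd_iff less_le)
qed

(* Squaring is open (invariance of domain) and proper on the connected set hpd. *)
lemma square_image_hpd: "(\<lambda>y. y ** y) ` hpd = (hpd :: (complex^'n^'n) set)"
proof -
  let ?sq = "\<lambda>y. y ** y :: complex^'n^'n"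
  have cont: "continuous_on UNIV f \<Longrightarrow> a \<longlonglongrightarrow> l \<Longrightarrow> (\<lambda>n. f (a n)) \<longlonglongrightarrow> f l"
    for f :: "complex^'n^'n \<Rightarrow> 'b::topological_space" and a l
    by (metis continuous_on_eq_continuous_at isCont_tendsto_compose open_UNIV UNIV_I)
  have "l \<in> ?sq ` hpd" if x: "\<And>n. x n \<in> ?sq ` hpd" "x \<longlonglongrightarrow> l" and l: "l \<in> hpd" for x l
  proof -
    have "\<forall>n. \<exists>y. y \<in> hpd \<and> x n = y ** y"
      using x(1) by blast
    then obtain y where y: "\<And>n. y n \<in> hpd" "\<And>n. x n = y n ** y n"
      by metis
    \<comment> \<open>This is properness: the traces of a convergent sequence of squares bound the
      norms of the roots, so a subsequence of the roots converges.\<close>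
    have norm: "(norm (y n))\<^sup>2 = Re (trace (x n))" for n
      using inner_matrix_eq_trace[of "y n" "y n"] y by (simp add: hpd_ctranspose power2_norm_eq_inner)
    have "continuous_on UNIV (\<lambda>x :: complex^'n^'n. Re (trace x))"
      unfolding trace_def by (intro continuous_intros)
    then have "Bseq (\<lambda>n. Re (trace (x n)))"
      using convergent_imp_Bseq[OF convergentI] cont[OF _ x(2)] by blast
    then obtain C where "\<And>n. norm (Re (trace (x n))) \<le> C"
      using BseqE by metis
    then have "norm (y n) \<le> sqrt C" for n
      using norm[of n] by (intro real_le_rsqrt) (metis abs_le_D1 real_norm_def)
    then have "bounded (range y)"
      by (auto simp: bounded_iff)
    then obtain z r where r: "strict_mono r" and z: "(\<lambda>n. y (r n)) \<longlonglongrightarrow> z"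
      using bounded_imp_convergent_subsequence unfolding o_def by blast
    have "(\<lambda>n. y (r n) ** y (r n)) \<longlonglongrightarrow> z ** z"
      using z by (rule cont[rotated]) (intro continuous_intros)
    moreover have "(\<lambda>n. y (r n) ** y (r n)) \<longlonglongrightarrow> l"
      using LIMSEQ_subseq_LIMSEQ[OF x(2) r] y by (simp add: o_def)
    ultimately have zz: "z ** z = l" using LIMSEQ_unique by blast
    have "(\<lambda>n. ctranspose (y (r n))) \<longlonglongrightarrow> ctranspose z"
      using z by (rule cont[rotated]) (intro continuous_intros)
    then have 1: "ctranspose z = z"
      using z y LIMSEQ_unique by (simp add: hpd_ctranspose) blast
    have 2: "0 \<le> v \<bullet> (z *v v)" for v
    proof (rule LIMSEQ_le_const)
      show "(\<lambda>n. v \<bullet> (y (r n) *v v)) \<longlonglongrightarrow> v \<bullet> (z *v v)"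
        using z by (rule cont[rotated]) (intro continuous_intros)
      show "\<exists>N. \<forall>n\<ge>N. 0 \<le> v \<bullet> (y (r n) *v v)"
        using y hpd_inner_pos by (metis inner_zero_left less_le order_refl)
    qed
    have "invertible z"
      using hpd_invertible[OF l] by (simp add: zz[symmetric] invertible_det_nz det_mul)
    then have "z \<in> hpd"
      using 1 2 by (intro psd_invertible_imp_hpd)
    then show ?thesis using zz by auto
  qed
  then have "closedin (top_of_set hpd) (?sq ` hpd)"
    using square_hpd unfolding closedin_closed
    by (intro exI[of _ "closure (?sq ` hpd)"]) (use closure_subset in \<open>fastforce simp: closure_sequential\<close>)
  moreover have "openin (top_of_set hpd) (?sq ` hpd)"
    by (rule openin_square_image) simp
  ultimately show ?thesis
    using convex_connected[OF convex_hpd] mat_1_hpd unfolding connected_clopen by blast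
qed

lemma hpd_sqrt:
  assumes "x \<in> hpd"
  shows "hpd_sqrt x \<in> hpd" "hpd_sqrt x ** hpd_sqrt x = x"
proof -
  have "\<exists>!y. y \<in> hpd \<and> y ** y = x"
  proof -
    have "x \<in> (\<lambda>y. y ** y) ` hpd"
      using assms by (simp add: square_image_hpd)
    then obtain y where "y \<in> hpd" "x = y ** y" by (rule imageE)
    then show ?thesis using hpd_square_inj by (intro ex1I[of _ y]) auto
  qed
  then show "hpd_sqrt x \<in> hpd" "hpd_sqrt x ** hpd_sqrt x = x"
    unfolding hpd_sqrt_def using theI'[of "\<lambda>y. y \<in> hpd \<and> y ** y = x"] by auto
qed

lemma hpd_sqrt_unique: "y \<in> hpd \<Longrightarrow> hpd_sqrt (y ** y) = y"
  using hpd_sqrt hpd_square_inj square_hpd by blast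

text \<open>An open continuous bijection has a continuous inverse. Continuity of the root is what
  makes the polar decomposition measurable when the Haar measure is constructed.\<close>

lemma continuous_on_hpd_sqrt: "continuous_on hpd (hpd_sqrt :: complex^'n^'n \<Rightarrow> _)"
  by (rule continuous_on_inverse_open_map[of hpd "\<lambda>y. y ** y"])
    (auto simp: square_image_hpd hpd_sqrt_unique openin_square_image intro!: continuous_intros)

section \<open>Inverses and inverse square roots\<close>

lemma matrix_inv_mult:
  assumes "invertible A"
  shows "A ** matrix_inv A = mat 1" "matrix_inv A ** A = mat 1"
  using assms unfolding invertible_def matrix_inv_def by (metis (mono_tags, lifting) someI_ex)+

lemma matrix_inv_unique:
  fixes A B :: "'a::field^'n^'n"
  assumes "A ** B = mat 1"
  shows "matrix_inv A = B"
proof -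
  have "B ** A = mat 1"
    using assms by (simp add: matrix_left_right_inverse)
  then have "matrix_inv A ** A = mat 1"
    using assms by (intro matrix_inv_mult) (auto simp: invertible_def)
  then have "matrix_inv A = matrix_inv A ** (A ** B)"
    by (simp add: assms)
  also have "\<dots> = B"
    by (simp add: matrix_mul_assoc \<open>matrix_inv A ** A = mat 1\<close>)
  finally show ?thesis .
qed

lemma hpd_matrix_inv:
  assumes "x \<in> hpd"
  shows "matrix_inv x \<in> hpd"
proof -
  have "matrix_inv x ** x = mat 1" "x ** matrix_inv x = mat 1"
    using assms hpd_invertible matrix_inv_mult by blast+
  moreover from this have "ctranspose (matrix_inv x) = matrix_inv x"
    by (metis assms ctranspose_mat_1 ctranspose_mult hpd_ctranspose matrix_inv_unique)
  moreover have "invertible (matrix_inv x)"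
    using calculation unfolding invertible_def by blast
  ultimately show ?thesis
    using act_hpd[OF assms, of "matrix_inv x"] by (simp add: act_def)
qed

lemma inv_sqrt:
  assumes "x \<in> hpd"
  shows "inv_sqrt x \<in> hpd" "act (inv_sqrt x) x = mat 1"
proof -
  let ?q = "hpd_sqrt x"
  have q: "inv_sqrt x ** ?q = mat 1" "?q ** inv_sqrt x = mat 1"
    unfolding inv_sqrt_def using hpd_sqrt[OF assms] hpd_invertible matrix_inv_mult by blast+
  show i: "inv_sqrt x \<in> hpd"
    unfolding inv_sqrt_def using hpd_sqrt assms hpd_matrix_inv by blast
  have "act (inv_sqrt x) x = (inv_sqrt x ** ?q) ** (?q ** inv_sqrt x)"
    using hpd_sqrt(2)[OF assms] by (metis act_def hpd_ctranspose i matrix_mul_assoc)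
  then show "act (inv_sqrt x) x = mat 1"
    by (simp add: q)
qed

subsection \<open>Triangular and linear changes of variables\<close>

lemma prod_Basis_vec: "(\<Prod>b\<in>Basis. x \<bullet> b) = (\<Prod>i\<in>UNIV. x $ i)" for x :: "real^'m"
proof -
  have inj: "inj (\<lambda>i::'m. axis i (1::real))"
    by (auto intro!: injI simp: axis_eq_axis)
  have Basis: "Basis = range (\<lambda>i::'m. axis i (1::real))"
    by (auto simp: Basis_vec_def)
  show ?thesis
    unfolding Basis by (simp add: prod.reindex[OF inj] inner_axis)
qed

lemma box_vec: "box l u = {x. \<forall>i. x $ i \<in> box (l $ i) (u $ i)}" for l u :: "real^'m"
  by (auto simp: mem_box_cart)

lemma measurable_vec_lambda [measurable]:
  "vec_lambda \<in> measurable (PiM UNIV (\<lambda>_::'m::finite. lborel :: real measure)) borel"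
proof (rule borel_measurable_euclidean_space[THEN iffD2], rule ballI)
  fix b :: "real^'m" assume "b \<in> Basis"
  then obtain i where "b = axis i 1" by (auto simp: Basis_vec_def)
  then show "(\<lambda>x. vec_lambda x \<bullet> b) \<in> borel_measurable (PiM UNIV (\<lambda>_. lborel))"
    by (simp add: inner_axis)
qed

text \<open>The two measures agree on boxes. The product form allows a single coordinate to be
  integrated with the others held fixed.\<close>

lemma lborel_vec_eq_distr_PiM:
  "(lborel :: (real^'m) measure) = distr (PiM UNIV (\<lambda>_. lborel)) borel vec_lambda"
proof (rule lborel_eqI)
  interpret product_sigma_finite "\<lambda>_::'m. lborel :: real measure" ..
  fix l u :: "real^'m" assume le: "\<And>b. b \<in> Basis \<Longrightarrow> l \<bullet> b \<le> u \<bullet> b"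
  have le': "l $ i \<le> u $ i" for i
    using le[of "axis i 1"] by (simp add: inner_axis)
  have "vec_lambda -` box l u = PiE UNIV (\<lambda>i. box (l $ i) (u $ i))"
    by (auto simp: box_vec PiE_def)
  then have "emeasure (distr (PiM UNIV (\<lambda>_. lborel)) borel vec_lambda) (box l u)
      = emeasure (PiM UNIV (\<lambda>_. lborel)) (PiE UNIV (\<lambda>i. box (l $ i) (u $ i)))"
    by (subst emeasure_distr) (auto simp: space_PiM)
  also have "\<dots> = (\<Prod>i\<in>UNIV. emeasure lborel (box (l $ i) (u $ i)))"
    by (subst emeasure_PiM) auto
  also have "\<dots> = (\<Prod>i\<in>UNIV. ennreal ((u - l) $ i))"
    using le' by (intro prod.cong) auto
  also have "\<dots> = ennreal (\<Prod>b\<in>Basis. (u - l) \<bullet> b)"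
    using le' by (subst prod_Basis_vec) (simp add: prod_ennreal)
  finally show "emeasure (distr (PiM UNIV (\<lambda>_. lborel)) borel vec_lambda) (box l u)
      = (\<Prod>b\<in>Basis. (u - l) \<bullet> b)" .
qed simp

text \<open>Fubini isolates the coordinate p. The scale and the shift do not depend on it, so for
  fixed other coordinates the substitution is affine in one real variable.\<close>

lemma nn_integral_PiM_single_coordinate:
  fixes s h :: "('p::finite \<Rightarrow> real) \<Rightarrow> real"
  defines "M \<equiv> PiM UNIV (\<lambda>_::'p. lborel :: real measure)"
  assumes [measurable]: "F \<in> borel_measurable M" "s \<in> borel_measurable M" "h \<in> borel_measurable M"
    and s: "\<And>a. s a \<noteq> 0"
    and indep: "\<And>a y. s (a(p := y)) = s a" "\<And>a y. h (a(p := y)) = h a"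
  shows "(\<integral>\<^sup>+a. F (a(p := s a * a p + h a)) * ennreal \<bar>s a\<bar> \<partial>M) = (\<integral>\<^sup>+a. F a \<partial>M)"
proof -
  interpret product_sigma_finite "\<lambda>_::'p. lborel :: real measure" ..
  have M: "M = PiM (insert p (UNIV - {p})) (\<lambda>_. lborel)"
    by (simp add: M_def insert_absorb)
  have [measurable]: "(\<lambda>a. a i) \<in> borel_measurable M" for i by (simp add: M_def)
  have upd [measurable]: "(\<lambda>a. a(p := y a)) \<in> measurable M M" if [measurable]: "y \<in> borel_measurable M" for y
    unfolding M_def by (rule measurable_PiM_single') (auto simp: space_PiM M_def[symmetric])
  have upd1: "(\<lambda>y. a(p := y)) \<in> measurable lborel M" for a
    unfolding M_def by (rule measurable_PiM_single') (auto simp: space_PiM)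
  have "(\<integral>\<^sup>+a. F (a(p := s a * a p + h a)) * ennreal \<bar>s a\<bar> \<partial>M)
     = (\<integral>\<^sup>+a. (\<integral>\<^sup>+y. F (a(p := s a * y + h a)) * ennreal \<bar>s a\<bar> \<partial>lborel) \<partial>PiM (UNIV - {p}) (\<lambda>_. lborel))"
  proof -
    have "(\<lambda>a. F (a(p := s a * a p + h a)) * ennreal \<bar>s a\<bar>) \<in> borel_measurable (PiM (insert p (UNIV - {p})) (\<lambda>_. lborel))"
      unfolding M[symmetric] by measurable
    then show ?thesis
      unfolding M by (subst product_nn_integral_insert) (auto simp: indep)
  qed
  also have "\<dots> = (\<integral>\<^sup>+a. (\<integral>\<^sup>+y. F (a(p := y)) \<partial>lborel) \<partial>PiM (UNIV - {p}) (\<lambda>_. lborel))"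
  proof (rule nn_integral_cong)
    fix a
    have [measurable]: "(\<lambda>y. F (a(p := y))) \<in> borel_measurable lborel"
      using upd1 by (rule measurable_compose) fact
    show "(\<integral>\<^sup>+y. F (a(p := s a * y + h a)) * ennreal \<bar>s a\<bar> \<partial>lborel) = (\<integral>\<^sup>+y. F (a(p := y)) \<partial>lborel)"
    proof -
      have "(\<lambda>y. (\<lambda>y. F (a(p := y))) (h a + s a * y)) \<in> borel_measurable lborel"
        by measurable
      then have "(\<integral>\<^sup>+y. F (a(p := h a + s a * y)) * ennreal \<bar>s a\<bar> \<partial>lborel)
        = ennreal \<bar>s a\<bar> * (\<integral>\<^sup>+y. F (a(p := h a + s a * y)) \<partial>lborel)"
        by (subst nn_integral_multc) (auto simp: mult.commute)
      also have "\<dots> = (\<integral>\<^sup>+y. F (a(p := y)) \<partial>lborel)"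
        using s[of a] by (intro nn_integral_real_affine[symmetric]) auto
      finally show ?thesis by (simp only: add.commute)
    qed
  qed
  also have "\<dots> = (\<integral>\<^sup>+a. F a \<partial>M)"
  proof -
    have "F \<in> borel_measurable (PiM (insert p (UNIV - {p})) (\<lambda>_. lborel))"
      unfolding M[symmetric] by measurable
    then show ?thesis
      unfolding M by (subst product_nn_integral_insert) auto
  qed
  finally show ?thesis .
qed

text \<open>The hypotheses say that the scale and the shift at p depend only on coordinates of
  strictly smaller rank. Enlarging A by a coordinate p of top rank, the substitution at p leaves the
  scales and shifts of A alone. So the enlarged map is a substitution in p alone followed by
  \<open>T A\<close>, and the factors multiply.\<close>

lemma nn_integral_PiM_triangular:
  fixes s h :: "'p::finite \<Rightarrow> ('p \<Rightarrow> real) \<Rightarrow> real" and rank :: "'p \<Rightarrow> nat"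
  defines "M \<equiv> PiM UNIV (\<lambda>_::'p. lborel :: real measure)"
  assumes [measurable]: "F \<in> borel_measurable M"
    and meas [measurable]: "\<And>p. s p \<in> borel_measurable M" "\<And>p. h p \<in> borel_measurable M"
    and s: "\<And>p a. s p a \<noteq> 0"
    and indep: "\<And>p q a y. rank p \<le> rank q \<Longrightarrow> s p (a(q := y)) = s p a"
               "\<And>p q a y. rank p \<le> rank q \<Longrightarrow> h p (a(q := y)) = h p a"
  shows "(\<integral>\<^sup>+a. F (\<lambda>p. s p a * a p + h p a) * ennreal (\<Prod>p\<in>UNIV. \<bar>s p a\<bar>) \<partial>M) = (\<integral>\<^sup>+a. F a \<partial>M)"
proof -
  define T where "T = (\<lambda>A a p. if p \<in> A then s p a * a p + h p a else a p)"
  have [measurable]: "(\<lambda>a. a p) \<in> borel_measurable M" for p by (simp add: M_def)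
  have T [measurable]: "T A \<in> measurable M M" for A
    unfolding T_def
    by (subst (2) M_def, rule measurable_PiM_single') (auto simp: space_PiM)
  have "(\<integral>\<^sup>+a. F (T A a) * ennreal (\<Prod>p\<in>A. \<bar>s p a\<bar>) \<partial>M) = (\<integral>\<^sup>+a. F a \<partial>M)" for A
    using finite[of A]
  proof (induction A rule: finite_ranking_induct[where f = rank])
    case empty
    then show ?case by (simp add: T_def)
  next
    case (insert p A)
    show ?case
    proof (cases "p \<in> A")
      case True
      then show ?thesis using insert by (simp add: insert_absorb)
    next
      case False
      let ?st = "\<lambda>a. a(p := s p a * a p + h p a)"
      have *: "s q (?st a) = s q a" "h q (?st a) = h q a" if "q \<in> A" for q a
        using insert that indep by auto
      have "T A (?st a) = T (insert p A) a" for a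
        using False by (auto simp: T_def * fun_eq_iff)
      moreover have "(\<Prod>q\<in>insert p A. \<bar>s q a\<bar>) = \<bar>s p a\<bar> * (\<Prod>q\<in>A. \<bar>s q (?st a)\<bar>)" for a
        using False insert by (simp add: * cong: prod.cong)
      ultimately have "(\<integral>\<^sup>+a. F (T (insert p A) a) * ennreal (\<Prod>q\<in>insert p A. \<bar>s q a\<bar>) \<partial>M)
        = (\<integral>\<^sup>+a. F (T A (?st a)) * ennreal (\<Prod>q\<in>A. \<bar>s q (?st a)\<bar>) * ennreal \<bar>s p a\<bar> \<partial>M)"
        by (simp add: ennreal_mult prod_nonneg mult_ac)
      also have "\<dots> = (\<integral>\<^sup>+a. F (T A a) * ennreal (\<Prod>q\<in>A. \<bar>s q a\<bar>) \<partial>M)"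
        unfolding M_def
        by (rule nn_integral_PiM_single_coordinate
            [where F = "\<lambda>a. F (T A a) * ennreal (\<Prod>q\<in>A. \<bar>s q a\<bar>)" and s = "s p" and h = "h p"])
          (use s indep in \<open>auto simp: M_def[symmetric]\<close>)
      also note insert.IH
      finally show ?thesis .
    qed
  qed
  from this[of UNIV] show ?thesis
    by (simp add: T_def)
qed

lemma nn_integral_lborel_vec:
  fixes F :: "real^'m \<Rightarrow> ennreal"
  assumes "F \<in> borel_measurable borel"
  shows "(\<integral>\<^sup>+x. F x \<partial>lborel) = (\<integral>\<^sup>+a. F (vec_lambda a) \<partial>PiM UNIV (\<lambda>_. lborel))"
  using assms by (subst lborel_vec_eq_distr_PiM) (simp add: nn_integral_distr)

section \<open>Linear changes of variables\<close>

lemma borel_measurable_linear: "linear f \<Longrightarrow> f \<in> borel_measurable borel"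
  for f :: "'a::euclidean_space \<Rightarrow> 'b::euclidean_space"
  using linear_continuous_on linear_linear borel_measurable_continuous_onI by blast

lemma lborel_distr_transpose:
  "distr lborel borel (\<lambda>v::real^'m. \<chi> i. v $ Transposition.transpose m n i) = lborel"
proof (rule lborel_eqI[symmetric])
  let ?h = "\<lambda>v::real^'m. \<chi> i. v $ Transposition.transpose m n i"
  have lin: "linear ?h"
    by (rule linearI) (simp_all add: plus_vec_def scaleR_vec_def)
  fix l u :: "real^'m" assume le: "\<And>b. b \<in> Basis \<Longrightarrow> l \<bullet> b \<le> u \<bullet> b"
  have le': "l $ i \<le> u $ i" for i
    using le[of "axis i 1"] by (simp add: inner_axis)
  have "?h -` box l u = box (?h l) (?h u)"
    by (auto simp: mem_box_cart) (metis transpose_involutory)+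
  then have "emeasure (distr lborel borel ?h) (box l u) = emeasure lborel (box (?h l) (?h u))"
    using borel_measurable_linear[OF lin] by (subst emeasure_distr) auto
  also have "\<dots> = (\<Prod>b\<in>Basis. (?h u - ?h l) \<bullet> b)"
    using le' by (intro emeasure_lborel_box) (auto simp: Basis_vec_def inner_axis)
  also have "(\<Prod>b\<in>Basis. (?h u - ?h l) \<bullet> b) = (\<Prod>i\<in>UNIV. (u - l) $ (Transposition.transpose m n i))"
    by (simp add: prod_Basis_vec)
  also have "\<dots> = (\<Prod>b\<in>Basis. (u - l) \<bullet> b)"
    using prod.permute [OF permutes_swap_id, where S=UNIV and g="\<lambda>i. (u - l)$i", symmetric]
    by (simp add: prod_Basis_vec o_def)
  finally show "emeasure (distr lborel borel ?h) (box l u) = (\<Prod>b\<in>Basis. (u - l) \<bullet> b)" .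
qed simp

text \<open>The formula is multiplicative under composition, as the determinant is, so it suffices
  to check elementary maps: diagonal ones, swaps and shears. Injectivity is a premise inside P: the
  elementary maps with a zero row then satisfy P vacuously, and in finite dimension both factors of
  an injective composition are injective.\<close>

lemma nn_integral_lborel_linear:
  fixes f :: "real^'m \<Rightarrow> real^'m"
  assumes "linear f" "inj f" "F \<in> borel_measurable borel"
  shows "(\<integral>\<^sup>+x. F (f x) \<partial>lborel) * ennreal \<bar>det (matrix f)\<bar> = (\<integral>\<^sup>+x. F x \<partial>lborel)"
proof -
  define P where "P = (\<lambda>f::real^'m \<Rightarrow> real^'m. inj f \<longrightarrow> (\<forall>F\<in>borel_measurable borel.
    (\<integral>\<^sup>+x. F (f x) \<partial>lborel) * ennreal \<bar>det (matrix f)\<bar> = (\<integral>\<^sup>+x. F x \<partial>lborel)))"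
  have "P f"
  proof (rule induct_linear_elementary[OF assms(1)])
    fix f g :: "real^'m \<Rightarrow> real^'m"
    assume lin: "linear f" "linear g" and P: "P f" "P g"
    show "P (f \<circ> g)"
      unfolding P_def
    proof (intro impI ballI)
      fix F :: "real^'m \<Rightarrow> ennreal"
      assume inj: "inj (f \<circ> g)" and [measurable]: "F \<in> borel_measurable borel"
      have g: "inj g" using inj by (rule inj_on_imageI2)
      then have "surj g" using lin linear_injective_imp_surjective by blast
      then have f: "inj f" using inj by (metis comp_inj_on_iff g)
      have [measurable]: "f \<in> borel_measurable borel"
        by (rule borel_measurable_linear) fact
      have "(\<integral>\<^sup>+x. F ((f \<circ> g) x) \<partial>lborel) * ennreal \<bar>det (matrix (f \<circ> g))\<bar>
        = (\<integral>\<^sup>+x. F (f (g x)) \<partial>lborel) * ennreal \<bar>det (matrix g)\<bar> * ennreal \<bar>det (matrix f)\<bar>"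
        using matrix_compose [OF lin(2,1)]
        by (simp add: o_def det_mul abs_mult ennreal_mult mult_ac)
      also have "(\<integral>\<^sup>+x. F (f (g x)) \<partial>lborel) * ennreal \<bar>det (matrix g)\<bar> = (\<integral>\<^sup>+x. F (f x) \<partial>lborel)"
        using P(2) g unfolding P_def by (auto dest: bspec[of _ _ "\<lambda>x. F (f x)"])
      also have "\<dots> * ennreal \<bar>det (matrix f)\<bar> = (\<integral>\<^sup>+x. F x \<partial>lborel)"
        using P(1) f unfolding P_def by auto
      finally show "(\<integral>\<^sup>+x. F ((f \<circ> g) x) \<partial>lborel) * ennreal \<bar>det (matrix (f \<circ> g))\<bar> = (\<integral>\<^sup>+x. F x \<partial>lborel)" .
    qed
  next
    fix f :: "real^'m \<Rightarrow> real^'m" and i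
    assume "linear f" and 0: "\<And>x. f x $ i = 0"
    then have "\<not> inj f"
      by (metis (full_types) linear_injective_imp_surjective one_neq_zero surjE vec_component)
    then show "P f" by (simp add: P_def)
  next
    fix c :: "'m \<Rightarrow> real"
    let ?f = "\<lambda>a. \<chi> i. c i * a $ i"
    show "P ?f"
      unfolding P_def
    proof (intro impI ballI)
      fix F :: "real^'m \<Rightarrow> ennreal"
      assume inj: "inj ?f" and [measurable]: "F \<in> borel_measurable borel"
      have nz: "c i \<noteq> 0" for i
      proof
        assume "c i = 0"
        then have "?f (axis i 1) = ?f 0" by (auto simp: vec_eq_iff axis_def)
        then show False using inj by (metis axis_eq_0_iff injD zero_neq_one)
      qed
      have [measurable]: "?f \<in> borel_measurable borel"
        by (intro borel_measurable_linear linearI) (auto simp: vec_eq_iff algebra_simps)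
      have "det (matrix ?f) = (\<Prod>i\<in>UNIV. c i)"
        by (simp add: axis_def matrix_def det_diagonal)
      moreover have "(\<integral>\<^sup>+a. F (?f (vec_lambda a)) * ennreal (\<Prod>i\<in>UNIV. \<bar>c i\<bar>) \<partial>PiM UNIV (\<lambda>_. lborel))
          = (\<integral>\<^sup>+a. F (vec_lambda a) \<partial>PiM UNIV (\<lambda>_. lborel))"
        using nn_integral_PiM_triangular[of "\<lambda>a. F (vec_lambda a)" "\<lambda>i _. c i" "\<lambda>_ _. 0" "\<lambda>_. 0"] nz
        by simp
      moreover have "(\<lambda>a. F (?f (vec_lambda a))) \<in> borel_measurable (PiM UNIV (\<lambda>_. lborel))"
        by measurable
      ultimately show "(\<integral>\<^sup>+x. F (?f x) \<partial>lborel) * ennreal \<bar>det (matrix ?f)\<bar> = (\<integral>\<^sup>+x. F x \<partial>lborel)"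
        by (simp add: nn_integral_lborel_vec nn_integral_multc abs_prod)
    qed
  next
    fix m n :: "'m"
    let ?h = "\<lambda>v::real^'m. \<chi> i. v $ Transposition.transpose m n i"
    assume "m \<noteq> n"
    have lin: "linear ?h"
      by (rule linearI) (simp_all add: plus_vec_def scaleR_vec_def)
    have "matrix ?h = transpose (\<chi> i j. mat 1 $ i $ Transposition.transpose m n j)"
      by (auto simp: vec_eq_iff transpose_def axis_def mat_def matrix_def)
    then have "\<bar>det (matrix ?h)\<bar> = 1"
      by (simp add: det_permute_columns permutes_swap_id sign_swap_id abs_mult)
    moreover have "(\<integral>\<^sup>+x. F (?h x) \<partial>lborel) = (\<integral>\<^sup>+x. F x \<partial>lborel)" if "F \<in> borel_measurable borel" for F
      using that borel_measurable_linear[OF lin]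
      by (subst (2) lborel_distr_transpose[of m n, symmetric]) (simp add: nn_integral_distr)
    ultimately show "P ?h" by (simp add: P_def)
  next
    fix m n :: "'m"
    let ?h = "\<lambda>v::real^'m. \<chi> i. if i = m then v $ m + v $ n else v $ i"
    assume "m \<noteq> n"
    have lin: "linear ?h"
      by (rule linearI) (auto simp: algebra_simps plus_vec_def scaleR_vec_def vec_eq_iff)
    have "matrix ?h = (\<chi> k. if k = m then row m (mat 1) + 1 *s row n (mat 1) else row k (mat 1))"
      by (auto simp: vec_eq_iff matrix_def row_def mat_def axis_def)
    then have "det (matrix ?h) = 1"
      using det_row_operation[OF \<open>m \<noteq> n\<close>, of "mat 1" 1] by simp
    moreover have "(\<integral>\<^sup>+x. F (?h x) \<partial>lborel) = (\<integral>\<^sup>+x. F x \<partial>lborel)" if [measurable]: "F \<in> borel_measurable borel" for F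
    proof -
      have [measurable]: "?h \<in> borel_measurable borel"
        by (rule borel_measurable_linear[OF lin])
      have "?h (vec_lambda a) = vec_lambda (a(m := 1 * a m + a n))" for a
        by (auto simp: vec_eq_iff)
      then have "(\<integral>\<^sup>+a. F (?h (vec_lambda a)) \<partial>PiM UNIV (\<lambda>_. lborel)) = (\<integral>\<^sup>+a. F (vec_lambda a) \<partial>PiM UNIV (\<lambda>_. lborel))"
        using nn_integral_PiM_single_coordinate[of "\<lambda>a. F (vec_lambda a)" "\<lambda>_. 1" "\<lambda>a. a n" m] \<open>m \<noteq> n\<close>
        by simp
      then show ?thesis
        by (simp add: nn_integral_lborel_vec)
    qed
    ultimately show "P ?h" by (simp add: P_def)
  qed
  then show ?thesis using assms by (auto simp: P_def)
qed

subsection \<open>The chart of Hermitian matrices\<close>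

lemma mat_entry_nth: "mat_entry i j c $ k $ l = (if k = i \<and> l = j then c else 0)"
  by (simp add: mat_entry_def)

lemma herm_basis_nth:
  "herm_basis (k, l) $ i $ j =
    (if k = l then (if i = k \<and> j = k then 1 else 0)
     else if k < l then (if i = k \<and> j = l \<or> i = l \<and> j = k then 1 else 0)
     else (if i = k \<and> j = l then \<i> else if i = l \<and> j = k then - \<i> else 0))"
  by (auto simp: herm_basis_def mat_entry_nth)

lemma herm_basis_eq_0: "(i, j) \<noteq> p \<Longrightarrow> (j, i) \<noteq> p \<Longrightarrow> herm_basis p $ i $ j = 0"
proof (cases p)
  case (Pair k l)
  assume "(i, j) \<noteq> p" "(j, i) \<noteq> p"
  then have 1: "\<not> (i = k \<and> j = l)" and 2: "\<not> (i = l \<and> j = k)" by (auto simp: Pair)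
  show ?thesis
  proof (cases "k = l")
    case True
    then show ?thesis unfolding Pair herm_basis_nth using 1 by simp
  next
    case False
    then show ?thesis unfolding Pair herm_basis_nth by (simp only: 1 2 if_False simp_thms if_cancel)
  qed
qed

lemma herm_chart_nth:
  "herm_chart a $ i $ j =
    (if i = j then of_real (a $ (i, i))
     else if i < j then Complex (a $ (i, j)) (- a $ (j, i)) else Complex (a $ (j, i)) (a $ (i, j)))"
proof -
  have "herm_chart a $ i $ j = (\<Sum>p\<in>UNIV. a $ p *\<^sub>R (herm_basis p $ i $ j))"
    by (simp add: herm_chart_def)
  also have "\<dots> = (\<Sum>p\<in>{(i, j), (j, i)}. a $ p *\<^sub>R (herm_basis p $ i $ j))"
  proof (rule sum.mono_neutral_right; (intro ballI)?)
    fix p assume "p \<in> UNIV - {(i, j), (j, i)}"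
    then have "(i, j) \<noteq> p" "(j, i) \<noteq> p" by auto
    then show "a $ p *\<^sub>R (herm_basis p $ i $ j) = 0"
      by (simp add: herm_basis_eq_0)
  qed auto
  finally show ?thesis
    by (auto simp: herm_basis_nth complex_eq_iff of_real_def)
qed

text \<open>The inverse of \<open>herm_chart\<close> on Hermitian matrices, extended to all matrices
  so that it is a linear map.\<close>

definition herm_coords :: "complex^'n::{finite,linorder}^'n::{finite,linorder} \<Rightarrow> real^('n \<times> 'n)" where
  "herm_coords x = (\<chi> p. if fst p \<le> snd p then Re (x $ fst p $ snd p) else Im (x $ fst p $ snd p))"

lemma herm_coords_nth: "herm_coords x $ (i, j) = (if i \<le> j then Re (x $ i $ j) else Im (x $ i $ j))"
  by (simp add: herm_coords_def)

lemma herm_coords_chart [simp]: "herm_coords (herm_chart a) = a"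
  by (auto simp: vec_eq_iff herm_coords_nth herm_chart_nth)

lemma ctranspose_herm_chart [simp]: "ctranspose (herm_chart a) = herm_chart a"
  by (auto simp: vec_eq_iff herm_chart_nth complex_eq_iff)

lemma herm_chart_coords:
  assumes "ctranspose x = x"
  shows "herm_chart (herm_coords x) = x"
proof -
  have "cnj (x $ j $ i) = x $ i $ j" for i j
    using assms by (metis ctranspose_nth)
  from this[THEN arg_cong[of _ _ Re]] this[THEN arg_cong[of _ _ Im]] show ?thesis
    by (auto simp: vec_eq_iff herm_coords_nth herm_chart_nth complex_eq_iff)
      (metis add.inverse_neutral equation_minus_iff neg_equal_zero)+
qed

lemma linear_herm_chart: "linear herm_chart"
  by (rule linearI) (auto simp: herm_chart_def scaleR_left_distrib sum.distrib scaleR_sum_right)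

lemma linear_herm_coords: "linear herm_coords"
  by (rule linearI) (auto simp: vec_eq_iff herm_coords_nth)

lemma herm_chart_axis: "herm_chart (axis p 1) = herm_basis p"
proof -
  have "herm_chart (axis p 1) = (\<Sum>q\<in>{p}. (axis p 1 $ q) *\<^sub>R herm_basis q)"
    unfolding herm_chart_def by (intro sum.mono_neutral_right) (auto simp: axis_def)
  then show ?thesis by simp
qed

text \<open>The congruence action read in the chart, where it is a linear endomorphism of a real
  coordinate space and so has a Jacobian determinant.\<close>

definition act_coords where
  "act_coords g a = herm_coords (act g (herm_chart a))"

lemma ctranspose_act: "ctranspose x = x \<Longrightarrow> ctranspose (act g x) = act g x"
  by (simp add: act_def ctranspose_mult matrix_mul_assoc)

lemma herm_chart_act_coords [simp]: "herm_chart (act_coords g a) = act g (herm_chart a)"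
  by (simp add: act_coords_def herm_chart_coords ctranspose_act)

lemma matrix_scaleR_left: "(c *\<^sub>R A) ** B = c *\<^sub>R (A ** B)" for A :: "complex^'n^'m"
  by (simp add: vec_eq_iff matrix_matrix_mult_def scaleR_sum_right)

lemma matrix_scaleR_right: "A ** (c *\<^sub>R B) = c *\<^sub>R (A ** B)" for A :: "complex^'n^'m"
  by (simp add: vec_eq_iff matrix_matrix_mult_def scaleR_sum_right)

lemma linear_act: "linear (act g)" for g :: "complex^'n^'n"
proof (rule linearI)
  show "act g (c *\<^sub>R x) = c *\<^sub>R act g x" for c x
    by (simp add: act_def matrix_scaleR_left matrix_scaleR_right)
qed (rule act_add)

lemma linear_act_coords: "linear (act_coords g)"
  unfolding act_coords_def
  using linear_compose[OF linear_compose[OF linear_herm_chart linear_act] linear_herm_coords]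
  by (simp add: o_def)

lemma inj_act_coords:
  assumes "invertible g"
  shows "inj (act_coords g)"
proof (rule injI)
  fix a b assume "act_coords g a = act_coords g b"
  then have eq: "act g (herm_chart a) = act g (herm_chart b)"
    by (metis herm_chart_act_coords)
  obtain h where "h ** g = mat 1" using assms by (auto simp: invertible_def)
  then have "herm_chart a = herm_chart b"
    using arg_cong[OF eq, of "act h"] by (simp add: act_act)
  then show "a = b" by (metis herm_coords_chart)
qed

text \<open>The inverse of \<open>act g x\<close> is h^H x^(-1) h with h the inverse of g. All inner
  factors cancel, and the outer pair cancels by cyclicity of the trace.\<close>

lemma riem_metric_act:
  assumes "invertible g" "invertible x"
  shows "riem_metric (act g x) (act g v) (act g w) = riem_metric x v w"
proof -
  define h where "h = matrix_inv g"
  have h: "g ** h = mat 1" "h ** g = mat 1"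
    using matrix_inv_mult[OF assms(1)] by (auto simp: h_def)
  then have h': "ctranspose h ** ctranspose g = mat 1" "ctranspose g ** ctranspose h = mat 1"
    by (metis ctranspose_mat_1 ctranspose_mult)+
  have c: "h ** (g ** B) = B" "g ** (h ** B) = B" "ctranspose g ** (ctranspose h ** B) = B"
    "ctranspose h ** (ctranspose g ** B) = B" "matrix_inv x ** (x ** B) = B" "x ** (matrix_inv x ** B) = B" for B
    using h h' matrix_inv_mult[OF assms(2)] by (simp_all add: matrix_mul_assoc)
  have "act g x ** (ctranspose h ** matrix_inv x ** h) = mat 1"
    by (simp add: act_def c matrix_mul_assoc[symmetric] h)
  then have inv: "matrix_inv (act g x) = ctranspose h ** matrix_inv x ** h"
    by (rule matrix_inv_unique)
  have "trace (matrix_inv (act g x) ** act g v ** matrix_inv (act g x) ** act g w)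
      = trace (ctranspose h ** (matrix_inv x ** v ** matrix_inv x ** w ** ctranspose g))"
    unfolding inv by (simp add: act_def c matrix_mul_assoc[symmetric])
  also have "\<dots> = trace ((matrix_inv x ** v ** matrix_inv x ** w ** ctranspose g) ** ctranspose h)"
    by (rule trace_mul_sym)
  also have "\<dots> = trace (matrix_inv x ** v ** matrix_inv x ** w)"
    by (simp add: matrix_mul_assoc[symmetric] h')
  finally show ?thesis by (simp add: riem_metric_def)
qed

lemma trace_scaleR: "trace (c *\<^sub>R A) = c *\<^sub>R trace A" for A :: "complex^'n^'n"
  by (simp add: trace_def scaleR_sum_right)

lemma linear_riem_metric_left: "linear (\<lambda>v. riem_metric x v w)"
  by (rule linearI)
    (simp_all add: riem_metric_def matrix_add_ldistrib matrix_add_rdistrib trace_add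
      matrix_scaleR_left matrix_scaleR_right trace_scaleR)

lemma linear_riem_metric_right: "linear (\<lambda>w. riem_metric x v w)"
  by (rule linearI)
    (simp_all add: riem_metric_def matrix_add_ldistrib trace_add matrix_scaleR_right trace_scaleR)

lemma riem_metric_herm_chart:
  "riem_metric x (herm_chart a) (herm_chart b) = a \<bullet> (gram x *v b)"
proof -
  have 1: "riem_metric x (herm_chart a) w = (\<Sum>p\<in>UNIV. a $ p * riem_metric x (herm_basis p) w)" for w
    unfolding herm_chart_def
    by (simp add: linear_sum[OF linear_riem_metric_left] linear_scale[OF linear_riem_metric_left])
  have 2: "riem_metric x v (herm_chart b) = (\<Sum>q\<in>UNIV. b $ q * riem_metric x v (herm_basis q))" for v
    unfolding herm_chart_def
    by (simp add: linear_sum[OF linear_riem_metric_right] linear_scale[OF linear_riem_metric_right])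
  show ?thesis
    by (subst 1, subst 2) (simp add: inner_vec_def matrix_vector_mult_def gram_def mult.commute)
qed

text \<open>Congruence is an isometry of the metric, so the Gram matrix at x is the pull-back A^T B
  A of the Gram matrix B at \<open>act g x\<close>, where A is the action in coordinates.\<close>

lemma gram_act:
  assumes "invertible g" "invertible x"
  shows "det (gram x) = (det (matrix (act_coords g)))\<^sup>2 * det (gram (act g x))"
proof -
  let ?A = "matrix (act_coords g)"
  have A: "?A *v a = act_coords g a" for a
    using fun_cong[OF matrix_vector_mul(2)[OF linear_act_coords[of g]]] by simp
  have "a \<bullet> (gram x *v b) = a \<bullet> ((transpose ?A ** gram (act g x) ** ?A) *v b)" for a b
  proof -
    have "a \<bullet> (gram x *v b) = riem_metric (act g x) (act g (herm_chart a)) (act g (herm_chart b))"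
      by (simp add: riem_metric_herm_chart[symmetric] riem_metric_act assms)
    also have "\<dots> = (?A *v a) \<bullet> (gram (act g x) *v (?A *v b))"
      by (simp add: riem_metric_herm_chart[symmetric] A)
    also have "\<dots> = a \<bullet> (transpose ?A *v (gram (act g x) *v (?A *v b)))"
      using dot_lmul_matrix[of a "transpose ?A" "gram (act g x) *v (?A *v b)"]
        transpose_matrix_vector[of "transpose ?A" a] by simp
    finally show ?thesis by (simp add: matrix_vector_mul_assoc matrix_mul_assoc)
  qed
  then have "gram x *v b = (transpose ?A ** gram (act g x) ** ?A) *v b" for b
    by (metis vector_eq_ldot)
  then have "gram x = transpose ?A ** gram (act g x) ** ?A"
    by (simp add: matrix_eq)
  then have "det (gram x) = det (transpose ?A ** gram (act g x) ** ?A)"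
    by simp
  then show ?thesis
    by (simp add: det_mul det_transpose power2_eq_square)
qed

definition vol_density :: "complex^'n::{finite,linorder}^'n::{finite,linorder} \<Rightarrow> real" where
  "vol_density x = sqrt (det (gram x))"

text \<open>Two uses: for general x it gives the invariance of the volume, and at the identity it
  gives the density at every point from its value there.\<close>

lemma vol_density_act:
  assumes "invertible g" "invertible x"
  shows "vol_density x = \<bar>det (matrix (act_coords g))\<bar> * vol_density (act g x)"
  by (simp add: vol_density_def gram_act[OF assms] real_sqrt_mult)

lemma card_off_diagonal: "card {p::'n::finite \<times> 'n. fst p \<noteq> snd p} = CARD('n) * (CARD('n) - 1)"
proof -
  have "{p::'n\<times>'n. fst p \<noteq> snd p} = UNIV - range (\<lambda>i. (i, i))" by auto
  moreover have "card (range (\<lambda>i::'n. (i, i))) = CARD('n)"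
    by (rule card_image) (auto intro: injI)
  moreover have "card (UNIV - range (\<lambda>i::'n. (i, i))) = card (UNIV::('n\<times>'n) set) - card (range (\<lambda>i::'n. (i, i)))"
    by (rule card_Diff_subset) auto
  ultimately have "card {p::'n\<times>'n. fst p \<noteq> snd p} = CARD('n) * CARD('n) - CARD('n)"
    by (simp add: UNIV_Times_UNIV[symmetric] card_cartesian_product del: UNIV_Times_UNIV)
  then show ?thesis by (simp add: diff_mult_distrib2)
qed

text \<open>At the identity the basis is orthogonal. Diagonal basis elements have squared length 1,
  and the N (N - 1) off-diagonal ones have squared length 2. This is the source of the powers of 2
  in \<open>Gamma_M\<close>.\<close>

lemma vol_density_mat_1:
  "vol_density (mat 1 :: complex^'n::{finite,linorder}^'n::{finite,linorder}) = 2 ^ (CARD('n) * (CARD('n) - 1) div 2)"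
proof -
  have inv: "matrix_inv (mat 1 :: 'n cmat) = mat 1"
    by (rule matrix_inv_unique) simp
  have g: "gram (mat 1 :: 'n cmat) $ p $ q = (if p = q then (if fst p = snd p then 1 else 2) else 0)" for p q
  proof -
    obtain i j k l where p: "p = (i, j)" "q = (k, l)" by (metis surj_pair)
    have "gram (mat 1 :: 'n cmat) $ p $ q = Re (trace (herm_basis p ** (herm_basis q :: 'n cmat)))"
      by (simp add: gram_def riem_metric_def inv)
    also have "\<dots> = (\<Sum>m\<in>UNIV. \<Sum>n\<in>UNIV. Re (herm_basis p $ m $ n * herm_basis q $ n $ m))"
      by (simp add: trace_def matrix_matrix_mult_def)
    also have "\<dots> = (\<Sum>z\<in>UNIV \<times> UNIV. Re (herm_basis p $ fst z $ snd z * herm_basis q $ snd z $ fst z))"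
      unfolding sum.cartesian_product case_prod_unfold ..
    also have "\<dots> = (\<Sum>z\<in>{(i, j), (j, i)}. Re (herm_basis p $ fst z $ snd z * herm_basis q $ snd z $ fst z))"
    proof (rule sum.mono_neutral_right; (intro ballI)?)
      fix z assume "z \<in> UNIV \<times> UNIV - {(i, j), (j, i)}"
      then have "(fst z, snd z) \<noteq> p" "(snd z, fst z) \<noteq> p" by (auto simp: p)
      then show "Re (herm_basis p $ fst z $ snd z * herm_basis q $ snd z $ fst z) = 0"
        by (simp add: herm_basis_eq_0)
    qed auto
    also have "\<dots> = (if p = q then (if fst p = snd p then 1 else 2) else 0)"
    proof -
      consider "q = p" | "q = (j, i)" "i \<noteq> j" | "q \<noteq> (i, j)" "q \<noteq> (j, i)"
        using p by blast
      then show ?thesis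
      proof cases
        case 1
        then show ?thesis
          unfolding p(1) by (cases i j rule: linorder_cases) (simp_all add: herm_basis_nth)
      next
        case 2
        then show ?thesis
          unfolding p(1) by (cases i j rule: linorder_cases) (simp_all add: herm_basis_nth)
      next
        case 3
        then have "herm_basis q $ j $ i = 0" "herm_basis q $ i $ j = 0"
          by (auto intro!: herm_basis_eq_0)
        moreover have "p \<noteq> q" using 3 p by auto
        ultimately show ?thesis by (cases "i = j") simp_all
      qed
    qed
    finally show ?thesis .
  qed
  then have "det (gram (mat 1 :: 'n cmat)) = (\<Prod>p\<in>UNIV. gram (mat 1 :: 'n cmat) $ p $ p)"
    by (intro det_diagonal) auto
  also have "\<dots> = (\<Prod>p::'n\<times>'n\<in>UNIV. if fst p = snd p then 1 else 2)"
    by (simp add: g)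
  also have "\<dots> = 2 ^ card {p::'n\<times>'n. fst p \<noteq> snd p}"
    by (simp add: prod.If_cases Compl_eq)
  also have "card {p::'n\<times>'n. fst p \<noteq> snd p} = CARD('n) * (CARD('n) - 1)"
    by (rule card_off_diagonal)
  finally have "det (gram (mat 1 :: 'n cmat)) = (2 ^ (CARD('n) * (CARD('n) - 1) div 2))\<^sup>2"
    by (simp add: power_mult[symmetric])
  then show ?thesis by (simp add: vol_density_def)
qed

subsection \<open>Invariance of the Riemannian volume\<close>

text \<open>Cramer's rule, applied to the columns of the identity; it presents the inverse as a
  quotient of determinants, from which its continuity is read off.\<close>

lemma matrix_inv_nth:
  fixes x :: "'a::field^'n^'n"
  assumes "invertible x"
  shows "matrix_inv x $ i $ j = det (\<chi> a b. if b = i then axis j 1 $ a else x $ a $ b) / det x"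
proof -
  have "x *v (matrix_inv x *v axis j 1) = axis j 1"
    by (simp add: matrix_vector_mul_assoc matrix_inv_mult[OF assms])
  then have "matrix_inv x *v axis j 1 = (\<chi> k. det (\<chi> a b. if b = k then axis j 1 $ a else x $ a $ b) / det x)"
    using assms by (subst (asm) cramer) (simp_all add: invertible_det_nz)
  moreover have "(matrix_inv x *v axis j 1) $ i = matrix_inv x $ i $ j"
  proof -
    have "(matrix_inv x *v axis j 1) $ i = (\<Sum>k\<in>UNIV. if k = j then matrix_inv x $ i $ k else 0)"
      unfolding matrix_vector_mult_def axis_def by (simp add: if_distrib cong: if_cong)
    then show ?thesis by simp
  qed
  ultimately show ?thesis by simp
qed

lemma continuous_on_matrix_inv [continuous_intros]:
  fixes f :: "'a::topological_space \<Rightarrow> 'b::real_normed_field^'n^'n"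
  assumes "continuous_on S f" "\<And>x. x \<in> S \<Longrightarrow> invertible (f x)"
  shows "continuous_on S (\<lambda>x. matrix_inv (f x))"
proof -
  have "continuous_on S (\<lambda>x. \<chi> i j. det (\<chi> a b. if b = i then axis j 1 $ a else f x $ a $ b) / det (f x))"
  proof (intro continuous_on_vec_lambda continuous_on_divide continuous_on_det)
    show "continuous_on S (\<lambda>x. if b = i then axis j 1 $ a else f x $ a $ b)" for a b i j
      by (cases "b = i") (auto intro!: continuous_intros assms)
  qed (use assms in \<open>auto simp: invertible_det_nz\<close>)
  then show ?thesis
    by (rule continuous_on_cong[THEN iffD1, rotated 2])
      (use assms in \<open>auto simp: vec_eq_iff matrix_inv_nth\<close>)
qed

lemma borel_hpd [measurable]: "(hpd :: (complex^'n^'n) set) \<in> sets borel"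
proof -
  obtain T where T: "open T" "(hpd :: (complex^'n^'n) set) = hermitian_matrices \<inter> T"
    using hpd_eq_open_Int by blast
  have "closed (hermitian_matrices :: (complex^'n^'n) set)"
    by (intro closed_Collect_eq continuous_intros)
  then show ?thesis
    unfolding T(2) using T(1) by (intro sets.Int borel_closed borel_open)
qed

lemma borel_measurable_herm_chart [measurable]: "herm_chart \<in> borel_measurable borel"
  by (rule borel_measurable_linear[OF linear_herm_chart])

lemma continuous_on_riem_metric [continuous_intros]:
  assumes "continuous_on S f" "\<And>x. x \<in> S \<Longrightarrow> invertible (f x)"
  shows "continuous_on S (\<lambda>x. riem_metric (f x) v w)"
  unfolding riem_metric_def trace_def by (intro continuous_intros assms)

lemma continuous_on_vol_density: "continuous_on hpd vol_density"
  unfolding vol_density_def gram_def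
  by (intro continuous_intros continuous_on_vec_lambda hpd_invertible) auto

lemma space_vol [simp]: "space vol = hpd"
  and sets_vol [measurable_cong]: "sets vol = sets (restrict_space borel hpd)"
  by (simp_all add: vol_def space_restrict_space)

lemma borel_measurable_vol_weight [measurable]:
  "(\<lambda>a. indicator hpd (herm_chart a) * ennreal (vol_density (herm_chart a))) \<in> borel_measurable borel"
proof -
  have "(\<lambda>x. ennreal (vol_density x)) \<in> borel_measurable (restrict_space borel hpd)"
    using borel_measurable_continuous_on_restrict[OF continuous_on_vol_density] by measurable
  then have [measurable]: "(\<lambda>x. ennreal (vol_density x) * indicator hpd x) \<in> borel_measurable borel"
    by (subst (asm) borel_measurable_restrict_space_iff_ennreal) auto
  show ?thesis by (subst mult.commute) measurable
qed

text \<open>The domain appears as an indicator on the whole coordinate space, because the linear and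
  triangular substitutions are stated for unrestricted Lebesgue measure.\<close>

lemma nn_integral_vol:
  fixes F :: "'n::{finite,linorder} cmat \<Rightarrow> ennreal"
  assumes [measurable]: "F \<in> borel_measurable (restrict_space borel hpd)"
  shows "(\<integral>\<^sup>+x. F x \<partial>vol)
    = (\<integral>\<^sup>+a. F (herm_chart a) * (indicator hpd (herm_chart a) * ennreal (vol_density (herm_chart a))) \<partial>lborel)"
proof -
  let ?H = "herm_chart :: _ \<Rightarrow> 'n cmat"
  have [measurable]: "?H -` hpd \<in> sets borel"
    using measurable_sets[OF borel_measurable_herm_chart borel_hpd] by simp
  have [measurable]: "?H \<in> measurable (restrict_space lborel (?H -` hpd)) (restrict_space borel hpd)"
    by (rule measurable_restrict_space3) auto
  have m [measurable]: "(\<lambda>a. ennreal (vol_density (?H a))) \<in> borel_measurable (restrict_space lborel (?H -` hpd))"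
    by (subst borel_measurable_restrict_space_iff_ennreal)
       (use borel_measurable_vol_weight[where 'a='n] in \<open>auto simp: indicator_def if_distrib mult.commute cong: if_cong\<close>)
  have "(\<integral>\<^sup>+x. F x \<partial>vol)
     = (\<integral>\<^sup>+a. ennreal (vol_density (?H a)) * F (?H a) \<partial>restrict_space lborel (?H -` hpd))"
    unfolding vol_def vol_density_def[symmetric]
    by (simp add: nn_integral_distr nn_integral_density)
  also have "\<dots> = (\<integral>\<^sup>+a. ennreal (vol_density (?H a)) * F (?H a) * indicator (?H -` hpd) a \<partial>lborel)"
    by (rule nn_integral_restrict_space) auto
  also have "\<dots> = (\<integral>\<^sup>+a. F (?H a) * (indicator hpd (?H a) * ennreal (vol_density (?H a))) \<partial>lborel)"
    by (intro nn_integral_cong) (auto simp: indicator_def mult_ac)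
  finally show ?thesis .
qed

lemma measurable_act_restrict [measurable]:
  assumes "invertible g"
  shows "act g \<in> measurable (restrict_space borel hpd) (restrict_space borel hpd)"
proof (rule measurable_restrict_space3)
  show "act g \<in> borel_measurable borel"
    by (rule borel_measurable_linear[OF linear_act])
qed (use assms act_hpd in auto)

text \<open>The Jacobian of the action in coordinates is exactly the factor by which the density
  changes, so the two cancel in the change of variables.\<close>

lemma distr_vol_act:
  fixes g :: "'n::{finite,linorder} cmat"
  assumes g: "invertible g"
  shows "distr vol vol (act g) = vol"
proof (rule measure_eqI)
  note [measurable] = measurable_act_restrict[OF g]
  fix A assume "A \<in> sets (distr vol vol (act g))"
  then have A [measurable]: "A \<in> sets (restrict_space borel hpd)"
    by (simp add: sets_vol)
  let ?H = "herm_chart :: _ \<Rightarrow> 'n cmat"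
  let ?w = "\<lambda>x. indicator hpd x * ennreal (vol_density x)"
  let ?d = "ennreal \<bar>det (matrix (act_coords g))\<bar>"
  have w: "?w x = ?d * ?w (act g x)" for x
    using vol_density_act[OF g hpd_invertible, of x] act_hpd_iff[OF g, of x]
    by (auto simp: indicator_def ennreal_mult')
  have [measurable]: "act_coords g \<in> borel_measurable borel"
    by (rule borel_measurable_linear[OF linear_act_coords])
  have A': "A \<in> sets borel"
    using A by (auto simp: sets_restrict_space)
  then have [measurable]: "(\<lambda>a. indicator A (?H a) * ?w (?H a)) \<in> borel_measurable borel"
    by measurable
  have "emeasure (distr vol vol (act g)) A = (\<integral>\<^sup>+x. indicator A x \<partial>distr vol vol (act g))"
    using A by (intro nn_integral_indicator[symmetric]) (simp add: sets_vol)
  also have "\<dots> = (\<integral>\<^sup>+x. indicator A (act g x) \<partial>vol)"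
    by (rule nn_integral_distr) measurable
  also have "\<dots> = (\<integral>\<^sup>+a. indicator A (act g (?H a)) * ?w (?H a) \<partial>lborel)"
    by (rule nn_integral_vol) measurable
  also have "\<dots> = (\<integral>\<^sup>+a. indicator A (?H (act_coords g a)) * ?w (?H (act_coords g a)) * ?d \<partial>lborel)"
    by (intro nn_integral_cong) (subst w, simp add: mult_ac)
  also have "\<dots> = (\<integral>\<^sup>+a. indicator A (?H (act_coords g a)) * ?w (?H (act_coords g a)) \<partial>lborel) * ?d"
    by (rule nn_integral_multc) measurable
  also have "\<dots> = (\<integral>\<^sup>+a. indicator A (?H a) * ?w (?H a) \<partial>lborel)"
    by (rule nn_integral_lborel_linear) (auto simp: linear_act_coords inj_act_coords g)
  also have "\<dots> = (\<integral>\<^sup>+x. indicator A x \<partial>vol)"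
    by (rule nn_integral_vol[symmetric]) measurable
  finally show "emeasure (distr vol vol (act g)) A = emeasure vol A"
    by (simp add: sets_vol A)
qed simp

subsection \<open>Cholesky coordinates\<close>

text \<open>A permutation other than the identity moves some i with r i \<le> r (p i): if r dropped
  at every moved index, its sum over all indices would drop too. So every other Leibniz term has a
  zero factor. Ties in r are allowed because the rank r i + r j of a pair is not injective.\<close>

lemma det_triangular:
  fixes A :: "'a::comm_ring_1^'n^'n" and r :: "'n \<Rightarrow> nat"
  assumes zero: "\<And>i j. i \<noteq> j \<Longrightarrow> r i \<le> r j \<Longrightarrow> A $ i $ j = 0"
  shows "det A = (\<Prod>i\<in>UNIV. A $ i $ i)"
proof -
  have "of_int (sign p) * (\<Prod>i\<in>UNIV. A $ i $ p i) = 0" if p: "p permutes UNIV" "p \<noteq> id" for p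
  proof -
    have "\<exists>i. p i \<noteq> i \<and> r i \<le> r (p i)"
    proof (rule ccontr)
      assume "\<not> ?thesis"
      then have *: "p i \<noteq> i \<Longrightarrow> r (p i) < r i" for i by (meson not_le)
      then have "r (p i) \<le> r i" for i by (cases "p i = i") (auto simp: less_imp_le)
      moreover obtain i where "p i \<noteq> i" using p(2) by (auto simp: fun_eq_iff)
      ultimately have "(\<Sum>i\<in>UNIV. r (p i)) < (\<Sum>i\<in>UNIV. r i)"
        using * by (intro sum_strict_mono_ex1) auto
      then show False using sum.permute[OF p(1), of r] by (simp add: o_def)
    qed
    then obtain i where "A $ i $ p i = 0" using zero by metis
    then have "(\<Prod>i\<in>UNIV. A $ i $ p i) = 0" by (intro prod_zero) auto
    then show ?thesis by simp
  qed
  then have "det A = (\<Sum>p\<in>{id}. of_int (sign p) * (\<Prod>i\<in>UNIV. A $ i $ p i))"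
    unfolding det_def by (intro sum.mono_neutral_right) (auto simp: permutes_id)
  then show ?thesis by simp
qed

text \<open>Triangularity relative to a rank, so that eliminations from the first row and from the
  last row are instances of one theory.\<close>

definition lower_triangular :: "('n \<Rightarrow> nat) \<Rightarrow> 'a::zero^'n^'n \<Rightarrow> bool" where
  "lower_triangular r A \<longleftrightarrow> (\<forall>i j. r i < r j \<longrightarrow> A $ i $ j = 0)"

lemma det_lower_triangular:
  fixes A :: "'a::comm_ring_1^'n^'n"
  assumes "inj r" "lower_triangular r A"
  shows "det A = (\<Prod>i\<in>UNIV. A $ i $ i)"
  using assms by (intro det_triangular[of r]) (auto simp: lower_triangular_def inj_eq le_less)

lemma act_nth: "act L x $ i $ j = (\<Sum>k\<in>UNIV. \<Sum>l\<in>UNIV. L $ i $ k * x $ k $ l * cnj (L $ j $ l))"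
proof -
  have "act L x $ i $ j = (\<Sum>l\<in>UNIV. \<Sum>k\<in>UNIV. L $ i $ k * x $ k $ l * cnj (L $ j $ l))"
    by (simp add: act_def matrix_matrix_mult_def sum_distrib_right)
  then show ?thesis by (subst sum.swap)
qed

text \<open>Only positions dominated by (i, j) in both ranks can contribute, while the basis matrix
  is supported on (k, l) and (l, k). When the rank sum of (i, j) is at most that of (k, l),
  domination must be equality, and a single term is left.\<close>

lemma act_herm_basis_lower_triangular:
  fixes L :: "'n::{finite,linorder} cmat"
  assumes r: "inj r" and L: "lower_triangular r L"
    and le: "r i + r j \<le> r k + r l"
  shows "act L (herm_basis (k, l)) $ i $ j = L $ i $ i * herm_basis (k, l) $ i $ j * cnj (L $ j $ j)"
proof -
  let ?t = "\<lambda>z. L $ i $ fst z * herm_basis (k, l) $ fst z $ snd z * cnj (L $ j $ snd z)"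
  have "act L (herm_basis (k, l)) $ i $ j = (\<Sum>z\<in>UNIV \<times> UNIV. ?t z)"
    unfolding act_nth sum.cartesian_product case_prod_unfold ..
  also have "\<dots> = (\<Sum>z\<in>{(i, j)}. ?t z)"
  proof (rule sum.mono_neutral_right; (intro ballI)?)
    fix z assume z: "z \<in> UNIV \<times> UNIV - {(i, j)}"
    show "?t z = 0"
    proof (rule ccontr)
      assume nz: "?t z \<noteq> 0"
      then have "r (fst z) \<le> r i" "r (snd z) \<le> r j"
        using L by (auto simp: lower_triangular_def not_less[symmetric])
      moreover have "(fst z, snd z) = (k, l) \<or> (snd z, fst z) = (k, l)"
        using nz herm_basis_eq_0[of "fst z" "snd z" "(k, l)"] by (auto simp del: prod.inject)
      ultimately have "r (fst z) = r i" "r (snd z) = r j" using le by auto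
      then have "z = (i, j)" using r by (auto simp: inj_eq prod_eq_iff)
      then show False using z by simp
    qed
  qed auto
  finally show ?thesis by simp
qed

text \<open>Ordered by r i + r j, the matrix of the action is triangular with diagonal entries d_i
  d_j. Each d_i occurs 2 N times among them.\<close>

lemma det_act_coords_lower_triangular:
  fixes L :: "'n::{finite,linorder} cmat"
  assumes r: "inj r" and L: "lower_triangular r L" and d: "\<And>i. L $ i $ i = of_real (d i)"
  shows "det (matrix (act_coords L)) = (\<Prod>i\<in>UNIV. d i) ^ (2 * CARD('n))"
proof -
  have m: "matrix (act_coords L) $ (i, j) $ (k, l) = d i * d j * axis (k, l) 1 $ (i, j)"
    if "r i + r j \<le> r k + r l" for i j k l
  proof -
    have "matrix (act_coords L) $ (i, j) $ (k, l) = herm_coords (act L (herm_basis (k, l))) $ (i, j)"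
      by (simp add: matrix_def act_coords_def herm_chart_axis)
    also have "\<dots> = d i * d j * herm_coords (herm_basis (k, l)) $ (i, j)"
      by (simp add: herm_coords_nth act_herm_basis_lower_triangular[OF r L that] d)
    also have "herm_coords (herm_basis (k, l)) = (axis (k, l) 1 :: real^('n \<times> 'n))"
      by (simp flip: herm_chart_axis)
    finally show ?thesis .
  qed
  have "det (matrix (act_coords L)) = (\<Prod>p\<in>UNIV. matrix (act_coords L) $ p $ p)"
  proof (rule det_triangular[of "\<lambda>p. r (fst p) + r (snd p)"])
    fix p q :: "'n \<times> 'n"
    assume "p \<noteq> q" "r (fst p) + r (snd p) \<le> r (fst q) + r (snd q)"
    then show "matrix (act_coords L) $ p $ q = 0"
      using m[of "fst p" "snd p" "fst q" "snd q"] by (simp add: axis_def)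
  qed
  also have "\<dots> = (\<Prod>p\<in>UNIV \<times> UNIV. d (fst p) * d (snd p))"
    using m by (intro prod.cong) auto
  also have "\<dots> = (\<Prod>i\<in>UNIV. \<Prod>j\<in>UNIV. d i * d j)"
    by (simp add: prod.cartesian_product case_prod_unfold)
  also have "\<dots> = (\<Prod>i\<in>UNIV. d i) ^ (2 * CARD('n))"
    by (simp add: prod.distrib prod_power_distrib power_mult power2_eq_square power_mult_distrib)
  finally show ?thesis .
qed

lemma vol_density_lower_triangular:
  fixes L :: "'n::{finite,linorder} cmat"
  assumes r: "inj r" and L: "lower_triangular r L" and d: "\<And>i. L $ i $ i = of_real (d i)" "\<And>i. 0 < d i"
  shows "vol_density (L ** ctranspose L) = 2 ^ (CARD('n) * (CARD('n) - 1) div 2) / (\<Prod>i\<in>UNIV. d i) ^ (2 * CARD('n))"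
proof -
  have "invertible L"
    using det_lower_triangular[OF r L] d by (simp add: invertible_det_nz less_imp_neq[THEN not_sym])
  moreover have "(\<Prod>i\<in>UNIV. d i) > 0" using d by (simp add: prod_pos)
  moreover have "d i \<noteq> 0" for i using d(2)[of i] by simp
  ultimately show ?thesis
    using vol_density_act[of L "mat 1"] vol_density_mat_1[where 'n='n] 
    by (simp add: det_act_coords_lower_triangular[OF r L d(1)] act_def field_simps invertible_det_nz)
qed

text \<open>The diagonal coordinates hold the squares of the diagonal entries of the factor. With
  this choice each diagonal entry of the product is affine in its own coordinate, as the triangular
  substitution requires.\<close>

definition chol_factor :: "('n::{finite,linorder} \<Rightarrow> nat) \<Rightarrow> ('n \<times> 'n \<Rightarrow> real) \<Rightarrow> 'n cmat" where
  "chol_factor r a = (\<chi> i k. if i = k then of_real (sqrt (a (k, k)))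
     else if r k < r i then herm_chart (vec_lambda a) $ i $ k else 0)"

definition chol :: "('n::{finite,linorder} \<Rightarrow> nat) \<Rightarrow> ('n \<times> 'n \<Rightarrow> real) \<Rightarrow> 'n cmat" where
  "chol r a = chol_factor r a ** ctranspose (chol_factor r a)"

text \<open>For an injective rank, this is the last column in which rows i and j of a lower
  triangular matrix can both be nonzero.\<close>

definition pivot :: "('n \<Rightarrow> nat) \<Rightarrow> 'n \<Rightarrow> 'n \<Rightarrow> 'n" where
  "pivot r i j = (if r i \<le> r j then i else j)"

(* For a nonpositive pivot the scale is 1, so that the substitution is nondegenerate on the whole space
   and nn_integral_PiM_triangular applies; chol_coords_pos then discards those points. *)
definition chol_scale :: "('n::{finite,linorder} \<Rightarrow> nat) \<Rightarrow> 'n \<times> 'n \<Rightarrow> ('n \<times> 'n \<Rightarrow> real) \<Rightarrow> real" where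
  "chol_scale r p a = (let i = fst p; j = snd p; d = a (pivot r i j, pivot r i j)
     in if i \<noteq> j \<and> 0 < d then sqrt d else 1)"

text \<open>The part of entry (i, j) of L L^H that comes from the columns before the pivot column;
  the pivot column itself gives the term linear in the coordinate.\<close>

definition chol_sum :: "('n::{finite,linorder} \<Rightarrow> nat) \<Rightarrow> 'n \<Rightarrow> 'n \<Rightarrow> ('n \<times> 'n \<Rightarrow> real) \<Rightarrow> complex" where
  "chol_sum r i j a = (\<Sum>k | r k < r i \<and> r k < r j.
     herm_chart (vec_lambda a) $ i $ k * cnj (herm_chart (vec_lambda a) $ j $ k))"

definition chol_shift :: "('n::{finite,linorder} \<Rightarrow> nat) \<Rightarrow> 'n \<times> 'n \<Rightarrow> ('n \<times> 'n \<Rightarrow> real) \<Rightarrow> real" where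
  "chol_shift r p a = (if fst p \<le> snd p then Re (chol_sum r (fst p) (snd p) a) else Im (chol_sum r (fst p) (snd p) a))"

definition chol_coords :: "('n::{finite,linorder} \<Rightarrow> nat) \<Rightarrow> ('n \<times> 'n \<Rightarrow> real) \<Rightarrow> 'n \<times> 'n \<Rightarrow> real" where
  "chol_coords r a = (\<lambda>p. chol_scale r p a * a p + chol_shift r p a)"

lemma chol_sum_cnj: "cnj (chol_sum r i j a) = chol_sum r j i a"
  by (simp add: chol_sum_def cnj_sum mult.commute conj_commute)

lemma herm_chart_chol_coords_nth:
  assumes "inj r"
  shows "herm_chart (vec_lambda (chol_coords r a)) $ i $ j =
    of_real (chol_scale r (i, j) a) * herm_chart (vec_lambda a) $ i $ j + chol_sum r i j a"
proof -
  have s: "chol_scale r (j, i) a = chol_scale r (i, j) a"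
    using assms by (auto simp: chol_scale_def pivot_def inj_eq)
  have c: "Re (chol_sum r j i a) = Re (chol_sum r i j a)" "Im (chol_sum r j i a) = - Im (chol_sum r i j a)"
    by (simp_all flip: chol_sum_cnj[of r i j])
  consider "i = j" | "i < j" | "j < i" by (rule linorder_cases)
  then show ?thesis
  proof cases
    case 1
    then show ?thesis
      using c by (simp add: herm_chart_nth complex_eq_iff chol_coords_def chol_shift_def chol_scale_def)
  next
    case 2
    then have "i \<le> j" "\<not> j \<le> i" "i \<noteq> j" by auto
    then show ?thesis
      using 2 c by (simp add: herm_chart_nth complex_eq_iff chol_coords_def chol_shift_def s)
  next
    case 3
    then have "j \<le> i" "\<not> i \<le> j" "i \<noteq> j" "\<not> i < j" by auto
    then show ?thesis
      using 3 c by (simp add: herm_chart_nth complex_eq_iff chol_coords_def chol_shift_def s)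
  qed
qed

lemma lower_triangular_chol_factor: "lower_triangular r (chol_factor r a)"
  by (auto simp: lower_triangular_def chol_factor_def)

lemma chol_factor_diag: "chol_factor r a $ i $ i = of_real (sqrt (a (i, i)))"
  by (simp add: chol_factor_def)

text \<open>Only the one pivot belonging to (i, j) has to be positive. The local form is needed in
  \<open>chol_coords_pos\<close>, where the entries before the first bad pivot still have to be
  those of a product L L^H.\<close>

lemma herm_chart_chol_coords_entry:
  assumes r: "inj r" and pos: "0 < a (pivot r i j, pivot r i j)"
  shows "herm_chart (vec_lambda (chol_coords r a)) $ i $ j =
    (\<Sum>l\<in>UNIV. chol_factor r a $ i $ l * cnj (chol_factor r a $ j $ l))"
proof -
  let ?L = "chol_factor r a" and ?m = "pivot r i j" and ?H = "herm_chart (vec_lambda a)"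
  have neq: "r k \<noteq> r l" if "k \<noteq> l" for k l using r that by (auto simp: inj_eq)
  have "(\<Sum>l\<in>UNIV. ?L $ i $ l * cnj (?L $ j $ l)) = (\<Sum>l\<in>insert ?m {l. r l < r i \<and> r l < r j}. ?L $ i $ l * cnj (?L $ j $ l))"
  proof (rule sum.mono_neutral_right; (intro ballI)?)
    fix l assume "l \<in> UNIV - insert ?m {l. r l < r i \<and> r l < r j}"
    then have "l \<noteq> ?m" "r i \<le> r l \<or> r j \<le> r l" by auto
    then have "r i < r l \<or> r j < r l"
      using neq[of l i] neq[of l j] by (auto simp: pivot_def split: if_splits)
    then show "?L $ i $ l * cnj (?L $ j $ l) = 0"
      using lower_triangular_chol_factor[of r a] by (auto simp: lower_triangular_def)
  qed auto
  also have "\<dots> = ?L $ i $ ?m * cnj (?L $ j $ ?m) + (\<Sum>l | r l < r i \<and> r l < r j. ?L $ i $ l * cnj (?L $ j $ l))"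
    by (subst sum.insert) (auto simp: pivot_def split: if_splits)
  also have "(\<Sum>l | r l < r i \<and> r l < r j. ?L $ i $ l * cnj (?L $ j $ l)) = chol_sum r i j a"
    unfolding chol_sum_def by (intro sum.cong) (auto simp: chol_factor_def)
  also have "?L $ i $ ?m * cnj (?L $ j $ ?m) = of_real (chol_scale r (i, j) a) * ?H $ i $ j"
  proof -
    have "cnj (?H $ j $ i) = ?H $ i $ j" by (metis ctranspose_herm_chart ctranspose_nth)
    moreover have "of_real (sqrt (a (i, i))) * of_real (sqrt (a (i, i))) = (of_real (a (i, i)) :: complex)" if "0 < a (i, i)"
      using that by (simp flip: of_real_mult)
    ultimately show ?thesis
      using pos neq[of i j] neq[of j i]
      by (cases "i = j") (auto simp: chol_scale_def chol_factor_def pivot_def herm_chart_nth not_le split: if_splits)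
  qed
  finally show ?thesis
    by (simp add: herm_chart_chol_coords_nth[OF r])
qed

lemma herm_chart_chol_coords:
  assumes "inj r" "\<And>k. 0 < a (k, k)"
  shows "herm_chart (vec_lambda (chol_coords r a)) = chol r a"
  using assms by (simp add: vec_eq_iff chol_def matrix_matrix_mult_def herm_chart_chol_coords_entry)

lemma det_chol_factor: "inj r \<Longrightarrow> det (chol_factor r a) = of_real (\<Prod>k\<in>UNIV. sqrt (a (k, k)))"
  by (simp add: det_lower_triangular[OF _ lower_triangular_chol_factor] chol_factor_diag)

lemma invertible_chol_factor: "inj r \<Longrightarrow> (\<And>k. 0 < a (k, k)) \<Longrightarrow> invertible (chol_factor r a)"
  by (simp add: invertible_det_nz det_chol_factor less_imp_neq[THEN not_sym])

lemma chol_hpd: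
  assumes "inj r" "\<And>k. 0 < a (k, k)"
  shows "chol r a \<in> hpd"
  using act_hpd[OF mat_1_hpd invertible_chol_factor[of r a, OF assms]] by (simp add: act_def chol_def)

text \<open>The converse of \<open>chol_hpd\<close>. Together they identify the points that the
  substitution sends into \<open>hpd\<close>; since the substitution formula holds on the whole
  space, \<open>hpd\<close> is then covered without constructing a decomposition of a given
  matrix.\<close>

lemma chol_coords_pos:
  assumes r: "inj r" and hpd: "herm_chart (vec_lambda (chol_coords r a)) \<in> hpd"
  shows "0 < a (k, k)"
proof (rule ccontr)
  let ?X = "herm_chart (vec_lambda (chol_coords r a))"
  assume "\<not> 0 < a (k, k)"
  define k0 where "k0 = (ARG_MIN r k. \<not> 0 < a (k, k))"
  have k0: "\<not> 0 < a (k0, k0)"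
    unfolding k0_def by (rule arg_min_natI) fact
  have less: "0 < a (l, l)" if "r l < r k0" for l
    using that arg_min_nat_le[of "\<lambda>k. \<not> 0 < a (k, k)" l r] by (force simp: k0_def)
  (* k0 is the first nonpositive pivot. The vector v below is orthogonal to all earlier columns of the
     factor, so that the quadratic form at v equals that pivot. *)
  define M where "M = (\<chi> i l. if r l < r k0 then chol_factor r a $ i $ l else 0)"
  \<comment> \<open>Completing the earlier columns by unit vectors gives an invertible matrix, so v
    can be prescribed: it is orthogonal to those columns and has coordinate 1 at k0.\<close>
  define L where "L = (\<chi> i l. if r l < r k0 then chol_factor r a $ i $ l else if i = l then 1 else 0)"
  have L: "lower_triangular r L"
    using lower_triangular_chol_factor[of r a] by (auto simp: lower_triangular_def L_def)
  have "L $ i $ i \<noteq> 0" for i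
    using less[of i] by (auto simp: L_def chol_factor_diag)
  then have "invertible (ctranspose L)"
    by (simp add: invertible_det_nz det_ctranspose det_lower_triangular[OF r L])
  then obtain v where v: "ctranspose L *v v = axis k0 1"
    by (metis matrix_inv_mult(1) matrix_vector_mul_assoc matrix_vector_mul_lid)
  have v1: "v $ l = axis k0 1 $ l" if "\<not> r l < r k0" for l
  proof -
    have "(ctranspose L *v v) $ l = (\<Sum>i\<in>UNIV. if i = l then v $ i else 0)"
      unfolding matrix_vector_mult_def vec_lambda_beta
      by (intro sum.cong refl) (use that in \<open>simp add: L_def\<close>)
    then show ?thesis by (simp add: v)
  qed
  have v0: "r l \<le> r k0" if "v $ l \<noteq> 0" for l
    using v1[of l] that by (cases "r l < r k0") (auto simp: axis_def split: if_splits)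
  have Mv: "ctranspose M *v v = 0"
  proof -
    have "(ctranspose M *v v) $ l = 0" for l
    proof (cases "r l < r k0")
      case True
      then have "(ctranspose M *v v) $ l = (ctranspose L *v v) $ l"
        by (simp add: matrix_vector_mult_def M_def L_def)
      then show ?thesis using True by (auto simp: v axis_def)
    qed (simp add: matrix_vector_mult_def M_def)
    then show ?thesis by (simp add: vec_eq_iff)
  qed
  \<comment> \<open>The vector v vanishes at ranks above that of k0, so only this block matters.
    There the matrix is M M^H plus the bad pivot at (k0, k0).\<close>
  have X: "?X $ i $ j = (M ** ctranspose M) $ i $ j + (if i = k0 \<and> j = k0 then of_real (a (k0, k0)) else 0)"
    if "r i \<le> r k0" "r j \<le> r k0" for i j
  proof (cases "i = k0 \<and> j = k0")
    case True
    have "(M ** ctranspose M) $ k0 $ k0 = (\<Sum>l\<in>UNIV. if r l < r k0 then chol_factor r a $ k0 $ l * cnj (chol_factor r a $ k0 $ l) else 0)"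
      by (auto simp: matrix_matrix_mult_def M_def intro!: sum.cong)
    also have "\<dots> = chol_sum r k0 k0 a"
      unfolding chol_sum_def by (subst sum.If_cases) (auto simp: chol_factor_def intro!: sum.cong)
    moreover have "herm_chart (vec_lambda a) $ k0 $ k0 = of_real (a (k0, k0))"
      by (simp add: herm_chart_nth)
    ultimately show ?thesis
      using True by (simp add: herm_chart_chol_coords_nth[OF r] chol_scale_def)
  next
    case False
    then have m: "r (pivot r i j) < r k0"
      using r that by (auto simp: pivot_def inj_eq le_less)
    have "?X $ i $ j = (\<Sum>l\<in>UNIV. chol_factor r a $ i $ l * cnj (chol_factor r a $ j $ l))"
      using less[OF m] by (rule herm_chart_chol_coords_entry[OF r])
    also have "\<dots> = (\<Sum>l\<in>UNIV. M $ i $ l * cnj (M $ j $ l))"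
    proof (intro sum.cong refl)
      fix l
      have "\<not> r l < r k0 \<Longrightarrow> chol_factor r a $ i $ l = 0 \<or> chol_factor r a $ j $ l = 0"
        using m lower_triangular_chol_factor[of r a] by (auto simp: lower_triangular_def pivot_def split: if_splits)
      then show "chol_factor r a $ i $ l * cnj (chol_factor r a $ j $ l) = M $ i $ l * cnj (M $ j $ l)"
        by (auto simp: M_def)
    qed
    finally show ?thesis using False by (auto simp: matrix_matrix_mult_def)
  qed
  have "v \<bullet> (?X *v v) = Re (\<Sum>i\<in>UNIV. \<Sum>j\<in>UNIV. cnj (v $ i) * ?X $ i $ j * v $ j)"
    by (simp only: quadratic_form_eq_inner)
  also have "\<dots> = Re (\<Sum>i\<in>UNIV. \<Sum>j\<in>UNIV. cnj (v $ i) * (M ** ctranspose M) $ i $ j * v $ j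
      + (if i = k0 then if j = k0 then cnj (v $ i) * of_real (a (k0, k0)) * v $ j else 0 else 0))"
  proof (intro arg_cong[of _ _ Re] sum.cong refl)
    fix i j
    show "cnj (v $ i) * ?X $ i $ j * v $ j = cnj (v $ i) * (M ** ctranspose M) $ i $ j * v $ j
      + (if i = k0 then if j = k0 then cnj (v $ i) * of_real (a (k0, k0)) * v $ j else 0 else 0)"
      using X[of i j] v0[of i] v0[of j]
      by (cases "v $ i = 0"; cases "v $ j = 0") (auto simp: algebra_simps)
  qed
  also have "\<dots> = v \<bullet> ((M ** ctranspose M) *v v) + Re (cnj (v $ k0) * of_real (a (k0, k0)) * v $ k0)"
    by (simp add: sum.distrib quadratic_form_eq_inner[symmetric] if_distrib[of "sum _"] sum.If_cases flip: sum.delta)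
  also have "\<dots> = a (k0, k0)"
    using v1[of k0] by (simp flip: matrix_vector_mul_assoc add: Mv)
  finally have "v \<bullet> (?X *v v) \<le> 0" using k0 by simp
  moreover have "v \<noteq> 0" using v1[of k0] by auto
  ultimately show False using hpd_inner_pos[OF hpd] by force
qed

lemma chol_coords_hpd_iff:
  "inj r \<Longrightarrow> herm_chart (vec_lambda (chol_coords r a)) \<in> hpd \<longleftrightarrow> (\<forall>k. 0 < a (k, k))"
  using chol_coords_pos chol_hpd herm_chart_chol_coords by metis

text \<open>For each i of larger rank than k, the two real coordinates of the complex entry (i, k)
  are both scaled by the root of the pivot at k. Together they contribute one full power of
  it.\<close>

lemma prod_chol_scale:
  assumes r: "inj r" and pos: "\<And>k. 0 < a (k, k)"
  shows "(\<Prod>p\<in>UNIV. chol_scale r p a) = (\<Prod>k\<in>UNIV. a (k, k) ^ card {i. r k < r i})"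
proof -
  have "(\<Prod>p\<in>UNIV. chol_scale r p a) = (\<Prod>i\<in>UNIV. \<Prod>j\<in>UNIV. chol_scale r (i, j) a)"
    by (simp add: prod.cartesian_product)
  also have "\<dots> = (\<Prod>i\<in>UNIV. \<Prod>j\<in>UNIV. (if r i < r j then sqrt (a (i, i)) else 1) * (if r j < r i then sqrt (a (j, j)) else 1))"
  proof (intro prod.cong refl)
    fix i j
    show "chol_scale r (i, j) a = (if r i < r j then sqrt (a (i, i)) else 1) * (if r j < r i then sqrt (a (j, j)) else 1)"
      using r pos by (cases "r i" "r j" rule: linorder_cases) (auto simp: chol_scale_def pivot_def inj_eq)
  qed
  also have "\<dots> = (\<Prod>i\<in>UNIV. \<Prod>j\<in>UNIV. if r i < r j then sqrt (a (i, i)) else 1)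
      * (\<Prod>j\<in>UNIV. \<Prod>i\<in>UNIV. if r j < r i then sqrt (a (j, j)) else 1)"
    by (subst (3) prod.swap) (simp add: prod.distrib)
  also have "\<dots> = (\<Prod>k\<in>UNIV. sqrt (a (k, k)) ^ card {i. r k < r i} * sqrt (a (k, k)) ^ card {i. r k < r i})"
    by (simp add: prod.distrib prod.If_cases)
  also have "\<dots> = (\<Prod>k\<in>UNIV. a (k, k) ^ card {i. r k < r i})"
    using pos by (simp add: less_imp_le flip: power_mult_distrib)
  finally show ?thesis .
qed

lemma chol_scale_nonzero: "chol_scale r p a \<noteq> 0"
  by (simp add: chol_scale_def Let_def)

section \<open>The volume in Cholesky coordinates\<close>

abbreviation lborel_PiM :: "('p \<Rightarrow> real) measure" where
  "lborel_PiM \<equiv> PiM UNIV (\<lambda>_. lborel)"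

lemma borel_measurable_vec_nth [measurable]: "(\<lambda>x. x $ i) \<in> borel_measurable borel"
  for i :: "'n::finite"
  by (intro borel_measurable_continuous_onI continuous_intros continuous_on_component)

lemma borel_measurable_herm_chart_nth [measurable]:
  "(\<lambda>a. herm_chart (vec_lambda a) $ i $ j) \<in> borel_measurable lborel_PiM"
proof -
  have "(\<lambda>a. herm_chart (vec_lambda a)) \<in> borel_measurable lborel_PiM"
    by measurable
  from measurable_compose[OF this borel_measurable_vec_nth[of i]] show ?thesis
    by (rule measurable_compose) (rule borel_measurable_vec_nth)
qed

lemma borel_measurable_cnj [measurable]: "cnj \<in> borel_measurable borel"
  by (intro borel_measurable_continuous_onI continuous_intros)

lemma borel_measurable_chol_scale [measurable]: "chol_scale r p \<in> borel_measurable lborel_PiM"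
  unfolding chol_scale_def Let_def by measurable

lemma borel_measurable_chol_shift [measurable]: "chol_shift r p \<in> borel_measurable lborel_PiM"
  unfolding chol_shift_def chol_sum_def by (cases "fst p \<le> snd p") simp_all

lemma borel_measurable_matrixI:
  fixes f :: "'a \<Rightarrow> complex^'n^'m"
  assumes [measurable]: "\<And>i j. (\<lambda>x. f x $ i $ j) \<in> borel_measurable M"
  shows "f \<in> borel_measurable M"
proof -
  have "(\<lambda>x. f x \<bullet> b) \<in> borel_measurable M" if "b \<in> Basis" for b
  proof -
    have "b \<in> (\<Union>i. \<Union>u\<in>Basis. {axis i u})"
      using that by (subst (asm) Basis_vec_def)
    then obtain i c where b: "b = axis i c" "c \<in> Basis" by blast
    have "c \<in> (\<Union>i. \<Union>u\<in>Basis. {axis i u})"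
      using b(2) by (subst (asm) Basis_vec_def)
    then obtain j d where c: "c = axis j d" "d \<in> Basis" by blast
    show ?thesis unfolding b c by (simp add: inner_axis)
  qed
  then show ?thesis by (subst borel_measurable_euclidean_space) blast
qed

lemma borel_measurable_chol [measurable]: "chol r \<in> borel_measurable lborel_PiM"
proof (rule borel_measurable_matrixI)
  have [measurable]: "(\<lambda>a. chol_factor r a $ i $ j) \<in> borel_measurable lborel_PiM" for i j
    unfolding chol_factor_def vec_lambda_beta by measurable
  show "(\<lambda>a. chol r a $ i $ j) \<in> borel_measurable lborel_PiM" for i j
    by (simp add: chol_def matrix_matrix_mult_def)
qed

definition chol_domain :: "('n \<times> 'n \<Rightarrow> real) set" where
  "chol_domain = {a. \<forall>k. 0 < a (k, k)}"

lemma chol_domain_measurable [measurable]: "(chol_domain :: ('n::finite \<times> 'n \<Rightarrow> real) set) \<in> sets lborel_PiM"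
proof -
  have "{a \<in> space lborel_PiM. \<forall>k::'n. 0 < a (k, k)} \<in> sets lborel_PiM"
    by measurable
  then show ?thesis by (simp add: chol_domain_def space_PiM)
qed

lemma herm_chart_update:
  assumes "p \<noteq> (i, j)" "p \<noteq> (j, i)"
  shows "herm_chart (vec_lambda (a(p := y))) $ i $ j = herm_chart (vec_lambda a) $ i $ j"
  using assms by (auto simp: herm_chart_nth)

text \<open>The numerator of each pivot power is the Jacobian of the substitution, the denominator
  the Riemannian density at L L^H.\<close>

lemma nn_integral_vol_chol:
  fixes F :: "'n::{finite,linorder} cmat \<Rightarrow> ennreal"
  assumes r: "inj r" and F [measurable]: "F \<in> borel_measurable (restrict_space borel hpd)"
  shows "(\<integral>\<^sup>+x. F x \<partial>vol) = (\<integral>\<^sup>+a. indicator chol_domain a * (F (chol r a) *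
     ennreal (2 ^ (CARD('n) * (CARD('n) - 1) div 2) * (\<Prod>k\<in>UNIV. a (k, k) ^ card {i. r k < r i} / a (k, k) ^ CARD('n)))) \<partial>lborel_PiM)"
proof -
  let ?G = "\<lambda>a. F (herm_chart a) * (indicator hpd (herm_chart a) * ennreal (vol_density (herm_chart a)))"
  \<comment> \<open>Coordinates are ranked by their pivot index. Within one pivot index the diagonal
    coordinate comes first, since its root is the scale of the others; the doubling makes room for
    this.\<close>
  define rank where "rank = (\<lambda>p. 2 * r (pivot r (fst p) (snd p)) + (if fst p = snd p then 0 else 1))"
  have "(\<lambda>x. F x * indicator hpd x) \<in> borel_measurable borel"
    using F by (subst (asm) borel_measurable_restrict_space_iff_ennreal) auto
  from measurable_compose[OF borel_measurable_herm_chart this]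
  have "(\<lambda>a. (F (herm_chart a) * indicator hpd (herm_chart a)) * (indicator hpd (herm_chart a) * ennreal (vol_density (herm_chart a))))
      \<in> borel_measurable borel"
    by (rule borel_measurable_times_ennreal) (rule borel_measurable_vol_weight)
  also have "(\<lambda>a. (F (herm_chart a) * indicator hpd (herm_chart a)) * (indicator hpd (herm_chart a) * ennreal (vol_density (herm_chart a))))
      = ?G"
    by (auto simp: fun_eq_iff indicator_def)
  finally have G [measurable]: "?G \<in> borel_measurable borel" .
  have scale: "chol_scale r p (a(q := y)) = chol_scale r p a" if "rank p \<le> rank q" for p q a y
    using that by (auto simp: chol_scale_def rank_def pivot_def Let_def split: if_splits)
  have sum: "chol_sum r i j (a(q := y)) = chol_sum r i j a" if le: "rank (i, j) \<le> rank q" for i j q a y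
  proof -
    have "q \<noteq> (l, k)" "q \<noteq> (k, l)" if "r k < r i" "r k < r j" for k l
    proof -
      have "rank (l, k) < rank (i, j)" "rank (k, l) < rank (i, j)"
        using that by (auto simp: rank_def pivot_def)
      then show "q \<noteq> (l, k)" "q \<noteq> (k, l)" using le by auto
    qed
    then show ?thesis
      unfolding chol_sum_def by (intro sum.cong refl) (simp add: herm_chart_update)
  qed
  have "(\<integral>\<^sup>+x. F x \<partial>vol) = (\<integral>\<^sup>+a. ?G a \<partial>lborel)"
    by (rule nn_integral_vol) fact
  also have "\<dots> = (\<integral>\<^sup>+a. ?G (vec_lambda a) \<partial>lborel_PiM)"
    by (rule nn_integral_lborel_vec) fact
  also have "\<dots> = (\<integral>\<^sup>+a. ?G (vec_lambda (chol_coords r a)) * ennreal (\<Prod>p\<in>UNIV. \<bar>chol_scale r p a\<bar>) \<partial>lborel_PiM)"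
    unfolding chol_coords_def
  proof (rule nn_integral_PiM_triangular[where rank = rank, symmetric])
    show "(\<lambda>a. ?G (vec_lambda a)) \<in> borel_measurable lborel_PiM"
      using G by (rule measurable_compose[OF measurable_vec_lambda])
    show "chol_shift r p (a(q := y)) = chol_shift r p a" if "rank p \<le> rank q" for p q a y
      using sum[of "fst p" "snd p" q a y] that by (simp add: chol_shift_def)
  qed (simp_all add: scale chol_scale_nonzero)
  also have "\<dots> = (\<integral>\<^sup>+a. indicator chol_domain a * (F (chol r a) *
     ennreal (2 ^ (CARD('n) * (CARD('n) - 1) div 2) * (\<Prod>k\<in>UNIV. a (k, k) ^ card {i. r k < r i} / a (k, k) ^ CARD('n)))) \<partial>lborel_PiM)"
  proof (rule nn_integral_cong)
    fix a :: "'n \<times> 'n \<Rightarrow> real"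
    let ?c = "2 ^ (CARD('n) * (CARD('n) - 1) div 2) :: real"
    show "?G (vec_lambda (chol_coords r a)) * ennreal (\<Prod>p\<in>UNIV. \<bar>chol_scale r p a\<bar>)
      = indicator chol_domain a * (F (chol r a) * ennreal (?c * (\<Prod>k\<in>UNIV. a (k, k) ^ card {i. r k < r i} / a (k, k) ^ CARD('n))))"
    proof (cases "a \<in> chol_domain")
      case False
      then show ?thesis by (simp add: chol_domain_def chol_coords_hpd_iff[OF r])
    next
      case True
      then have pos: "\<And>k. 0 < a (k, k)" by (simp add: chol_domain_def)
      have "vol_density (chol r a) = ?c / (\<Prod>i\<in>UNIV. sqrt (a (i, i))) ^ (2 * CARD('n))"
        unfolding chol_def using pos
        by (intro vol_density_lower_triangular[OF r]) (auto simp: lower_triangular_chol_factor chol_factor_diag)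
      also have "(\<Prod>i\<in>UNIV. sqrt (a (i, i))) ^ (2 * CARD('n)) = (\<Prod>i\<in>UNIV. a (i, i) ^ CARD('n))"
        using pos by (simp add: power_mult less_imp_le prod_power_distrib)
      finally have vd: "vol_density (chol r a) = ?c / (\<Prod>i\<in>UNIV. a (i, i) ^ CARD('n))" .
      have abs: "\<bar>chol_scale r p a\<bar> = chol_scale r p a" for p
        using pos by (auto simp: chol_scale_def Let_def less_imp_le)
      have "ennreal (vol_density (chol r a)) * ennreal (\<Prod>p\<in>UNIV. \<bar>chol_scale r p a\<bar>)
        = ennreal (?c / (\<Prod>i\<in>UNIV. a (i, i) ^ CARD('n)) * (\<Prod>k\<in>UNIV. a (k, k) ^ card {i. r k < r i}))"
        unfolding abs vd prod_chol_scale[of r a, OF r pos]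
        using pos by (intro ennreal_mult[symmetric]) (auto intro!: prod_nonneg divide_nonneg_nonneg simp: less_imp_le)
      then show ?thesis
        using True pos by (simp add: chol_hpd[of r a, OF r pos] herm_chart_chol_coords[of r a, OF r pos] mult.assoc prod_dividef)
    qed
  qed
  finally show ?thesis .
qed

subsection \<open>Integration in Cholesky coordinates\<close>

text \<open>The density of \<open>vol\<close> with respect to Lebesgue measure in Cholesky
  coordinates.\<close>

definition chol_weight :: "('n::{finite,linorder} \<Rightarrow> nat) \<Rightarrow> ('n \<times> 'n \<Rightarrow> real) \<Rightarrow> real" where
  "chol_weight r a = indicator chol_domain a * (2 ^ (CARD('n) * (CARD('n) - 1) div 2)
     * (\<Prod>k\<in>UNIV. a (k, k) ^ card {i. r k < r i} / a (k, k) ^ CARD('n)))"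

lemma chol_weight_nonneg: "0 \<le> chol_weight r a"
  by (auto simp: chol_weight_def chol_domain_def indicator_def less_imp_le intro!: mult_nonneg_nonneg prod_nonneg)

lemma borel_measurable_chol_weight [measurable]: "chol_weight r \<in> borel_measurable lborel_PiM"
  unfolding chol_weight_def by measurable

(* The value mat 1 is arbitrary: chol_weight vanishes outside chol_domain. *)
definition chol_ext :: "('n::{finite,linorder} \<Rightarrow> nat) \<Rightarrow> ('n \<times> 'n \<Rightarrow> real) \<Rightarrow> 'n cmat" where
  "chol_ext r a = (if a \<in> chol_domain then chol r a else mat 1)"

lemma measurable_chol_ext [measurable]:
  assumes "inj r"
  shows "chol_ext r \<in> measurable lborel_PiM vol"
proof -
  have "chol_ext r \<in> measurable lborel_PiM (restrict_space borel hpd)"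
  proof (rule measurable_restrict_space2)
    show "chol_ext r \<in> space lborel_PiM \<rightarrow> hpd"
      using chol_hpd[OF assms] by (auto simp: chol_ext_def chol_domain_def)
    show "chol_ext r \<in> borel_measurable lborel_PiM"
      unfolding chol_ext_def by measurable
  qed
  then show ?thesis
    by (simp add: measurable_cong_sets[OF refl sets_vol])
qed

text \<open>Turns the identity of nonnegative integrals into an identity of measures, so that it
  also serves complex integrands and almost-everywhere statements.\<close>

lemma vol_eq_distr_chol:
  assumes r: "inj r"
  shows "vol = distr (density lborel_PiM (\<lambda>a. ennreal (chol_weight r a))) vol (chol_ext r)"
proof (rule measure_eqI)
  note [measurable] = measurable_chol_ext[OF r]
  fix A :: "'a cmat set" assume A [measurable]: "A \<in> sets vol"
  have "emeasure vol A = (\<integral>\<^sup>+x. indicator A x \<partial>vol)" by simp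
  also have "\<dots> = (\<integral>\<^sup>+a. indicator chol_domain a * (indicator A (chol r a) *
     ennreal (2 ^ (CARD('a) * (CARD('a) - 1) div 2) * (\<Prod>k\<in>UNIV. a (k, k) ^ card {i. r k < r i} / a (k, k) ^ CARD('a)))) \<partial>lborel_PiM)"
    using A by (intro nn_integral_vol_chol r) (simp add: sets_vol)
  also have "\<dots> = (\<integral>\<^sup>+a. ennreal (chol_weight r a) * indicator A (chol_ext r a) \<partial>lborel_PiM)"
    by (intro nn_integral_cong) (auto simp: chol_weight_def chol_ext_def indicator_def)
  also have "\<dots> = (\<integral>\<^sup>+x. indicator A x \<partial>distr (density lborel_PiM (\<lambda>a. ennreal (chol_weight r a))) vol (chol_ext r))"
    by (simp add: nn_integral_distr nn_integral_density del: nn_integral_indicator)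
  finally show "emeasure vol A = emeasure (distr (density lborel_PiM (\<lambda>a. ennreal (chol_weight r a))) vol (chol_ext r)) A"
    by simp
qed simp

lemma
  fixes f :: "_ \<Rightarrow> 'b::{banach,second_countable_topology}"
  assumes r: "inj r" and f [measurable]: "f \<in> borel_measurable vol"
  shows integrable_vol_chol: "integrable vol f \<longleftrightarrow> integrable lborel_PiM (\<lambda>a. chol_weight r a *\<^sub>R f (chol_ext r a))"
    and integral_vol_chol: "integral\<^sup>L vol f = (\<integral>a. chol_weight r a *\<^sub>R f (chol_ext r a) \<partial>lborel_PiM)"
proof -
  note [measurable] = measurable_chol_ext[OF r]
  show "integrable vol f \<longleftrightarrow> integrable lborel_PiM (\<lambda>a. chol_weight r a *\<^sub>R f (chol_ext r a))"
    by (subst (1) vol_eq_distr_chol[OF r])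
      (simp add: integrable_distr_eq integrable_density chol_weight_nonneg)
  show "integral\<^sup>L vol f = (\<integral>a. chol_weight r a *\<^sub>R f (chol_ext r a) \<partial>lborel_PiM)"
    by (subst (1) vol_eq_distr_chol[OF r])
      (simp add: integral_distr integral_density chol_weight_nonneg)
qed

lemma prod_diagonal:
  fixes f :: "'n::finite \<Rightarrow> 'a::comm_monoid_mult"
  shows "(\<Prod>p\<in>UNIV. if fst p = snd p then f (fst p) else g p) = (\<Prod>k\<in>UNIV. f k) * (\<Prod>p | fst p \<noteq> snd p. g p)"
proof -
  have "(\<Prod>p | fst p = snd p. f (fst p)) = (\<Prod>k\<in>UNIV. f k)"
    by (rule prod.reindex_bij_witness[of _ "\<lambda>k. (k, k)" fst]) auto
  then show ?thesis
    by (simp add: prod.If_cases Compl_eq)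
qed

text \<open>The trace of L L^H is the squared Frobenius norm of L. In these coordinates it has no
  mixed terms, which is what makes the exponential split.\<close>

lemma trace_chol:
  assumes r: "inj r" and a: "a \<in> chol_domain"
  shows "trace (chol r a) = of_real ((\<Sum>k\<in>UNIV. a (k, k)) + (\<Sum>p | fst p \<noteq> snd p. (a p)\<^sup>2))"
proof -
  let ?L = "chol_factor r a"
  let ?g = "\<lambda>i k. if r k < r i then (a (i, k))\<^sup>2 + (a (k, i))\<^sup>2 else 0"
  have sq: "?L $ i $ k * cnj (?L $ i $ k) = of_real ((if i = k then a (k, k) else 0) + ?g i k)" for i k
  proof (cases "i = k")
    case True
    then show ?thesis
      using a by (simp add: chol_factor_diag chol_domain_def less_imp_le flip: of_real_mult)
  next
    case False
    have "z * cnj z = of_real ((Re z)\<^sup>2 + (Im z)\<^sup>2)" for z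
      using complex_norm_square[of z] by (simp add: cmod_power2)
    moreover have "(Re (herm_chart (vec_lambda a) $ i $ k))\<^sup>2 + (Im (herm_chart (vec_lambda a) $ i $ k))\<^sup>2 = (a (i, k))\<^sup>2 + (a (k, i))\<^sup>2"
      using False by (simp add: herm_chart_nth)
    ultimately have "herm_chart (vec_lambda a) $ i $ k * cnj (herm_chart (vec_lambda a) $ i $ k) = of_real ((a (i, k))\<^sup>2 + (a (k, i))\<^sup>2)"
      by metis
    then show ?thesis
      using False by (simp add: chol_factor_def)
  qed
  have "trace (chol r a) = (\<Sum>i\<in>UNIV. \<Sum>k\<in>UNIV. of_real ((if i = k then a (k, k) else 0) + ?g i k))"
    by (simp add: trace_def chol_def matrix_matrix_mult_def sq)
  also have "\<dots> = of_real (\<Sum>i\<in>UNIV. \<Sum>k\<in>UNIV. (if i = k then a (k, k) else 0) + ?g i k)"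
    by simp
  also have "(\<Sum>i\<in>UNIV. \<Sum>k\<in>UNIV. (if i = k then a (k, k) else 0) + ?g i k)
     = (\<Sum>i\<in>UNIV. a (i, i)) + (\<Sum>i\<in>UNIV. \<Sum>k\<in>UNIV. ?g i k)"
    by (simp add: sum.distrib)
  also have "(\<Sum>i\<in>UNIV. \<Sum>k\<in>UNIV. ?g i k)
     = (\<Sum>i\<in>UNIV. \<Sum>k\<in>UNIV. if r k < r i then (a (i, k))\<^sup>2 else 0) + (\<Sum>k\<in>UNIV. \<Sum>i\<in>UNIV. if r k < r i then (a (k, i))\<^sup>2 else 0)"
    by (subst (3) sum.swap) (simp add: sum.distrib[symmetric] if_distrib cong: if_cong)
  also have "\<dots> = (\<Sum>i\<in>UNIV. \<Sum>k\<in>UNIV. if i \<noteq> k then (a (i, k))\<^sup>2 else 0)"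
    unfolding sum.distrib[symmetric]
  proof (intro sum.cong refl)
    fix i k
    show "(if r k < r i then (a (i, k))\<^sup>2 else 0) + (if r i < r k then (a (i, k))\<^sup>2 else 0) = (if i \<noteq> k then (a (i, k))\<^sup>2 else 0)"
      using r by (cases "r i" "r k" rule: linorder_cases) (auto simp: inj_eq)
  qed
  also have "\<dots> = (\<Sum>p\<in>UNIV \<times> UNIV. if fst p \<noteq> snd p then (a p)\<^sup>2 else 0)"
    by (simp add: sum.cartesian_product case_prod_unfold cong: if_cong)
  also have "\<dots> = (\<Sum>p | fst p \<noteq> snd p. (a p)\<^sup>2)"
    by (simp add: sum.If_cases)
  finally show ?thesis .
qed

section \<open>One-dimensional integrals and their product\<close>

lemma
  assumes "0 < Re z"
  shows integrable_Gamma_lborel: "integrable lborel (\<lambda>t. indicator {0<..} t *\<^sub>R (complex_of_real t powr (z - 1) / of_real (exp t)))" (is "integrable _ ?f")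
    and integral_Gamma_lborel: "(\<integral>t. indicator {0<..} t *\<^sub>R (complex_of_real t powr (z - 1) / of_real (exp t)) \<partial>lborel) = Gamma z"
proof -
  have "continuous_on {0<..} (\<lambda>t. complex_of_real t powr (z - 1) / of_real (exp t))"
    by (intro continuous_intros) (auto simp: complex_nonpos_Reals_iff)
  then have m: "?f \<in> borel_measurable borel"
    by (intro borel_measurable_continuous_on_indicator) auto
  have "(\<lambda>t. complex_of_real t powr (z - 1) / of_real (exp t)) absolutely_integrable_on {0<..}"
    by (rule absolutely_integrable_Gamma_integral'[OF assms])
  then have i: "integrable lebesgue ?f"
    by (simp add: set_integrable_def)
  then show il: "integrable lborel ?f"
    using m by (simp add: integrable_completion)
  have "(?f has_integral integral\<^sup>L lborel ?f) UNIV"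
    by (rule has_integral_integral_lborel[OF il])
  moreover have "(?f has_integral Gamma z) UNIV"
  proof -
    have "((\<lambda>t. if t \<in> {0<..} then complex_of_real t powr (z - 1) / of_real (exp t) else 0) has_integral Gamma z) UNIV"
      using Gamma_integral_complex'[OF assms] by (simp only: has_integral_restrict_UNIV)
    moreover have "?f = (\<lambda>t. if t \<in> {0<..} then complex_of_real t powr (z - 1) / of_real (exp t) else 0)"
      by (auto simp: fun_eq_iff)
    ultimately show ?thesis by simp
  qed
  ultimately show "integral\<^sup>L lborel ?f = Gamma z"
    by (rule has_integral_unique)
qed

lemma
  shows integrable_gaussian: "integrable lborel (\<lambda>t::real. complex_of_real (exp (- t\<^sup>2)))"
    and integral_gaussian: "(\<integral>t. exp (- t\<^sup>2) \<partial>lborel) = sqrt pi"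
proof -
  have eq: "exp (- t\<^sup>2) = sqrt pi * normal_density 0 (sqrt (1/2)) t" for t :: real
    by (simp add: normal_density_def)
  have i: "integrable lborel (\<lambda>t::real. exp (- t\<^sup>2))"
    unfolding eq by (intro integrable_mult_right integrable_normal_density) simp
  then show "integrable lborel (\<lambda>t::real. complex_of_real (exp (- t\<^sup>2)))"
    by (rule integrable_of_real)
  show "(\<integral>t. exp (- t\<^sup>2) \<partial>lborel) = sqrt pi"
    unfolding eq by simp
qed

text \<open>The exponent is arranged to cancel the weight, leaving the power e_k - 1 of the pivot at
  k and hence Gamma(e_k). The N (N - 1) Gaussian integrals give powers of \<pi>, which join the
  powers of 2 in the volume to form powers of 2 \<pi>. Since r, e and C are free, the same
  evaluation serves both orders of elimination.\<close>

lemma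
  fixes F :: "'n::{finite,linorder} cmat \<Rightarrow> complex" and e :: "'n \<Rightarrow> complex"
  assumes r: "inj r" and e: "\<And>k. 0 < Re (e k)" and F [measurable]: "F \<in> borel_measurable vol"
    and eq: "\<And>a. a \<in> chol_domain \<Longrightarrow> F (chol r a) = C * exp (- trace (chol r a)) *
      (\<Prod>k\<in>UNIV. complex_of_real (a (k, k)) powr (e k - 1 - of_nat (card {i. r k < r i}) + of_nat CARD('n)))"
  shows integrable_vol_powers: "integrable vol F"
    and integral_vol_powers: "integral\<^sup>L vol F = C * of_real (2 * pi) ^ (CARD('n) * (CARD('n) - 1) div 2) * (\<Prod>k\<in>UNIV. Gamma (e k))"
proof -
  interpret product_sigma_finite "\<lambda>_::'n\<times>'n. lborel :: real measure" ..
  let ?c = "2 ^ (CARD('n) * (CARD('n) - 1) div 2)"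
  define \<phi> where "\<phi> = (\<lambda>p t. if fst p = snd p
     then indicator {0<..} t *\<^sub>R (complex_of_real t powr (e (fst p) - 1) / of_real (exp t))
     else complex_of_real (exp (- t\<^sup>2)))"
  have int: "integrable lborel (\<phi> p)" for p
    unfolding \<phi>_def using integrable_Gamma_lborel[OF e] integrable_gaussian by (cases "fst p = snd p") simp_all
  have "chol_weight r a *\<^sub>R F (chol_ext r a) = C * ?c * (\<Prod>p\<in>UNIV. \<phi> p (a p))" for a
  proof (cases "a \<in> chol_domain")
    case False
    then obtain k where "\<not> 0 < a (k, k)" by (auto simp: chol_domain_def)
    then have "\<phi> (k, k) (a (k, k)) = 0" by (simp add: \<phi>_def)
    then have "(\<Prod>p\<in>UNIV. \<phi> p (a p)) = 0" by (intro prod_zero) auto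
    then show ?thesis using False by (simp add: chol_weight_def)
  next
    case True
    then have pos: "0 < a (k, k)" for k by (simp add: chol_domain_def)
    have pw: "complex_of_real (a (k, k) ^ card {i. r k < r i} / a (k, k) ^ CARD('n)) *
        complex_of_real (a (k, k)) powr (e k - 1 - of_nat (card {i. r k < r i}) + of_nat CARD('n))
      = complex_of_real (a (k, k)) powr (e k - 1)" for k
      using pos[of k] by (simp add: powr_add powr_diff powr_nat')
    have "(\<Prod>p\<in>UNIV. \<phi> p (a p)) = (\<Prod>p\<in>UNIV. if fst p = snd p
       then complex_of_real (a (fst p, fst p)) powr (e (fst p) - 1) / of_real (exp (a (fst p, fst p))) else of_real (exp (- (a p)\<^sup>2)))"
    proof (intro prod.cong refl)
      fix p
      have "a p = a (fst p, fst p)" if "fst p = snd p" using that by (metis prod.collapse)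
      then show "\<phi> p (a p) = (if fst p = snd p
       then complex_of_real (a (fst p, fst p)) powr (e (fst p) - 1) / of_real (exp (a (fst p, fst p))) else of_real (exp (- (a p)\<^sup>2)))"
        using pos[of "snd p"] by (cases "fst p = snd p") (simp_all add: \<phi>_def)
    qed
    also have "\<dots> = (\<Prod>k\<in>UNIV. complex_of_real (a (k, k)) powr (e k - 1) / of_real (exp (a (k, k)))) * (\<Prod>p | fst p \<noteq> snd p. of_real (exp (- (a p)\<^sup>2)))"
      by (rule prod_diagonal)
    also have "\<dots> = (\<Prod>k\<in>UNIV. complex_of_real (a (k, k)) powr (e k - 1)) * exp (- trace (chol r a))"
    proof -
      have "exp (- trace (chol r a)) = of_real (exp (- ((\<Sum>k\<in>UNIV. a (k, k)) + (\<Sum>p | fst p \<noteq> snd p. (a p)\<^sup>2))))"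
        by (simp only: trace_chol[OF r True] of_real_minus[symmetric] exp_of_real)
      also have "exp (- ((\<Sum>k\<in>UNIV. a (k, k)) + (\<Sum>p | fst p \<noteq> snd p. (a p)\<^sup>2)))
        = (\<Prod>k\<in>UNIV. exp (- a (k, k))) * (\<Prod>p | fst p \<noteq> snd p. exp (- (a p)\<^sup>2))"
        by (simp only: exp_sum[symmetric] finite exp_add[symmetric] sum_negf minus_add_distrib)
      finally show ?thesis
        by (simp add: prod.distrib divide_inverse exp_minus)
    qed
    finally have *: "(\<Prod>p\<in>UNIV. \<phi> p (a p)) = (\<Prod>k\<in>UNIV. complex_of_real (a (k, k)) powr (e k - 1)) * exp (- trace (chol r a))" .
    have "chol_weight r a *\<^sub>R F (chol_ext r a) = complex_of_real (chol_weight r a) * F (chol r a)"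
      using True by (simp add: chol_ext_def scaleR_conv_of_real)
    also have "complex_of_real (chol_weight r a) = ?c * (\<Prod>k\<in>UNIV. complex_of_real (a (k, k) ^ card {i. r k < r i} / a (k, k) ^ CARD('n)))"
      using True by (simp add: chol_weight_def)
    also have "\<dots> * F (chol r a) = C * ?c * exp (- trace (chol r a)) *
      (\<Prod>k\<in>UNIV. complex_of_real (a (k, k) ^ card {i. r k < r i} / a (k, k) ^ CARD('n)) *
         complex_of_real (a (k, k)) powr (e k - 1 - of_nat (card {i. r k < r i}) + of_nat CARD('n)))"
      unfolding eq[OF True] prod.distrib by (simp only: mult_ac)
    finally show ?thesis
      unfolding pw * by (simp only: mult_ac)
  qed
  note eq' = this
  show "integrable vol F"
    unfolding integrable_vol_chol[OF r F] eq'
    by (intro integrable_mult_right product_integrable_prod int) auto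
  have "integral\<^sup>L vol F = C * ?c * (\<integral>a. (\<Prod>p\<in>UNIV. \<phi> p (a p)) \<partial>lborel_PiM)"
    unfolding integral_vol_chol[OF r F] eq' by simp
  also have "(\<integral>a. (\<Prod>p\<in>UNIV. \<phi> p (a p)) \<partial>lborel_PiM) = (\<Prod>p\<in>UNIV. integral\<^sup>L lborel (\<phi> p))"
    by (rule product_integral_prod) (auto intro: int)
  also have "\<dots> = (\<Prod>p\<in>UNIV. if fst p = snd p then Gamma (e (fst p)) else of_real (sqrt pi))"
    by (intro prod.cong refl) (simp add: \<phi>_def integral_Gamma_lborel[OF e] integral_gaussian del: of_real_exp)
  also have "\<dots> = (\<Prod>k\<in>UNIV. Gamma (e k)) * of_real (sqrt pi) ^ (CARD('n) * (CARD('n) - 1))"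
    by (subst prod_diagonal[where f = "\<lambda>k. Gamma (e k)" and g = "\<lambda>_. of_real (sqrt pi)"])
      (simp add: card_off_diagonal[where 'n='n])
  also have "of_real (sqrt pi) ^ (CARD('n) * (CARD('n) - 1)) = complex_of_real pi ^ (CARD('n) * (CARD('n) - 1) div 2)"
  proof -
    have "CARD('n) * (CARD('n) - 1) = 2 * (CARD('n) * (CARD('n) - 1) div 2)" by simp
    then have "of_real (sqrt pi) ^ (CARD('n) * (CARD('n) - 1)) = (complex_of_real (sqrt pi) ^ 2) ^ (CARD('n) * (CARD('n) - 1) div 2)"
      by (metis power_mult)
    then show ?thesis by (simp flip: of_real_power)
  qed
  finally show "integral\<^sup>L vol F = C * of_real (2 * pi) ^ (CARD('n) * (CARD('n) - 1) div 2) * (\<Prod>k\<in>UNIV. Gamma (e k))"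
    by (simp add: power_mult_distrib mult_ac)
qed

subsection \<open>Leading principal minors\<close>

text \<open>The block is completed by the identity to a matrix of full size, so that facts about
  \<open>det\<close> and \<open>hpd\<close> apply to minors without a change of index type.\<close>

definition minor_ext :: "'n set \<Rightarrow> complex^'n^'n \<Rightarrow> complex^'n^'n" where
  "minor_ext S x = (\<chi> i j. if i \<in> S \<and> j \<in> S then x $ i $ j else if i = j then 1 else 0)"

lemma principal_minor_eq_det: "principal_minor S x = det (minor_ext S x)"
proof -
  have zero: "(\<Prod>i\<in>UNIV. minor_ext S x $ i $ p i) = 0" if "p permutes UNIV" "\<not> p permutes S" for p
  proof -
    have "\<exists>i. i \<notin> S \<and> p i \<noteq> i"
      using that unfolding permutes_def by blast
    then obtain i where "i \<notin> S" "p i \<noteq> i" by blast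
    then have "minor_ext S x $ i $ p i = 0" by (simp add: minor_ext_def)
    then show ?thesis by (intro prod_zero) auto
  qed
  have eq: "(\<Prod>i\<in>UNIV. minor_ext S x $ i $ p i) = (\<Prod>i\<in>S. x $ i $ p i)" if "p permutes S" for p
  proof -
    have "(\<Prod>i\<in>UNIV. minor_ext S x $ i $ p i) = (\<Prod>i\<in>S. minor_ext S x $ i $ p i)"
      using that by (intro prod.mono_neutral_right) (auto simp: minor_ext_def permutes_not_in)
    also have "\<dots> = (\<Prod>i\<in>S. x $ i $ p i)"
      using that by (intro prod.cong) (auto simp: minor_ext_def permutes_in_image)
    finally show ?thesis .
  qed
  have "det (minor_ext S x) = (\<Sum>p | p permutes S. of_int (sign p) * (\<Prod>i\<in>UNIV. minor_ext S x $ i $ p i))"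
    unfolding det_def
  proof (rule sum.mono_neutral_right)
    show "{p. p permutes S} \<subseteq> {p. p permutes UNIV}"
      using permutes_subset by blast
  qed (auto simp: zero)
  then show ?thesis
    by (simp add: principal_minor_def eq)
qed

text \<open>The form splits into the form of x at the part of v supported on S and the squared norm
  of the rest of v.\<close>

lemma minor_ext_hpd:
  assumes x: "x \<in> hpd"
  shows "minor_ext S x \<in> hpd"
  unfolding hpd_iff
proof (intro conjI allI impI)
  have "cnj (x $ j $ i) = x $ i $ j" for i j
    using hpd_ctranspose[OF x] by (metis ctranspose_nth)
  then show "ctranspose (minor_ext S x) = minor_ext S x"
    by (auto simp: vec_eq_iff minor_ext_def)
  fix v :: "complex^'a" assume "v \<noteq> 0"
  define w where "w = (\<chi> i. if i \<in> S then v $ i else 0)"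
  let ?d = "\<lambda>i. if i \<in> S then 0 else (cmod (v $ i))\<^sup>2"
  have "v \<bullet> (minor_ext S x *v v) = Re (\<Sum>i\<in>UNIV. \<Sum>j\<in>UNIV. cnj (v $ i) * minor_ext S x $ i $ j * v $ j)"
    by (simp only: quadratic_form_eq_inner)
  also have "\<dots> = Re (\<Sum>i\<in>UNIV. \<Sum>j\<in>UNIV. cnj (w $ i) * x $ i $ j * w $ j + (if j = i then of_real (?d i) else 0))"
    by (intro arg_cong[of _ _ Re] sum.cong refl)
      (auto simp: w_def minor_ext_def complex_norm_square[symmetric] mult.commute simp del: of_real_power)
  also have "\<dots> = w \<bullet> (x *v w) + (\<Sum>i\<in>UNIV. ?d i)"
    by (simp add: sum.distrib quadratic_form_eq_inner[symmetric])
  also have "\<dots> > 0"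
  proof (cases "w = 0")
    case True
    obtain i where "v $ i \<noteq> 0" using \<open>v \<noteq> 0\<close> by (auto simp: vec_eq_iff)
    moreover have "w $ i = 0" using True by simp
    with \<open>v $ i \<noteq> 0\<close> have "i \<notin> S" by (auto simp: w_def)
    ultimately have "0 < (\<Sum>i\<in>UNIV. ?d i)" by (intro sum_pos2[of _ i]) auto
    then show ?thesis using True by simp
  next
    case False
    have "0 \<le> (\<Sum>i\<in>UNIV. ?d i)" by (intro sum_nonneg) auto
    with hpd_inner_pos[OF x False] show ?thesis by linarith
  qed
  finally show "0 < v \<bullet> (minor_ext S x *v v)" .
qed

lemma principal_minor_pos:
  assumes "x \<in> hpd"
  shows "\<exists>c>0. principal_minor S x = of_real c"
  using hpd_det_pos[OF minor_ext_hpd[OF assms, of S]] hpd_det_eq[OF minor_ext_hpd[OF assms, of S]]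
  unfolding principal_minor_eq_det by blast

text \<open>The ranks for elimination from the first row and, as \<open>pos_down\<close>, from the
  last row. They count from 0, whereas \<open>card {..k}\<close> counts from 1; hence N - k and k -
  1 indices follow the k-th one in the two orders.\<close>

definition pos_up :: "'n::{finite,linorder} \<Rightarrow> nat" where "pos_up i = card {..<i}"

definition pos_down :: "'n::{finite,linorder} \<Rightarrow> nat" where "pos_down i = card {i<..}"

lemma pos_up_less_iff: "pos_up i < pos_up j \<longleftrightarrow> i < j"
proof -
  have "i < j \<Longrightarrow> pos_up i < pos_up j" for i j :: 'a
    unfolding pos_up_def by (intro psubset_card_mono) auto
  then show ?thesis by (metis less_asym linorder_neqE)
qed

lemma pos_down_less_iff: "pos_down i < pos_down j \<longleftrightarrow> j < i"
proof -
  have "j < i \<Longrightarrow> pos_down i < pos_down j" for i j :: 'a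
    unfolding pos_down_def by (intro psubset_card_mono) auto
  then show ?thesis by (metis less_asym linorder_neqE)
qed

lemma inj_pos_up: "inj pos_up"
  by (rule injI) (metis less_irrefl linorder_neqE pos_up_less_iff)

lemma inj_pos_down: "inj pos_down"
  by (rule injI) (metis less_irrefl linorder_neqE pos_down_less_iff)

lemma card_pos_up_greater: "card {i::'n. pos_up k < pos_up i} = CARD('n) - card {..k}"
  for k :: "'n::{finite,linorder}"
proof -
  have *: "{i. pos_up k < pos_up i} = UNIV - {..k}" by (auto simp: pos_up_less_iff)
  show ?thesis unfolding * by (rule card_Diff_subset) auto
qed

lemma card_pos_down_greater: "card {i::'n. pos_down k < pos_down i} = card {..k} - 1"
  for k :: "'n::{finite,linorder}"
proof -
  have *: "{i. pos_down k < pos_down i} = {..k} - {k}" by (auto simp: pos_down_less_iff)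
  show ?thesis unfolding * by (rule card_Diff_singleton) auto
qed

text \<open>The first k rows of M vanish beyond column k, so the leading block of M M^H is the
  product of the leading block of M with its own conjugate transpose.\<close>

lemma principal_minor_lower_triangular:
  assumes M: "lower_triangular pos_up M"
  shows "principal_minor {..k} (M ** ctranspose M) = (\<Prod>j\<le>k. M $ j $ j * cnj (M $ j $ j))"
proof -
  let ?N = "minor_ext {..k} M"
  have N: "lower_triangular pos_up ?N"
    using M by (auto simp: lower_triangular_def minor_ext_def)
  have M0: "M $ i $ j = 0" if "i < j" for i j
    using M that by (simp add: lower_triangular_def pos_up_less_iff)
  have "minor_ext {..k} (M ** ctranspose M) = ?N ** ctranspose ?N"
  proof -
    have "minor_ext {..k} (M ** ctranspose M) $ i $ j = (?N ** ctranspose ?N) $ i $ j" for i j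
    proof -
      consider "i \<le> k" "j \<le> k" | "k < i" | "k < j" by (meson not_le)
      then show ?thesis
      proof cases
        case 1
        have "M $ i $ l * cnj (M $ j $ l) = ?N $ i $ l * cnj (?N $ j $ l)" for l
          using 1 M0[of i l] by (cases "l \<le> k") (auto simp: minor_ext_def not_le)
        moreover have "minor_ext {..k} (M ** ctranspose M) $ i $ j = (M ** ctranspose M) $ i $ j"
          using 1 by (simp add: minor_ext_def)
        ultimately show ?thesis by (simp add: matrix_matrix_mult_def)
      next
        case 2
        have "(?N ** ctranspose ?N) $ i $ j = (\<Sum>l\<in>UNIV. if l = i then cnj (?N $ j $ i) else 0)"
          unfolding matrix_matrix_mult_def vec_lambda_beta
          by (intro sum.cong refl) (use 2 in \<open>auto simp: minor_ext_def\<close>)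
        then show ?thesis using 2 by (simp add: minor_ext_def not_le[symmetric])
      next
        case 3
        have "(?N ** ctranspose ?N) $ i $ j = (\<Sum>l\<in>UNIV. if l = j then ?N $ i $ j else 0)"
          unfolding matrix_matrix_mult_def vec_lambda_beta
          by (intro sum.cong refl) (use 3 in \<open>auto simp: minor_ext_def\<close>)
        then show ?thesis using 3 by (simp add: minor_ext_def not_le[symmetric])
      qed
    qed
    then show ?thesis by (simp add: vec_eq_iff)
  qed
  then have "principal_minor {..k} (M ** ctranspose M) = det ?N * cnj (det ?N)"
    by (simp add: principal_minor_eq_det det_mul det_ctranspose)
  also have "det ?N = (\<Prod>j\<in>UNIV. ?N $ j $ j)"
    by (rule det_lower_triangular[OF inj_pos_up N])
  also have "\<dots> = (\<Prod>j\<le>k. M $ j $ j)"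
    by (intro prod.mono_neutral_cong_right) (auto simp: minor_ext_def)
  finally show ?thesis by (simp add: cnj_prod prod.distrib)
qed

text \<open>The exponent of the k-th leading minor in \<open>Delta_gen\<close>, with s extended by 0
  beyond the last index.\<close>

definition gap :: "'a::ab_group_add^'n::{finite,linorder} \<Rightarrow> 'n \<Rightarrow> 'a" where
  "gap s k = (if {k<..} = {} then s $ k else s $ k - s $ Min {k<..})"

text \<open>A telescoping sum; the induction moves from j to its successor, the least element of
  \<open>{j<..}\<close>.\<close>

lemma sum_gap: "(\<Sum>k\<in>{j..}. gap s k) = s $ j"
proof (induction "card {j<..}" arbitrary: j rule: less_induct)
  case less
  have "{j..} = insert j {j<..}" by auto
  then have 1: "(\<Sum>k\<in>{j..}. gap s k) = gap s j + (\<Sum>k\<in>{j<..}. gap s k)" by simp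
  show ?case
  proof (cases "{j<..} = {}")
    case True
    then show ?thesis by (simp only: 1) (simp add: gap_def)
  next
    case False
    let ?m = "Min {j<..}"
    have m: "?m \<in> {j<..}" using False by (intro Min_in) auto
    then have "{?m<..} \<subset> {j<..}" by auto
    then have "card {?m<..} < card {j<..}" by (intro psubset_card_mono) auto
    then have "(\<Sum>k\<in>{?m..}. gap s k) = s $ ?m" by (rule less)
    moreover have "{j<..} = {?m..}" using m by auto
    moreover have "gap s j = s $ j - s $ ?m" using False by (simp add: gap_def)
    ultimately show ?thesis by (simp only: 1) simp
  qed
qed

lemma Delta_gen_eq: "Delta_gen s x = (\<Prod>k\<in>UNIV. principal_minor {..k} x powr gap s k)"
  by (simp add: Delta_gen_def gap_def)

lemma of_real_powr: "0 < c \<Longrightarrow> complex_of_real c powr z = exp (z * of_real (ln c))"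
  by (simp add: powr_def Ln_of_real)

text \<open>The k-th minor is the product of the pivots up to k, so the j-th pivot receives the
  exponents of all minors with k \<ge> j, which telescope to s_j. All bases are positive, so the
  regrouping can be done with real logarithms.\<close>

lemma Delta_gen_lower_triangular:
  assumes M: "lower_triangular pos_up M" and m: "\<And>j. M $ j $ j = of_real (m j)" "\<And>j. 0 < m j"
  shows "Delta_gen s (M ** ctranspose M) = (\<Prod>j\<in>UNIV. complex_of_real ((m j)\<^sup>2) powr (s $ j))"
proof -
  have m0: "m j \<noteq> 0" for j using m(2)[of j] by simp
  have pm: "principal_minor {..k} (M ** ctranspose M) = of_real (\<Prod>j\<le>k. (m j)\<^sup>2)" for k
    by (simp add: principal_minor_lower_triangular[OF M] m power2_eq_square)
  have pos: "0 < (\<Prod>j\<le>k. (m j)\<^sup>2)" for k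
    by (intro prod_pos) (simp add: m0)
  have "Delta_gen s (M ** ctranspose M) = (\<Prod>k\<in>UNIV. exp (gap s k * of_real (ln (\<Prod>j\<le>k. (m j)\<^sup>2))))"
    unfolding Delta_gen_eq pm by (intro prod.cong refl of_real_powr pos)
  also have "\<dots> = exp (\<Sum>k\<in>UNIV. gap s k * of_real (ln (\<Prod>j\<le>k. (m j)\<^sup>2)))"
    by (simp add: exp_sum)
  also have "(\<Sum>k\<in>UNIV. gap s k * of_real (ln (\<Prod>j\<le>k. (m j)\<^sup>2)))
      = (\<Sum>k\<in>UNIV. \<Sum>j\<in>UNIV. if j \<le> k then gap s k * of_real (ln ((m j)\<^sup>2)) else 0)"
  proof (intro sum.cong refl)
    fix k
    have "ln (\<Prod>j\<le>k. (m j)\<^sup>2) = (\<Sum>j\<le>k. ln ((m j)\<^sup>2))"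
      by (intro ln_prod) (auto simp: m0)
    then have "gap s k * of_real (ln (\<Prod>j\<le>k. (m j)\<^sup>2)) = (\<Sum>j\<le>k. gap s k * of_real (ln ((m j)\<^sup>2)))"
      by (simp add: sum_distrib_left)
    also have "\<dots> = (\<Sum>j\<in>UNIV. if j \<le> k then gap s k * of_real (ln ((m j)\<^sup>2)) else 0)"
      by (intro sum.mono_neutral_cong_left) auto
    finally show "gap s k * of_real (ln (\<Prod>j\<le>k. (m j)\<^sup>2)) = \<dots>" .
  qed
  also have "\<dots> = (\<Sum>j\<in>UNIV. \<Sum>k\<in>UNIV. if j \<le> k then gap s k * of_real (ln ((m j)\<^sup>2)) else 0)"
    by (rule sum.swap)
  also have "\<dots> = (\<Sum>j\<in>UNIV. (\<Sum>k\<in>{j..}. gap s k) * of_real (ln ((m j)\<^sup>2)))"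
  proof (intro sum.cong refl)
    fix j
    have "(\<Sum>k\<in>{j..}. gap s k) * of_real (ln ((m j)\<^sup>2)) = (\<Sum>k\<in>{j..}. gap s k * of_real (ln ((m j)\<^sup>2)))"
      by (simp add: sum_distrib_right)
    also have "\<dots> = (\<Sum>k\<in>UNIV. if j \<le> k then gap s k * of_real (ln ((m j)\<^sup>2)) else 0)"
      by (intro sum.mono_neutral_cong_left) auto
    finally show "(\<Sum>k\<in>UNIV. if j \<le> k then gap s k * of_real (ln ((m j)\<^sup>2)) else 0) = (\<Sum>k\<in>{j..}. gap s k) * of_real (ln ((m j)\<^sup>2))" ..
  qed
  also have "exp \<dots> = (\<Prod>j\<in>UNIV. complex_of_real ((m j)\<^sup>2) powr (s $ j))"
    by (simp add: sum_gap exp_sum of_real_powr m0 del: of_real_power)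
  finally show ?thesis .
qed

text \<open>A power of a positive number has as modulus the power with the real part of the
  exponent, and leading minors are positive on \<open>hpd\<close>.\<close>

lemma norm_Delta_gen:
  assumes "x \<in> hpd"
  shows "complex_of_real (norm (Delta_gen s x)) = Delta_gen (\<chi> k. of_real (Re (s $ k))) x"
proof -
  have "complex_of_real (norm (principal_minor {..k} x powr gap s k))
      = principal_minor {..k} x powr gap (\<chi> k. of_real (Re (s $ k))) k" for k
  proof -
    obtain c where c: "0 < c" "principal_minor {..k} x = of_real c"
      using principal_minor_pos[OF assms] by blast
    have "gap (\<chi> k. complex_of_real (Re (s $ k))) k = of_real (Re (gap s k))"
      by (simp add: gap_def)
    then show ?thesis
      using c by (simp add: of_real_powr exp_of_real[symmetric])
  qed
  then show ?thesis
    by (simp add: Delta_gen_eq prod_norm[symmetric])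
qed

lemma continuous_on_principal_minor [continuous_intros]:
  "continuous_on A f \<Longrightarrow> continuous_on A (\<lambda>x. principal_minor S (f x))"
  unfolding principal_minor_def by (intro continuous_intros)

lemma continuous_on_Delta_gen: "continuous_on hpd (Delta_gen s)"
  unfolding Delta_gen_eq[abs_def]
proof (rule continuous_on_prod)
  have pos: "principal_minor S x \<noteq> 0" "0 < Re (principal_minor S x)" if "x \<in> hpd" for S and x :: "'a cmat"
    using principal_minor_pos[OF that, of S] by auto
  show "continuous_on hpd (\<lambda>x. principal_minor {..k} x powr gap s k)" for k
    by (rule continuous_on_powr_complex) (use pos in \<open>auto simp: less_imp_le intro!: continuous_intros\<close>)
qed

subsection \<open>Gamma integrals\<close>

lemma measurable_vol_borel [measurable]: "(\<lambda>x. x) \<in> borel_measurable vol"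
proof -
  have "(\<lambda>x. x) \<in> borel_measurable (restrict_space borel hpd)"
    by (rule measurable_restrict_space1) simp
  then show ?thesis by (simp add: measurable_cong_sets[OF sets_vol refl])
qed

lemma borel_measurable_vol_continuous:
  assumes "continuous_on hpd f"
  shows "f \<in> borel_measurable vol"
  using borel_measurable_continuous_on_restrict[OF assms]
  by (simp add: measurable_cong_sets[OF sets_vol refl])

lemma borel_measurable_Delta_gen [measurable]: "Delta_gen s \<in> borel_measurable vol"
  by (rule borel_measurable_vol_continuous[OF continuous_on_Delta_gen])

lemma continuous_on_det_powr:
  assumes "continuous_on A f" "\<And>x. x \<in> A \<Longrightarrow> f x \<in> hpd"
  shows "continuous_on A (\<lambda>x. det (f x) powr b)"
proof (rule continuous_on_powr_complex)
  have "0 < Re (det (f x))" if "x \<in> A" for x using hpd_det_pos(2) assms that by blast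
  then show "A \<subseteq> {x. 0 \<le> Re (det (f x)) \<or> Im (det (f x)) \<noteq> 0}"
    and "\<And>x. x \<in> A \<Longrightarrow> det (f x) = 0 \<Longrightarrow> 0 < Re b"
    by (auto simp: less_imp_le) fastforce
qed (auto intro!: continuous_intros assms)

lemma borel_measurable_det_powr [measurable]: "(\<lambda>x. det x powr b) \<in> borel_measurable vol"
  by (rule borel_measurable_vol_continuous, rule continuous_on_det_powr) (auto intro: continuous_intros)

lemma borel_measurable_vol_entry [measurable]: "(\<lambda>x. x $ i $ j) \<in> borel_measurable vol"
  by (rule borel_measurable_vol_continuous) (intro continuous_intros)

lemma borel_measurable_trace_mult [measurable]:
  "(\<lambda>p. trace (fst p ** snd p)) \<in> borel_measurable (vol \<Otimes>\<^sub>M vol)"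
proof -
  have [measurable]: "(\<lambda>p. fst p $ i $ j) \<in> borel_measurable (vol \<Otimes>\<^sub>M vol)"
    "(\<lambda>p. snd p $ i $ j) \<in> borel_measurable (vol \<Otimes>\<^sub>M vol)" for i j
    by (rule measurable_compose[OF _ borel_measurable_vol_entry], simp)+
  show ?thesis unfolding trace_def matrix_matrix_mult_def vec_lambda_beta by measurable
qed

lemma measurable_act_vol: "invertible g \<Longrightarrow> act g \<in> measurable vol vol"
  using measurable_act_restrict[of g] by (simp add: measurable_cong_sets[OF sets_vol sets_vol])

lemma
  fixes F :: "_ \<Rightarrow> 'b::{banach,second_countable_topology}"
  assumes g: "invertible g" and F [measurable]: "F \<in> borel_measurable vol"
  shows integrable_vol_act: "integrable vol (\<lambda>x. F (act g x)) \<longleftrightarrow> integrable vol F"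
    and integral_vol_act: "(\<integral>x. F (act g x) \<partial>vol) = integral\<^sup>L vol F"
  using integrable_distr_eq[OF measurable_act_vol[OF g] F] integral_distr[OF measurable_act_vol[OF g] F]
  by (simp_all add: distr_vol_act[OF g])

lemma det_chol:
  assumes "inj r" "a \<in> chol_domain"
  shows "det (chol r a) = of_real (\<Prod>k\<in>UNIV. a (k, k))"
proof -
  have "sqrt (a (k, k)) * sqrt (a (k, k)) = a (k, k)" for k
    using assms(2) by (simp add: chol_domain_def less_imp_le)
  then show ?thesis
    by (simp add: chol_def det_mul det_ctranspose det_chol_factor[OF assms(1)] prod.distrib[symmetric] flip: of_real_mult)
qed

lemma powr_prod_of_real:
  assumes "\<And>k. k \<in> A \<Longrightarrow> 0 < c k" "finite A"
  shows "complex_of_real (\<Prod>k\<in>A. c k) powr z = (\<Prod>k\<in>A. complex_of_real (c k) powr z)"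
proof -
  have "complex_of_real (\<Prod>k\<in>A. c k) powr z = exp (z * of_real (ln (\<Prod>k\<in>A. c k)))"
    using assms by (intro of_real_powr prod_pos) auto
  also have "ln (\<Prod>k\<in>A. c k) = (\<Sum>k\<in>A. ln (c k))"
    using assms by (intro ln_prod) (auto simp: less_imp_neq[THEN not_sym])
  finally show ?thesis
    using assms by (simp add: of_real_powr sum_distrib_left exp_sum)
qed

lemma card_atMost_le: "card {..k} \<le> CARD('n)" for k :: "'n::{finite,linorder}"
  by (intro card_mono) auto

lemma card_atMost_pos: "0 < card {..k}" for k :: "'n::{finite,linorder}"
  by (auto simp: card_gt_0_iff)

text \<open>The substitution of z^(-1/2) y z^(-1/2) for y preserves the volume and turns tr(z y)
  into tr y, at the cost of the factor det(z)^(-b). The remaining integral has the constant exponent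
  b at all pivots. Its smallest Gamma argument is b + 1 - N, whence the bound on Re b.\<close>

lemma
  fixes z :: "'n::{finite,linorder} cmat"
  assumes z: "z \<in> hpd" and b: "real CARD('n) - 1 < Re b"
  shows integrable_Gamma_det: "integrable vol (\<lambda>y. exp (- trace (z ** y)) * det y powr b)"
    and integral_Gamma_det: "(\<integral>y. exp (- trace (z ** y)) * det y powr b \<partial>vol) = Gamma_M (\<chi> k::'n. b) * det z powr (- b)"
proof -
  let ?F = "\<lambda>y. exp (- trace (z ** y)) * det y powr b" and ?i = "inv_sqrt z"
  have i: "?i \<in> hpd" "act ?i z = mat 1" using inv_sqrt[OF z] by auto
  have gi: "invertible ?i" by (rule hpd_invertible[OF i(1)])
  have c: "ctranspose ?i = ?i" by (rule hpd_ctranspose[OF i(1)])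
  have [measurable]: "?F \<in> borel_measurable vol"
    by (intro borel_measurable_vol_continuous continuous_intros continuous_on_det_powr) (auto simp: trace_def intro!: continuous_intros)
  have F: "?F (act ?i y) = det z powr (- b) * (exp (- trace y) * det y powr b)" if y: "y \<in> hpd" for y
  proof -
    have "trace (z ** act ?i y) = trace ((z ** ?i ** y) ** ?i)"
      by (simp add: act_def c matrix_mul_assoc)
    also have "\<dots> = trace (?i ** (z ** ?i ** y))"
      by (rule trace_mul_sym)
    also have "?i ** (z ** ?i ** y) = act ?i z ** y"
      by (simp add: act_def c matrix_mul_assoc)
    also have "\<dots> = y" by (simp add: i)
    finally have tr: "trace (z ** act ?i y) = trace y" .
    obtain p where p: "0 < p" "det z = of_real p" using hpd_det_pos[OF z] hpd_det_eq[OF z] by blast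
    obtain q where q: "0 < q" "det y = of_real q" using hpd_det_pos[OF y] hpd_det_eq[OF y] by blast
    have "of_real ((cmod (det ?i))\<^sup>2) * complex_of_real p = 1"
      using det_act[of ?i z] by (simp add: i p)
    then have "(cmod (det ?i))\<^sup>2 * p = 1"
      by (simp only: of_real_mult[symmetric] of_real_eq_1_iff)
    then have d: "(cmod (det ?i))\<^sup>2 = 1 / p" using p by (simp add: field_simps)
    have "det (act ?i y) = of_real (q / p)"
      unfolding det_act d q by simp
    then have "det (act ?i y) powr b = det z powr (- b) * det y powr b"
      using p q by (simp add: of_real_powr ln_div exp_add[symmetric] algebra_simps del: of_real_divide)
    then show ?thesis by (simp add: tr)
  qed
  have e: "0 < Re (b + 1 - of_nat (card {..k}))" for k :: 'n
    using b card_atMost_le[of k] by simp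
  have eq: "det z powr (- b) * (exp (- trace (chol pos_up a)) * det (chol pos_up a) powr b)
      = det z powr (- b) * exp (- trace (chol pos_up a)) *
      (\<Prod>k\<in>UNIV. complex_of_real (a (k, k)) powr (b + 1 - of_nat (card {..k}) - 1 - of_nat (card {i::'n. pos_up k < pos_up i}) + of_nat CARD('n)))"
    if a: "a \<in> chol_domain" for a :: "'n \<times> 'n \<Rightarrow> real"
  proof -
    have "det (chol pos_up a) powr b = (\<Prod>k\<in>UNIV. complex_of_real (a (k, k)) powr b)"
      unfolding det_chol[OF inj_pos_up a] using a by (intro powr_prod_of_real) (auto simp: chol_domain_def)
    moreover have ex: "b + 1 - of_nat (card {..k}) - 1 - of_nat (card {i::'n. pos_up k < pos_up i}) + of_nat CARD('n) = b" for k :: 'n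
      using card_atMost_le[of k] by (simp add: card_pos_up_greater of_nat_diff)
    ultimately show ?thesis unfolding ex by simp
  qed
  let ?G = "\<lambda>y :: 'n cmat. det z powr (- b) * (exp (- trace y) * det y powr b)"
  have G [measurable]: "?G \<in> borel_measurable vol"
    by (intro borel_measurable_vol_continuous continuous_intros continuous_on_det_powr) (auto simp: trace_def intro!: continuous_intros)
  have "integrable vol ?G"
    by (rule integrable_vol_powers[where F = ?G and C = "det z powr (- b)" and e = "\<lambda>k::'n. b + 1 - of_nat (card {..k})",
        OF inj_pos_up e G eq])
  moreover have "integrable vol (\<lambda>y. ?F (act ?i y)) \<longleftrightarrow> integrable vol ?G"
    by (intro Bochner_Integration.integrable_cong refl F) simp
  ultimately show "integrable vol ?F"
    using integrable_vol_act[OF gi, of ?F] by simp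
  have "integral\<^sup>L vol ?F = (\<integral>y. ?F (act ?i y) \<partial>vol)"
    by (rule integral_vol_act[OF gi, symmetric]) measurable
  also have "\<dots> = integral\<^sup>L vol ?G"
    by (intro Bochner_Integration.integral_cong refl F) simp
  also have "\<dots> = det z powr (- b) * of_real (2 * pi) ^ (CARD('n) * (CARD('n) - 1) div 2) * (\<Prod>k::'n\<in>UNIV. Gamma (b + 1 - of_nat (card {..k})))"
    by (rule integral_vol_powers[where F = ?G and C = "det z powr (- b)" and e = "\<lambda>k::'n. b + 1 - of_nat (card {..k})",
        OF inj_pos_up e G eq])
  also have "\<dots> = Gamma_M (\<chi> k::'n. b) * det z powr (- b)"
    by (simp add: Gamma_M_def add_diff_eq diff_add_eq)
  finally show "integral\<^sup>L vol ?F = Gamma_M (\<chi> k::'n. b) * det z powr (- b)" .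
qed

lemma lower_triangular_mult:
  fixes A B :: "complex^'n^'n"
  assumes r: "inj r" and A: "lower_triangular r A" and B: "lower_triangular r B"
  shows "lower_triangular r (A ** B)" "(A ** B) $ i $ i = A $ i $ i * B $ i $ i"
proof -
  have z: "A $ i $ l * B $ l $ j = 0" if "r i < r l \<or> r l < r j" for i j l
    using that A B by (auto simp: lower_triangular_def)
  have "(A ** B) $ i $ j = 0" if "r i < r j" for i j
    unfolding matrix_matrix_mult_def vec_lambda_beta
    by (rule sum.neutral) (use z[of i _ j] that in \<open>metis linorder_neqE_nat less_trans\<close>)
  then show "lower_triangular r (A ** B)" by (simp add: lower_triangular_def)
  have "(A ** B) $ i $ i = (\<Sum>l\<in>{i}. A $ i $ l * B $ l $ i)"
    unfolding matrix_matrix_mult_def vec_lambda_beta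
  proof (rule sum.mono_neutral_right; (intro ballI)?)
    fix l assume "l \<in> UNIV - {i}"
    then have "r l \<noteq> r i" using r by (auto simp: inj_eq)
    then show "A $ i $ l * B $ l $ i = 0" using z[of i l i] by (metis linorder_neqE_nat)
  qed auto
  then show "(A ** B) $ i $ i = A $ i $ i * B $ i $ i" by simp
qed

text \<open>Forward substitution: in the row of least rank not yet treated, all terms but the
  diagonal one vanish by induction or by triangularity.\<close>

lemma lower_triangular_inverse:
  fixes A B :: "complex^'n^'n"
  assumes r: "inj r" and A: "lower_triangular r A" "\<And>i. A $ i $ i \<noteq> 0" and AB: "A ** B = mat 1"
  shows "lower_triangular r B" "B $ i $ i = 1 / A $ i $ i"
proof -
  have "B $ i $ j = 0" if "r i < r j" for i j
    using that
  proof (induction "r i" arbitrary: i rule: less_induct)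
    case less
    have "(A ** B) $ i $ j = (\<Sum>l\<in>{i}. A $ i $ l * B $ l $ j)"
      unfolding matrix_matrix_mult_def vec_lambda_beta
    proof (rule sum.mono_neutral_right; (intro ballI)?)
      fix l assume "l \<in> UNIV - {i}"
      then have "r l < r i \<or> r i < r l" using r by (auto simp: inj_eq linorder_neq_iff[symmetric])
      then show "A $ i $ l * B $ l $ j = 0"
        using less A(1) by (auto simp: lower_triangular_def)
    qed auto
    moreover have "(A ** B) $ i $ j = 0" using less.prems by (auto simp: AB mat_def)
    ultimately show ?case using A(2)[of i] by simp
  qed
  then show B: "lower_triangular r B" by (simp add: lower_triangular_def)
  have "A $ i $ i * B $ i $ i = 1"
    using lower_triangular_mult(2)[OF r A(1) B, of i] by (simp add: AB mat_def)
  then show "B $ i $ i = 1 / A $ i $ i" using A(2)[of i] by (simp add: field_simps)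
qed

text \<open>A square root of y cannot be used as in \<open>integral_Gamma_det\<close>: it would turn
  tr(x y) into a trace, but \<open>Delta_gen\<close> is multiplied by a constant only under lower
  triangular congruences. Hence y must be U^H U with U lower triangular in the usual order, which is
  the elimination from the last row. The congruence by the inverse of U divides the j-th pivot of x
  by that of y.\<close>

lemma
  fixes b :: "'n::{finite,linorder} \<times> 'n \<Rightarrow> real" and s :: "(complex, 'n) vec"
  assumes b: "b \<in> chol_domain" and s: "\<And>k. real (card {..k}) - 1 < Re (s $ k)"
  shows integrable_Gamma_chol: "integrable vol (\<lambda>x. exp (- trace (x ** chol pos_down b)) * Delta_gen s x)"
    and integral_Gamma_chol: "(\<integral>x. exp (- trace (x ** chol pos_down b)) * Delta_gen s x \<partial>vol) =
      Gamma_M s * (\<Prod>k\<in>UNIV. complex_of_real (b (k, k)) powr (- s $ k))"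
proof -
  let ?L = "chol_factor pos_down b"
  let ?U = "ctranspose ?L"
  let ?G = "matrix_inv ?U"
  let ?y = "chol pos_down b"
  let ?F = "\<lambda>x. exp (- trace (x ** ?y)) * Delta_gen s x"
  have pos: "0 < b (k, k)" for k using b by (simp add: chol_domain_def)
  have U: "lower_triangular pos_up ?U"
    using lower_triangular_chol_factor[of pos_down b]
    by (auto simp: lower_triangular_def pos_up_less_iff pos_down_less_iff)
  have Ud: "?U $ i $ i = of_real (sqrt (b (i, i)))" for i
    by (simp add: chol_factor_diag)
  have Unz: "?U $ i $ i \<noteq> 0" for i
    using pos[of i] by (simp only: Ud) simp
  have "invertible ?L"
    using invertible_chol_factor[OF inj_pos_down, of b] pos by blast
  then have "invertible ?U" by (simp add: invertible_det_nz det_ctranspose)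
  note UG = matrix_inv_mult[OF this]
  have gG: "invertible ?G" using UG by (auto simp: invertible_def)
  have G: "lower_triangular pos_up ?G"
    and Gd: "?G $ i $ i = of_real (1 / sqrt (b (i, i)))" for i
    using lower_triangular_inverse[OF inj_pos_up U Unz UG(1)] Ud by simp_all
  have GL: "ctranspose ?G ** ?L = mat 1"
    using arg_cong[OF UG(1), of ctranspose] by (simp add: ctranspose_mult)
  have tr: "trace (act ?G x ** ?y) = trace x" for x
  proof -
    have "act ?G x ** ?y = ?G ** x ** (ctranspose ?G ** ?L) ** ?U"
      by (simp add: act_def chol_def matrix_mul_assoc)
    then have "trace (act ?G x ** ?y) = trace (?G ** x ** ?U)"
      by (simp add: GL)
    also have "\<dots> = trace (?U ** (?G ** x))" by (rule trace_mul_sym)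
    finally show ?thesis by (simp add: matrix_mul_assoc UG)
  qed
  have F [measurable]: "?F \<in> borel_measurable vol"
    by (intro borel_measurable_vol_continuous continuous_intros continuous_on_Delta_gen) (auto simp: trace_def intro!: continuous_intros)
  have Fa [measurable]: "(\<lambda>x. ?F (act ?G x)) \<in> borel_measurable vol"
    using measurable_compose[OF measurable_act_vol[OF gG] F] .
  let ?C = "\<Prod>k\<in>UNIV. complex_of_real (b (k, k)) powr (- s $ k)"
  have e: "0 < Re (s $ k + 1 - of_nat (card {..k}))" for k
    using s[of k] by simp
  have eq: "?F (act ?G (chol pos_up a)) = ?C * exp (- trace (chol pos_up a)) *
      (\<Prod>k\<in>UNIV. complex_of_real (a (k, k)) powr (s $ k + 1 - of_nat (card {..k}) - 1 - of_nat (card {i::'n. pos_up k < pos_up i}) + of_nat CARD('n)))"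
    if a: "a \<in> chol_domain" for a
  proof -
    have apos: "0 < a (k, k)" for k using a by (simp add: chol_domain_def)
    let ?M = "?G ** chol_factor pos_up a"
    note M = lower_triangular_mult[OF inj_pos_up G lower_triangular_chol_factor[of pos_up a]]
    have "act ?G (chol pos_up a) = ?M ** ctranspose ?M"
      by (simp add: act_def chol_def ctranspose_mult matrix_mul_assoc)
    then have "Delta_gen s (act ?G (chol pos_up a)) = Delta_gen s (?M ** ctranspose ?M)" by simp
    also have "\<dots> = (\<Prod>j\<in>UNIV. complex_of_real ((sqrt (a (j, j)) / sqrt (b (j, j)))\<^sup>2) powr (s $ j))"
      using apos pos by (intro Delta_gen_lower_triangular M) (simp_all add: M(2) Gd chol_factor_diag)
    also have "\<dots> = (\<Prod>j\<in>UNIV. complex_of_real (b (j, j)) powr (- s $ j) * complex_of_real (a (j, j)) powr (s $ j))"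
    proof (intro prod.cong refl)
      fix j
      have "(sqrt (a (j, j)) / sqrt (b (j, j)))\<^sup>2 = a (j, j) / b (j, j)"
        using apos[of j] pos[of j] by (simp add: power_divide less_imp_le)
      then show "complex_of_real ((sqrt (a (j, j)) / sqrt (b (j, j)))\<^sup>2) powr (s $ j)
        = complex_of_real (b (j, j)) powr (- s $ j) * complex_of_real (a (j, j)) powr (s $ j)"
        using apos[of j] pos[of j] by (simp add: of_real_powr ln_div exp_add[symmetric] algebra_simps del: of_real_divide)
    qed
    finally have D: "Delta_gen s (act ?G (chol pos_up a)) = ?C * (\<Prod>j\<in>UNIV. complex_of_real (a (j, j)) powr (s $ j))"
      by (simp add: prod.distrib)
    have ex: "s $ k + 1 - of_nat (card {..k}) - 1 - of_nat (card {i::'n. pos_up k < pos_up i}) + of_nat CARD('n) = s $ k" for k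
      using card_atMost_le[of k] by (simp add: card_pos_up_greater of_nat_diff)
    show ?thesis unfolding ex D tr by (simp only: mult_ac)
  qed
  show "integrable vol ?F"
    using integrable_vol_powers[OF inj_pos_up e Fa eq] integrable_vol_act[OF gG F] by simp
  have "integral\<^sup>L vol ?F = (\<integral>x. ?F (act ?G x) \<partial>vol)"
    by (rule integral_vol_act[OF gG F, symmetric])
  also have "\<dots> = ?C * of_real (2 * pi) ^ (CARD('n) * (CARD('n) - 1) div 2) * (\<Prod>k\<in>UNIV. Gamma (s $ k + 1 - of_nat (card {..k})))"
    by (rule integral_vol_powers[OF inj_pos_up e Fa eq])
  also have "\<dots> = Gamma_M s * ?C"
    by (simp add: Gamma_M_def add_diff_eq diff_add_eq)
  finally show "integral\<^sup>L vol ?F = Gamma_M s * ?C" .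
qed

text \<open>A Gamma integrand is integrable and has no zeros on \<open>hpd\<close>. By Markov's
  inequality the sets where its modulus is at least 1/n have finite volume, and they exhaust the
  space.\<close>

lemma sigma_finite_vol: "sigma_finite_measure (vol :: 'n::{finite,linorder} cmat measure)"
proof
  let ?vol = "vol :: 'n::{finite,linorder} cmat measure"
  let ?f = "\<lambda>y. exp (- trace (mat 1 ** y)) * det y powr of_nat CARD('n) :: complex"
  have int: "integrable ?vol ?f"
    by (rule integrable_Gamma_det) auto
  then have [measurable]: "?f \<in> borel_measurable ?vol" by simp
  define A where "A = (\<lambda>n::nat. {x \<in> space ?vol. 1 \<le> ennreal (real n) * ennreal (norm (?f x))})"
  have nz: "?f x \<noteq> 0" if "x \<in> space ?vol" for x
    using hpd_invertible[of x] that by (simp add: invertible_det_nz)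
  have "\<exists>n. x \<in> A n" if "x \<in> space ?vol" for x
  proof -
    obtain n :: nat where "1 / norm (?f x) \<le> real n" using real_arch_simple by blast
    then have "1 \<le> real n * norm (?f x)" using nz[OF that] by (simp add: field_simps)
    then have "1 \<le> ennreal (real n * norm (?f x))" by (metis ennreal_1 ennreal_leI)
    then show ?thesis using that unfolding A_def by (auto simp: ennreal_mult)
  qed
  then have "\<Union> (range A) = space ?vol" by (auto simp: A_def)
  moreover have "emeasure ?vol (A n) \<noteq> \<infinity>" for n
  proof -
    have "emeasure ?vol (A n) \<le> ennreal (real n) * (\<integral>\<^sup>+x. ennreal (norm (?f x)) * indicator (space ?vol) x \<partial>?vol)"
      unfolding A_def by (rule nn_integral_Markov_inequality) measurable
    also have "\<dots> = ennreal (real n) * (\<integral>\<^sup>+x. ennreal (norm (?f x)) \<partial>?vol)"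
      by (intro arg_cong2[of _ _ _ _ "(*)"] refl nn_integral_cong) simp
    also have "\<dots> < \<infinity>"
      using int unfolding integrable_iff_bounded by (simp add: ennreal_mult_less_top)
    finally show ?thesis by simp
  qed
  moreover have "A n \<in> sets ?vol" for n
    unfolding A_def by measurable
  ultimately show "\<exists>A. countable A \<and> A \<subseteq> sets ?vol \<and> \<Union> A = space ?vol \<and> (\<forall>a\<in>A. emeasure ?vol a \<noteq> \<infinity>)"
    by (intro exI[of _ "range A"]) auto
qed

subsection \<open>The Beta integral\<close>

lemma trace_ctranspose: "trace (ctranspose A) = cnj (trace A)"
  by (simp add: trace_def cnj_sum)

lemma trace_hermitian_mult_real:
  assumes "ctranspose x = x" "ctranspose y = y"
  shows "trace (x ** y) = of_real (Re (trace (x ** y)))"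
proof -
  have "cnj (trace (x ** y)) = trace (ctranspose (x ** y))"
    by (simp add: trace_ctranspose)
  also have "\<dots> = trace (x ** y)"
    using assms trace_mul_sym[of y x] by (simp add: ctranspose_mult)
  finally show ?thesis by (simp add: complex_eq_iff)
qed

lemma norm_exp_trace:
  assumes "ctranspose x = x" "ctranspose y = y"
  shows "complex_of_real (norm (exp (- trace (x ** y)))) = exp (- trace (x ** y))"
  by (subst (1 2) trace_hermitian_mult_real[OF assms])
    (simp only: of_real_minus[symmetric] exp_of_real norm_of_real abs_exp_cancel)

lemma norm_det_powr:
  assumes "x \<in> hpd"
  shows "complex_of_real (norm (det x powr b)) = det x powr of_real (Re b)"
proof -
  obtain p where "0 < p" "det x = of_real p"
    using hpd_det_pos[OF assms] hpd_det_eq[OF assms] by blast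
  then show ?thesis by (simp add: of_real_powr exp_of_real[symmetric])
qed

text \<open>The integrand on pairs for which one order of integration gives the Beta integrand and
  the other gives Gamma products.\<close>

definition beta_kernel :: "complex \<Rightarrow> (complex,'n::{finite,linorder}) vec \<Rightarrow>
    'n cmat \<Rightarrow> 'n cmat \<Rightarrow> complex" where
  "beta_kernel b s y x = exp (- trace y) * det y powr b * (exp (- trace (x ** y)) * Delta_gen s x)"

lemma measurable_beta_kernel [measurable]:
  "(\<lambda>p. beta_kernel b s (fst p) (snd p)) \<in> borel_measurable (vol \<Otimes>\<^sub>M vol)"
proof -
  have [measurable]: "(\<lambda>y :: 'n::{finite,linorder} cmat. exp (- trace y)) \<in> borel_measurable vol"
    by (rule borel_measurable_vol_continuous) (auto simp: trace_def intro!: continuous_intros)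
  have [measurable]: "(\<lambda>p. exp (- trace (fst p))) \<in> borel_measurable (vol \<Otimes>\<^sub>M vol)"
    "(\<lambda>p. det (fst p) powr b) \<in> borel_measurable (vol \<Otimes>\<^sub>M vol)"
    "(\<lambda>p. Delta_gen s (snd p)) \<in> borel_measurable (vol \<Otimes>\<^sub>M vol)"
    by measurable
  have [measurable]: "(\<lambda>p. trace (snd p ** fst p)) \<in> borel_measurable (vol \<Otimes>\<^sub>M vol)"
    using borel_measurable_trace_mult by (subst trace_mul_sym)
  show ?thesis unfolding beta_kernel_def by measurable
qed

text \<open>The modulus is again such an integrand, with real parameters. So absolute integrability
  on pairs follows from the iterated integral for the real parts, which satisfy the same
  inequalities.\<close>

lemma norm_beta_kernel:
  assumes "x \<in> hpd" "y \<in> hpd"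
  shows "complex_of_real (norm (beta_kernel b s y x))
    = beta_kernel (of_real (Re b)) (\<chi> k. of_real (Re (s $ k))) y x"
  using norm_exp_trace[of "mat 1" y] norm_exp_trace[of x y] norm_det_powr[OF assms(2), of b] norm_Delta_gen[OF assms(1), of s]
    hpd_ctranspose[OF assms(1)] hpd_ctranspose[OF assms(2)]
  unfolding beta_kernel_def by (simp only: norm_mult of_real_mult matrix_mul_lid ctranspose_mat_1)

context
  fixes b :: complex and s :: "(complex,'n::{finite,linorder}) vec"
  assumes s1: "\<And>k. real (card {..k}) - 1 < Re (s $ k)"
    and s2: "\<And>k. Re (s $ k) < Re b + real (card {..k}) - real CARD('n)"
begin

interpretation vol: sigma_finite_measure "vol :: 'n cmat measure"
  by (rule sigma_finite_vol)

text \<open>Integrating over x converges by the first condition on s and leaves powers of the pivots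
  of y, taken from the last row. Multiplied by e^(-tr y) det(y)^b, this is again an integral of
  pivot powers, now in the order \<open>pos_down\<close>, and the second condition makes its Gamma
  arguments positive.\<close>

lemma
  shows integrable_beta_kernel_iterated: "integrable vol (\<lambda>y. \<integral>x. beta_kernel b s y x \<partial>vol)"
    and integral_beta_kernel_iterated: "(\<integral>y. (\<integral>x. beta_kernel b s y x \<partial>vol) \<partial>vol) =
      Gamma_M s * of_real (2 * pi) ^ (CARD('n) * (CARD('n) - 1) div 2) *
      (\<Prod>k\<in>UNIV. Gamma (b - s $ k + of_nat (card {..k}) - of_nat CARD('n)))"
proof -
  let ?F = "\<lambda>y. \<integral>x. beta_kernel b s y x \<partial>vol"
  have "case_prod (beta_kernel b s) \<in> borel_measurable (vol \<Otimes>\<^sub>M vol)"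
    using measurable_beta_kernel[of b s] by (simp add: case_prod_unfold)
  then have F: "?F \<in> borel_measurable vol"
    by (rule vol.borel_measurable_lebesgue_integral)
  have e: "0 < Re (b - s $ k + of_nat (card {..k}) - of_nat CARD('n))" for k
    using s2[of k] by simp
  have eq: "?F (chol pos_down a) = Gamma_M s * exp (- trace (chol pos_down a)) *
    (\<Prod>k\<in>UNIV. complex_of_real (a (k, k)) powr (b - s $ k + of_nat (card {..k}) - of_nat CARD('n)
       - 1 - of_nat (card {i::'n. pos_down k < pos_down i}) + of_nat CARD('n)))"
    if a: "a \<in> chol_domain" for a :: "'n \<times> 'n \<Rightarrow> real"
  proof -
    have ex: "b - s $ k + of_nat (card {..k}) - of_nat CARD('n)
       - 1 - of_nat (card {i::'n. pos_down k < pos_down i}) + of_nat CARD('n) = b - s $ k" for k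
      using card_atMost_pos[of k] by (simp add: card_pos_down_greater of_nat_diff)
    have pos: "0 < a (k, k)" for k using a by (simp add: chol_domain_def)
    have "?F (chol pos_down a) = exp (- trace (chol pos_down a)) * det (chol pos_down a) powr b *
       (Gamma_M s * (\<Prod>k\<in>UNIV. complex_of_real (a (k, k)) powr (- s $ k)))"
      unfolding beta_kernel_def integral_Gamma_chol[OF a s1, symmetric] by (rule integral_mult_right_zero)
    also have "det (chol pos_down a) powr b = (\<Prod>k\<in>UNIV. complex_of_real (a (k, k)) powr b)"
      unfolding det_chol[OF inj_pos_down a] using pos by (intro powr_prod_of_real) auto
    also have "exp (- trace (chol pos_down a)) * (\<Prod>k\<in>UNIV. complex_of_real (a (k, k)) powr b) *
       (Gamma_M s * (\<Prod>k\<in>UNIV. complex_of_real (a (k, k)) powr (- s $ k))) =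
       Gamma_M s * exp (- trace (chol pos_down a)) * (\<Prod>k\<in>UNIV. complex_of_real (a (k, k)) powr b * complex_of_real (a (k, k)) powr (- s $ k))"
      by (simp only: prod.distrib mult_ac)
    also have "(\<Prod>k\<in>UNIV. complex_of_real (a (k, k)) powr b * complex_of_real (a (k, k)) powr (- s $ k))
       = (\<Prod>k\<in>UNIV. complex_of_real (a (k, k)) powr (b - s $ k))"
      by (simp flip: powr_add)
    finally show ?thesis unfolding ex .
  qed
  show "integrable vol ?F"
    by (rule integrable_vol_powers[where e = "\<lambda>k. b - s $ k + of_nat (card {..k}) - of_nat CARD('n)" and C = "Gamma_M s",
          OF inj_pos_down e F eq])
  show "integral\<^sup>L vol ?F = Gamma_M s * of_real (2 * pi) ^ (CARD('n) * (CARD('n) - 1) div 2) *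
      (\<Prod>k\<in>UNIV. Gamma (b - s $ k + of_nat (card {..k}) - of_nat CARD('n)))"
    by (rule integral_vol_powers[where e = "\<lambda>k. b - s $ k + of_nat (card {..k}) - of_nat CARD('n)" and C = "Gamma_M s",
          OF inj_pos_down e F eq])
qed

text \<open>The integral over x is known for y in Cholesky form. Such y carry the whole volume,
  since \<open>vol\<close> is the image of a measure on the coordinates.\<close>

lemma AE_integrable_beta_kernel: "AE y in vol. integrable vol (\<lambda>x. beta_kernel b s y x)"
proof -
  have "case_prod (beta_kernel b s) \<in> borel_measurable (vol \<Otimes>\<^sub>M vol)"
    using measurable_beta_kernel[of b s] by (simp add: case_prod_unfold)
  then have [measurable]: "Measurable.pred vol (\<lambda>y. integrable vol (\<lambda>x. beta_kernel b s y x))"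
    by (rule vol.borel_measurable_lebesgue_integrable)
  note [measurable] = measurable_chol_ext[OF inj_pos_down]
  have *: "integrable vol (\<lambda>x. beta_kernel b s (chol_ext pos_down a) x)" if "0 < ennreal (chol_weight pos_down a)" for a :: "'n \<times> 'n \<Rightarrow> real"
  proof -
    have a: "a \<in> chol_domain" using that by (cases "a \<in> chol_domain") (auto simp: chol_weight_def)
    then show ?thesis
      unfolding beta_kernel_def chol_ext_def using integrable_Gamma_chol[OF a s1] by simp
  qed
  have "AE y in distr (density lborel_PiM (\<lambda>a. ennreal (chol_weight pos_down a))) vol (chol_ext pos_down).
      integrable vol (\<lambda>x. beta_kernel b s y x)"
  proof (subst AE_distr_iff)
    show "{y \<in> space vol. integrable vol (\<lambda>x. beta_kernel b s y x)} \<in> sets vol"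
      by measurable
  qed (auto simp: AE_density *)
  then show ?thesis
    by (simp only: vol_eq_distr_chol[OF inj_pos_down, symmetric])
qed

end

lemma
  fixes s :: "(complex,'n::{finite,linorder}) vec"
  assumes b: "real CARD('n) - 1 < Re b"
    and s1: "\<And>k. real (card {..k}) - 1 < Re (s $ k)"
    and s2: "\<And>k. Re (s $ k) < Re b + real (card {..k}) - real CARD('n)"
  shows integrable_Beta: "integrable vol (\<lambda>x. Delta_gen s x * (Gamma_M (\<chi> k::'n. b) * det (mat 1 + x) powr (- b)))"
    and integral_Beta: "(\<integral>x. Delta_gen s x * (Gamma_M (\<chi> k::'n. b) * det (mat 1 + x) powr (- b)) \<partial>vol) =
      Gamma_M s * of_real (2 * pi) ^ (CARD('n) * (CARD('n) - 1) div 2) *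
      (\<Prod>k\<in>UNIV. Gamma (b - s $ k + of_nat (card {..k}) - of_nat CARD('n)))"
proof -
  interpret sigma_finite_measure "vol :: 'n cmat measure"
    by (rule sigma_finite_vol)
  interpret pair_sigma_finite "vol :: 'n cmat measure" "vol :: 'n cmat measure" ..
  have m: "case_prod (beta_kernel b s) \<in> borel_measurable (vol \<Otimes>\<^sub>M vol)"
    using measurable_beta_kernel[of b s] by (simp add: case_prod_unfold)
  have int: "integrable (vol \<Otimes>\<^sub>M vol) (case_prod (beta_kernel b s))"
  proof (rule Fubini_integrable[OF m])
    let ?s = "\<chi> k. complex_of_real (Re (s $ k))"
    have "integrable vol (\<lambda>y. \<integral>x. beta_kernel (of_real (Re b)) ?s y x \<partial>vol)"
      by (rule integrable_beta_kernel_iterated) (use s1 s2 in simp_all)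
    also have "?this \<longleftrightarrow> integrable vol (\<lambda>y. \<integral>x. complex_of_real (norm (beta_kernel b s y x)) \<partial>vol)"
      by (intro Bochner_Integration.integrable_cong Bochner_Integration.integral_cong refl)
        (simp add: norm_beta_kernel)
    finally show "integrable vol (\<lambda>y. \<integral>x. norm (case_prod (beta_kernel b s) (y, x)) \<partial>vol)"
      by (simp add: complex_of_real_integrable_eq)
    show "AE y in vol. integrable vol (\<lambda>x. case_prod (beta_kernel b s) (y, x))"
      using AE_integrable_beta_kernel[OF s1 s2] by simp
  qed
  have inner: "(\<integral>y. beta_kernel b s y x \<partial>vol) = Delta_gen s x * (Gamma_M (\<chi> k::'n. b) * det (mat 1 + x) powr (- b))"
    if x: "x \<in> hpd" for x
  proof -
    have "beta_kernel b s y x = Delta_gen s x * (exp (- trace ((mat 1 + x) ** y)) * det y powr b)" for y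
      by (simp add: beta_kernel_def matrix_add_rdistrib trace_add exp_add[symmetric] mult_ac)
    then show ?thesis
      using integral_Gamma_det[OF hpd_add[OF mat_1_hpd x] b] by simp
  qed
  have "integrable vol (\<lambda>x. \<integral>y. beta_kernel b s y x \<partial>vol)"
    using integrable_snd[OF int] .
  then show "integrable vol (\<lambda>x. Delta_gen s x * (Gamma_M (\<chi> k::'n. b) * det (mat 1 + x) powr (- b)))"
    by (rule Bochner_Integration.integrable_cong[THEN iffD1, rotated 2]) (simp_all add: inner)
  have "(\<integral>x. Delta_gen s x * (Gamma_M (\<chi> k::'n. b) * det (mat 1 + x) powr (- b)) \<partial>vol)
     = (\<integral>x. (\<integral>y. beta_kernel b s y x \<partial>vol) \<partial>vol)"
    by (intro Bochner_Integration.integral_cong) (simp_all add: inner)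
  also have "\<dots> = (\<integral>y. (\<integral>x. beta_kernel b s y x \<partial>vol) \<partial>vol)"
    by (rule Fubini_integral[OF int])
  also have "\<dots> = Gamma_M s * of_real (2 * pi) ^ (CARD('n) * (CARD('n) - 1) div 2) *
      (\<Prod>k\<in>UNIV. Gamma (b - s $ k + of_nat (card {..k}) - of_nat CARD('n)))"
    by (rule integral_beta_kernel_iterated[OF s1 s2])
  finally show "(\<integral>x. Delta_gen s x * (Gamma_M (\<chi> k::'n. b) * det (mat 1 + x) powr (- b)) \<partial>vol) = \<dots>" .
qed

subsection \<open>Haar measure on the unitary group\<close>

text \<open>Identifies complex matrices with a real coordinate space, where Lebesgue measure and its
  linear changes of variables are available; the boolean marks the real part.\<close>

definition complex_matrix :: "real^(('n \<times> 'n) \<times> bool) \<Rightarrow> complex^'n^'n" where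
  "complex_matrix a = (\<chi> i j. Complex (a $ ((i, j), True)) (a $ ((i, j), False)))"

definition real_coords :: "complex^'n^'n \<Rightarrow> real^(('n \<times> 'n) \<times> bool)" where
  "real_coords x = (\<chi> p. if snd p then Re (x $ fst (fst p) $ snd (fst p)) else Im (x $ fst (fst p) $ snd (fst p)))"

lemma complex_matrix_real_coords [simp]: "complex_matrix (real_coords x) = x"
  by (simp add: complex_matrix_def real_coords_def vec_eq_iff)

lemma real_coords_complex_matrix [simp]: "real_coords (complex_matrix a) = a"
proof -
  have "real_coords (complex_matrix a) $ p = a $ p" for p
    by (cases p, cases "fst p", cases "snd p") (auto simp: complex_matrix_def real_coords_def)
  then show ?thesis by (simp add: vec_eq_iff)
qed

lemma linear_complex_matrix: "linear complex_matrix"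
  by (rule linearI) (auto simp: complex_matrix_def vec_eq_iff complex_eq_iff)

lemma linear_real_coords: "linear real_coords"
  by (rule linearI) (auto simp: real_coords_def vec_eq_iff)

lemma norm_complex_matrix: "norm (complex_matrix a) = norm a"
proof -
  have "complex_matrix a \<bullet> complex_matrix a = (\<Sum>i\<in>UNIV. \<Sum>j\<in>UNIV. (a $ ((i, j), True))\<^sup>2 + (a $ ((i, j), False))\<^sup>2)"
    by (simp add: inner_vec_def inner_complex_def complex_matrix_def power2_eq_square)
  also have "\<dots> = (\<Sum>i\<in>UNIV. \<Sum>j\<in>UNIV. \<Sum>c\<in>UNIV. (a $ ((i, j), c))\<^sup>2)"
    by (simp add: UNIV_bool add.commute)
  also have "\<dots> = (\<Sum>z\<in>UNIV \<times> UNIV. \<Sum>c\<in>UNIV. (a $ (z, c))\<^sup>2)"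
    by (subst sum.cartesian_product) (simp add: case_prod_unfold)
  also have "\<dots> = (\<Sum>p\<in>(UNIV \<times> UNIV) \<times> UNIV. (a $ p)\<^sup>2)"
    by (subst sum.cartesian_product) (simp add: case_prod_unfold)
  also have "\<dots> = a \<bullet> a"
    by (simp add: inner_vec_def power2_eq_square)
  finally show ?thesis by (simp add: norm_eq_sqrt_inner)
qed

section \<open>The unitary group and the polar decomposition\<close>

lemma unitary_groupD:
  assumes "u \<in> unitary_group"
  shows "ctranspose u ** u = mat 1" "u ** ctranspose u = mat 1" "invertible u"
  using assms by (auto simp: unitary_group_def invertible_def)

lemma unitary_group_ctranspose: "u \<in> unitary_group \<Longrightarrow> ctranspose u \<in> unitary_group"
  by (simp add: unitary_group_def)

lemma unitary_group_mult: "u \<in> unitary_group \<Longrightarrow> v \<in> unitary_group \<Longrightarrow> u ** v \<in> unitary_group"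
  unfolding unitary_group_def mem_Collect_eq ctranspose_mult
  by (metis (no_types, opaque_lifting) matrix_mul_assoc matrix_mul_rid)

lemma mat_1_unitary [simp]: "mat 1 \<in> unitary_group"
  by (simp add: unitary_group_def)

lemma unitary_groupI: "ctranspose u ** u = mat 1 \<Longrightarrow> u \<in> unitary_group"
  using matrix_left_right_inverse[of "ctranspose u" u] by (simp add: unitary_group_def)

lemma norm_unitary_mult:
  fixes x :: "complex^'n^'n"
  assumes "u \<in> unitary_group"
  shows "norm (u ** x) = norm x"
proof -
  have "ctranspose (u ** x) ** (u ** x) = ctranspose x ** (ctranspose u ** u) ** x"
    by (simp add: ctranspose_mult matrix_mul_assoc)
  then show ?thesis
    using unitary_groupD[OF assms] by (simp add: norm_eq_sqrt_inner inner_matrix_eq_trace)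
qed

(* The unitary factor of the polar decomposition commutes with left multiplication by unitary matrices,
   so it maps the Lebesgue measure on a ball to an invariant measure. *)
definition unitary_part :: "complex^'n^'n \<Rightarrow> complex^'n^'n" where
  "unitary_part x = (if invertible x then x ** inv_sqrt (ctranspose x ** x) else mat 1)"

lemma ctranspose_mult_self_hpd: "invertible x \<Longrightarrow> ctranspose x ** x \<in> hpd" for x :: "complex^'n^'n"
  using act_hpd[OF mat_1_hpd, of "ctranspose x"] by (simp add: act_def invertible_det_nz det_ctranspose)

lemma unitary_part_unitary: "unitary_part x \<in> unitary_group"
proof (cases "invertible x")
  case True
  let ?h = "ctranspose x ** x" and ?p = "x ** inv_sqrt (ctranspose x ** x)"
  note i = inv_sqrt[OF ctranspose_mult_self_hpd[OF True]]
  have "ctranspose ?p ** ?p = inv_sqrt ?h ** ?h ** ctranspose (inv_sqrt ?h)"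
    by (simp add: ctranspose_mult hpd_ctranspose[OF i(1)] matrix_mul_assoc)
  then have "ctranspose ?p ** ?p = mat 1"
    using i(2) by (simp add: act_def)
  then show ?thesis using True by (simp add: unitary_part_def unitary_groupI)
qed (simp add: unitary_part_def)

lemma invertible_mult_iff: "invertible u \<Longrightarrow> invertible (u ** x) \<longleftrightarrow> invertible x" for u x :: "complex^'n^'n"
  by (simp add: invertible_det_nz det_mul)

lemma unitary_part_mult:
  assumes u: "u \<in> unitary_group" and x: "invertible x"
  shows "unitary_part (u ** x) = u ** unitary_part x"
proof -
  have "ctranspose (u ** x) ** (u ** x) = ctranspose x ** (ctranspose u ** u) ** x"
    by (simp add: ctranspose_mult matrix_mul_assoc)
  then have "ctranspose (u ** x) ** (u ** x) = ctranspose x ** x"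
    using unitary_groupD[OF u] by simp
  then show ?thesis
    using x unitary_groupD(3)[OF u] by (simp add: unitary_part_def invertible_mult_iff matrix_mul_assoc)
qed

lemma open_invertible: "open {x :: complex^'n^'n. invertible x}"
  unfolding invertible_det_nz by (intro open_Collect_neq continuous_intros)

lemma borel_measurable_unitary_part [measurable]: "unitary_part \<in> borel_measurable borel"
proof -
  have c: "continuous_on {x :: complex^'n^'n. invertible x} (\<lambda>x. x ** inv_sqrt (ctranspose x ** x))"
  proof (intro continuous_intros)
    have "continuous_on hpd (inv_sqrt :: complex^'n^'n \<Rightarrow> _)"
      unfolding inv_sqrt_def by (intro continuous_intros continuous_on_hpd_sqrt hpd_invertible hpd_sqrt)
    then show "continuous_on {x :: complex^'n^'n. invertible x} (\<lambda>x. inv_sqrt (ctranspose x ** x))"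
      by (rule continuous_on_compose2) (auto intro!: continuous_intros ctranspose_mult_self_hpd)
  qed
  have "(\<lambda>x. if x \<in> {x. invertible x} then x ** inv_sqrt (ctranspose x ** x) else mat 1) \<in> borel_measurable borel"
    by (rule borel_measurable_continuous_on_if[OF borel_open[OF open_invertible] c]) simp
  then show ?thesis by (simp add: unitary_part_def[abs_def])
qed

text \<open>The condition in the description of \<open>haar_unitary\<close>, named so that existence
  and uniqueness can be stated.\<close>

definition is_haar :: "(complex^'n^'n) measure \<Rightarrow> bool" where
  "is_haar \<mu> \<longleftrightarrow> sets \<mu> = sets (restrict_space borel unitary_group) \<and> emeasure \<mu> unitary_group = 1 \<and>
     (\<forall>u\<in>unitary_group. distr \<mu> \<mu> (\<lambda>v. u ** v) = \<mu>)"

lemma measurable_unitary_mult: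
  fixes u :: "complex^'n^'n"
  assumes "u \<in> unitary_group"
  shows "(\<lambda>v. u ** v) \<in> measurable (restrict_space borel unitary_group) (restrict_space borel unitary_group)"
  by (rule measurable_restrict_space3)
    (use assms unitary_group_mult in \<open>auto intro!: borel_measurable_continuous_onI continuous_intros\<close>)

text \<open>Left multiplication by a unitary matrix preserves the Frobenius norm, so in real
  coordinates it is orthogonal and preserves Lebesgue measure.\<close>

lemma orthogonal_unitary_mult_coords:
  assumes u: "u \<in> unitary_group"
  shows "orthogonal_transformation (\<lambda>a. real_coords (u ** complex_matrix a))"
  unfolding orthogonal_transformation
proof (intro conjI allI)
  have "linear (\<lambda>x. u ** x)"
    by (rule linearI) (simp_all add: matrix_add_ldistrib matrix_scaleR_right)
  then show "linear (\<lambda>a. real_coords (u ** complex_matrix a))"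
    using linear_compose[OF linear_compose[OF linear_complex_matrix] linear_real_coords] by (simp add: o_def)
  show "norm (real_coords (u ** complex_matrix a)) = norm a" for a
    using norm_complex_matrix[of "real_coords (u ** complex_matrix a)"]
    by (simp add: norm_unitary_mult[OF u] norm_complex_matrix)
qed

lemma haar_exists: "\<exists>\<mu> :: (complex^'n^'n) measure. is_haar \<mu>"
proof -
  let ?U = "unitary_group :: (complex^'n^'n) set"
  let ?N = "restrict_space borel ?U"
  \<comment> \<open>The unit ball is preserved by left multiplication by unitary matrices, and so is
    invertibility, on which the polar decomposition rests. The uniform distribution on S is
    therefore invariant, and p carries it to the group.\<close>
  define S where "S = {a. norm a < 1 \<and> invertible (complex_matrix a :: complex^'n^'n)}"
  define p where "p = (\<lambda>a. unitary_part (complex_matrix a :: complex^'n^'n))"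
  define \<mu> where "\<mu> = distr (uniform_measure lborel S) ?N p"
  have [measurable]: "complex_matrix \<in> borel_measurable borel"
    by (rule borel_measurable_linear[OF linear_complex_matrix])
  have "open S"
  proof -
    have "S = {a. norm a < 1} \<inter> complex_matrix -` {x. invertible x}"
      by (auto simp: S_def)
    moreover have "open (complex_matrix -` {x :: complex^'n^'n. invertible x})"
      using linear_continuous_on[of complex_matrix UNIV] linear_complex_matrix
      by (intro open_vimage open_invertible) (simp add: linear_linear)
    ultimately show ?thesis
      by (auto intro!: open_Int open_Collect_less continuous_intros)
  qed
  then have S [measurable]: "S \<in> sets borel" by simp
  have "emeasure lborel S \<noteq> 0"
  proof -
    \<comment> \<open>A small multiple of the identity lies in S. A nonempty open set contains a box
      and so has positive measure, which the normalization requires.\<close>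
    define c where "c = 1 / (2 * norm (mat 1 :: complex^'n^'n))"
    have "norm (mat 1 :: complex^'n^'n) \<noteq> 0"
      by (auto simp: vec_eq_iff mat_def)
    then have c: "0 < c" "norm (c *\<^sub>R (mat 1 :: complex^'n^'n)) < 1"
      by (auto simp: c_def)
    then have mem: "real_coords (c *\<^sub>R mat 1) \<in> S"
      using norm_complex_matrix[of "real_coords (c *\<^sub>R mat 1 :: complex^'n^'n)"]
      by (auto simp: S_def intro!: hpd_invertible hpd_scaleR)
    obtain l h where b: "box l h \<subseteq> S" and lh: "\<forall>i\<in>Basis. l \<bullet> i < h \<bullet> i"
      by (rule open_contains_box[OF \<open>open S\<close> mem])
    have "0 < (\<Prod>b\<in>Basis. (h - l) \<bullet> b)"
      using lh by (intro prod_pos) (simp add: inner_diff_left)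
    moreover have "emeasure lborel (box l h) = (\<Prod>b\<in>Basis. (h - l) \<bullet> b)"
      using lh by (intro emeasure_lborel_box) (simp add: less_imp_le)
    ultimately have "0 < emeasure lborel (box l h)"
      by (simp add: ennreal_less_zero_iff)
    also have "\<dots> \<le> emeasure lborel S" using b by (intro emeasure_mono) auto
    finally show ?thesis by simp
  qed
  moreover have "emeasure lborel S \<noteq> \<infinity>"
  proof -
    have "emeasure lborel S < \<infinity>"
      by (rule emeasure_bounded_finite, rule bounded_subset[OF bounded_ball[of 0 1]]) (auto simp: S_def)
    then show ?thesis by simp
  qed
  ultimately interpret um: prob_space "uniform_measure lborel S"
    by (rule prob_space_uniform_measure)
  have p_borel [measurable]: "p \<in> borel_measurable borel"
    unfolding p_def by measurable
  have p [measurable]: "p \<in> measurable borel ?N"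
    by (rule measurable_restrict_space2) (auto simp: p_def unitary_part_unitary)
  have p' [measurable]: "p \<in> measurable (uniform_measure lborel S) ?N"
    using p by (simp add: measurable_cong_sets[of "uniform_measure lborel S" borel])
  interpret \<mu>: prob_space \<mu>
    unfolding \<mu>_def by (rule um.prob_space_distr[OF p'])
  have sets_\<mu>: "sets \<mu> = sets ?N" by (simp add: \<mu>_def)
  have space_\<mu>: "space \<mu> = ?U" by (simp add: \<mu>_def space_restrict_space)
  have em: "emeasure \<mu> A = (\<integral>\<^sup>+a. indicator A (p a) * indicator S a \<partial>lborel) / emeasure lborel S"
    if A [measurable]: "A \<in> sets ?N" for A
  proof -
    have "emeasure \<mu> A = (\<integral>\<^sup>+x. indicator A x \<partial>\<mu>)" using A by (simp add: sets_\<mu>)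
    also have "\<dots> = (\<integral>\<^sup>+a. indicator A (p a) \<partial>uniform_measure lborel S)"
      unfolding \<mu>_def by (rule nn_integral_distr) measurable
    also have "\<dots> = (\<integral>\<^sup>+a. indicator A (p a) * indicator S a \<partial>lborel) / emeasure lborel S"
      by (rule nn_integral_uniform_measure) measurable
    finally show ?thesis .
  qed
  have "distr \<mu> \<mu> (\<lambda>v. u ** v) = \<mu>" if u: "u \<in> ?U" for u
  proof (rule measure_eqI)
    fix A assume "A \<in> sets (distr \<mu> \<mu> (\<lambda>v. u ** v))"
    then have A [measurable]: "A \<in> sets ?N" by (simp add: sets_\<mu>)
    have mu [measurable]: "(\<lambda>v. u ** v) \<in> measurable ?N ?N"
      by (rule measurable_unitary_mult[OF u])
    have mu': "(\<lambda>v. u ** v) \<in> measurable \<mu> \<mu>"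
      by (simp add: measurable_cong_sets[OF sets_\<mu> sets_\<mu>])
    let ?L = "\<lambda>a. real_coords (u ** complex_matrix a)"
    note ort = orthogonal_unitary_mult_coords[OF u]
    have eq: "indicator ((\<lambda>v. u ** v) -` A \<inter> ?U) (p a) * indicator S a = (indicator A (p (?L a)) * indicator S (?L a) :: ennreal)" for a
    proof -
      have "?L a \<in> S \<longleftrightarrow> a \<in> S"
        using orthogonal_transformation_norm[OF ort] unitary_groupD(3)[OF u] by (simp add: S_def invertible_mult_iff)
      moreover have "p (?L a) = u ** p a" if "a \<in> S"
        using that u by (simp add: p_def S_def unitary_part_mult)
      moreover have "p a \<in> ?U" by (simp add: p_def unitary_part_unitary)
      ultimately show ?thesis by (auto simp: indicator_def)
    qed
    have vA: "(\<lambda>v. u ** v) -` A \<inter> ?U \<in> sets ?N"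
      using measurable_sets[OF mu A] by (simp add: space_restrict_space)
    have "(\<integral>\<^sup>+a. indicator A (p (?L a)) * indicator S (?L a) \<partial>lborel) = (\<integral>\<^sup>+a. indicator A (p a) * indicator S a \<partial>lborel)"
      using nn_integral_lborel_linear[of ?L "\<lambda>a. indicator A (p a) * indicator S a"] ort
      by (simp add: orthogonal_transformation_linear orthogonal_transformation_inj)
    then have "emeasure \<mu> ((\<lambda>v. u ** v) -` A \<inter> ?U) = emeasure \<mu> A"
      using em[OF vA] em[OF A] by (simp add: eq)
    then show "emeasure (distr \<mu> \<mu> (\<lambda>v. u ** v)) A = emeasure \<mu> A"
      by (subst emeasure_distr[OF mu']) (simp_all add: sets_\<mu> space_\<mu> A)
  qed simp
  moreover have "emeasure \<mu> ?U = 1"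
    using \<mu>.emeasure_space_1 by (simp add: space_\<mu>)
  ultimately have "is_haar \<mu>" by (simp add: is_haar_def sets_\<mu>)
  then show ?thesis ..
qed

lemma is_haar_prob_space:
  assumes "is_haar \<mu>"
  shows "prob_space \<mu>" "space \<mu> = unitary_group" "sets \<mu> = sets (restrict_space borel unitary_group)"
proof -
  show sets: "sets \<mu> = sets (restrict_space borel unitary_group)"
    using assms by (simp add: is_haar_def)
  then show "space \<mu> = unitary_group"
    using sets_eq_imp_space_eq[OF sets] by (simp add: space_restrict_space)
  then show "prob_space \<mu>"
    using assms by (intro prob_spaceI) (simp add: is_haar_def)
qed

lemma is_haar_nn_integral:
  assumes \<mu>: "is_haar \<mu>" and u: "u \<in> unitary_group"
    and [measurable]: "f \<in> borel_measurable (restrict_space borel unitary_group)"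
  shows "(\<integral>\<^sup>+v. f (u ** v) \<partial>\<mu>) = (\<integral>\<^sup>+v. f v \<partial>\<mu>)"
proof -
  note s = is_haar_prob_space(3)[OF \<mu>]
  have "(\<integral>\<^sup>+v. f v \<partial>\<mu>) = (\<integral>\<^sup>+v. f v \<partial>distr \<mu> \<mu> (\<lambda>v. u ** v))"
    using \<mu> u by (simp add: is_haar_def)
  also have "\<dots> = (\<integral>\<^sup>+v. f (u ** v) \<partial>\<mu>)"
  proof -
    have "(\<lambda>v. u ** v) \<in> measurable \<mu> \<mu>"
      using measurable_unitary_mult[OF u] by (simp only: measurable_cong_sets[OF s s])
    moreover have "f \<in> borel_measurable \<mu>"
      using assms(3) by (simp only: measurable_cong_sets[OF s refl])
    ultimately show ?thesis by (simp add: nn_integral_distr)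
  qed
  finally show ?thesis ..
qed

(* Integrating f(x^(-1) y) in both orders gives mu(f) = nu(f o inverse) for any two Haar measures;
   apply this to (mu, nu) and to (nu, nu). *)
lemma haar_unique:
  fixes \<mu> \<nu> :: "(complex^'n^'n) measure"
  assumes \<mu>: "is_haar \<mu>" and \<nu>: "is_haar \<nu>"
  shows "\<mu> = \<nu>"
proof -
  let ?N = "restrict_space borel (unitary_group :: (complex^'n^'n) set)"
  have inv: "(\<integral>\<^sup>+v. f v \<partial>\<mu>) = (\<integral>\<^sup>+v. f (ctranspose v) \<partial>\<nu>)"
    if \<mu>: "is_haar \<mu>" and \<nu>: "is_haar \<nu>" and f: "f \<in> borel_measurable ?N" for \<mu> \<nu> and f :: "_ \<Rightarrow> ennreal"
  proof -
    interpret \<mu>: prob_space \<mu> by (rule is_haar_prob_space[OF \<mu>])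
    interpret \<nu>: prob_space \<nu> by (rule is_haar_prob_space[OF \<nu>])
    interpret pair_sigma_finite \<nu> \<mu> ..
    note s\<mu> = is_haar_prob_space(3)[OF \<mu>] and s\<nu> = is_haar_prob_space(3)[OF \<nu>]
    have space: "space (\<nu> \<Otimes>\<^sub>M \<mu>) = unitary_group \<times> unitary_group"
      by (simp add: space_pair_measure is_haar_prob_space(2)[OF \<mu>] is_haar_prob_space(2)[OF \<nu>])
    have [measurable]: "(\<lambda>v. v $ i $ j) \<in> borel_measurable \<mu>" "(\<lambda>v. v $ i $ j) \<in> borel_measurable \<nu>" for i j
      unfolding measurable_cong_sets[OF s\<mu> refl] measurable_cong_sets[OF s\<nu> refl]
      by (auto intro!: measurable_restrict_space1 borel_measurable_continuous_onI continuous_intros)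
    have "(\<lambda>p. ctranspose (fst p) ** snd p) \<in> borel_measurable (\<nu> \<Otimes>\<^sub>M \<mu>)"
      by (rule borel_measurable_matrixI) (simp add: matrix_matrix_mult_def)
    then have "(\<lambda>p. ctranspose (fst p) ** snd p) \<in> measurable (\<nu> \<Otimes>\<^sub>M \<mu>) ?N"
      by (rule measurable_restrict_space2[rotated])
        (auto simp: space intro!: unitary_group_mult unitary_group_ctranspose)
    then have m: "(\<lambda>(x, y). f (ctranspose x ** y)) \<in> borel_measurable (\<nu> \<Otimes>\<^sub>M \<mu>)"
      using measurable_compose[OF _ f] by (simp add: case_prod_unfold)
    have ft: "(\<lambda>x. f (ctranspose x)) \<in> borel_measurable ?N"
      by (rule measurable_compose[OF _ f], rule measurable_restrict_space3)
        (auto intro!: borel_measurable_continuous_onI continuous_intros unitary_group_ctranspose)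
    have "(\<integral>\<^sup>+y. f y \<partial>\<mu>) = (\<integral>\<^sup>+x. (\<integral>\<^sup>+y. f y \<partial>\<mu>) \<partial>\<nu>)"
      by (simp add: \<nu>.emeasure_space_1)
    also have "\<dots> = (\<integral>\<^sup>+x. (\<integral>\<^sup>+y. f (ctranspose x ** y) \<partial>\<mu>) \<partial>\<nu>)"
      by (intro nn_integral_cong is_haar_nn_integral[OF \<mu> _ f, symmetric])
        (simp add: is_haar_prob_space(2)[OF \<nu>] unitary_group_ctranspose)
    also have "\<dots> = (\<integral>\<^sup>+y. (\<integral>\<^sup>+x. f (ctranspose x ** y) \<partial>\<nu>) \<partial>\<mu>)"
      by (rule Fubini'[OF m, symmetric])
    also have "\<dots> = (\<integral>\<^sup>+y. (\<integral>\<^sup>+x. f (ctranspose x) \<partial>\<nu>) \<partial>\<mu>)"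
    proof (rule nn_integral_cong)
      fix y assume "y \<in> space \<mu>"
      then have y: "y \<in> unitary_group" by (simp add: is_haar_prob_space(2)[OF \<mu>])
      have fy: "(\<lambda>x. f (ctranspose x ** y)) \<in> borel_measurable ?N"
        by (rule measurable_compose[OF _ f], rule measurable_restrict_space3)
          (auto intro!: borel_measurable_continuous_onI continuous_intros unitary_group_ctranspose unitary_group_mult y)
      have "(\<integral>\<^sup>+x. f (ctranspose x ** y) \<partial>\<nu>) = (\<integral>\<^sup>+x. f (ctranspose (y ** x) ** y) \<partial>\<nu>)"
        by (rule is_haar_nn_integral[OF \<nu> y fy, symmetric])
      also have "\<dots> = (\<integral>\<^sup>+x. f (ctranspose x) \<partial>\<nu>)"
        using unitary_groupD(1)[OF y] by (simp add: ctranspose_mult flip: matrix_mul_assoc)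
      finally show "(\<integral>\<^sup>+x. f (ctranspose x ** y) \<partial>\<nu>) = (\<integral>\<^sup>+x. f (ctranspose x) \<partial>\<nu>)" .
    qed
    also have "\<dots> = (\<integral>\<^sup>+x. f (ctranspose x) \<partial>\<nu>)"
      by (simp add: \<mu>.emeasure_space_1)
    finally show ?thesis .
  qed
  show ?thesis
  proof (rule measure_eqI)
    show "sets \<mu> = sets \<nu>" using assms by (simp add: is_haar_def)
    fix A assume "A \<in> sets \<mu>"
    then have A: "A \<in> sets ?N" using \<mu> by (simp add: is_haar_def)
    then have "(\<integral>\<^sup>+v. indicator A v \<partial>\<mu>) = (\<integral>\<^sup>+v. indicator A v \<partial>\<nu>)"
      using inv[OF \<mu> \<nu>, of "indicator A"] inv[OF \<nu> \<nu>, of "indicator A"] by simp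
    then show "emeasure \<mu> A = emeasure \<nu> A"
      using A \<mu> \<nu> by (simp add: is_haar_def)
  qed
qed

lemma is_haar_haar_unitary: "is_haar haar_unitary"
proof -
  have "\<exists>!\<mu>. is_haar \<mu>" using haar_exists haar_unique by blast
  then have "is_haar (THE \<mu>. is_haar \<mu>)" by (rule theI')
  then show ?thesis by (simp only: haar_unitary_def is_haar_def)
qed

subsection \<open>The kernel and its spherical transform\<close>

text \<open>The bracket in the formula for the kernel. With y = 1 it is the determinant of x (1 +
  x)^(-2), so f and K become one function of two arguments.\<close>

definition det_ratio :: "complex^'n^'n \<Rightarrow> complex^'n^'n \<Rightarrow> complex" where
  "det_ratio x y = det x * det y / (det (x + y))\<^sup>2"

lemma hpd_det_obtain:
  assumes "x \<in> hpd"
  obtains p where "0 < p" "det x = complex_of_real p"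
  using hpd_det_pos[OF assms] hpd_det_eq[OF assms] by blast

lemma det_ratio_commute: "det_ratio x y = det_ratio y x"
  by (simp add: det_ratio_def mult.commute add.commute)

text \<open>Each of the three determinants is multiplied by |det g|^2, two in the numerator and one
  squared in the denominator.\<close>

lemma det_ratio_act:
  assumes "invertible g"
  shows "det_ratio (act g x) (act g y) = det_ratio x y"
proof -
  have "complex_of_real ((cmod (det g))\<^sup>2) \<noteq> 0"
    using assms by (simp add: invertible_det_nz)
  then show ?thesis
    unfolding det_ratio_def act_add[symmetric] det_act by (simp add: power2_eq_square)
qed

text \<open>The complex power splits because all three determinants are positive reals. The exponent
  -2 b is the one that a Gamma integral of parameter 2 b produces.\<close>

lemma det_ratio_powr:
  assumes x: "x \<in> hpd" and y: "y \<in> hpd"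
  shows "det_ratio x y powr b = det x powr b * det y powr b * det (x + y) powr (- (2 * b))"
proof -
  obtain p where p: "0 < p" "det x = complex_of_real p" by (rule hpd_det_obtain[OF x])
  obtain q where q: "0 < q" "det y = complex_of_real q" by (rule hpd_det_obtain[OF y])
  obtain s where s: "0 < s" "det (x + y) = complex_of_real s" by (rule hpd_det_obtain[OF hpd_add[OF x y]])
  have "det_ratio x y = of_real (p * q / s\<^sup>2)" by (simp add: det_ratio_def p q s)
  then have "det_ratio x y powr b = exp (b * of_real (ln (p * q / s\<^sup>2)))"
    using p q s by (simp only: of_real_powr divide_pos_pos mult_pos_pos zero_less_power)
  also have "ln (p * q / s\<^sup>2) = ln p + ln q - 2 * ln s"
    using p q s by (simp add: ln_div ln_mult ln_realpow)
  finally show ?thesis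
    using p q s by (simp add: of_real_powr exp_add[symmetric] algebra_simps)
qed

lemma det_ratio_pos:
  assumes x: "x \<in> hpd" and y: "y \<in> hpd"
  obtains p where "0 < p" "det_ratio x y = complex_of_real p"
proof -
  obtain p where p: "0 < p" "det x = complex_of_real p" by (rule hpd_det_obtain[OF x])
  obtain q where q: "0 < q" "det y = complex_of_real q" by (rule hpd_det_obtain[OF y])
  obtain s where s: "0 < s" "det (x + y) = complex_of_real s" by (rule hpd_det_obtain[OF hpd_add[OF x y]])
  show ?thesis
    by (rule that[of "p * q / s\<^sup>2"]) (use p q s in \<open>simp_all add: det_ratio_def\<close>)
qed

lemma continuous_on_det_ratio_powr:
  fixes f g :: "'a::topological_space \<Rightarrow> complex^'n^'n"
  assumes "continuous_on A f" "continuous_on A g" "\<And>x. x \<in> A \<Longrightarrow> f x \<in> hpd" "\<And>x. x \<in> A \<Longrightarrow> g x \<in> hpd"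
  shows "continuous_on A (\<lambda>x. det_ratio (f x) (g x) powr b)"
proof (rule continuous_on_powr_complex)
  have pos: "0 < Re (det_ratio (f x) (g x))" "det_ratio (f x) (g x) \<noteq> 0" if "x \<in> A" for x
    using det_ratio_pos[of "f x" "g x"] assms(3,4) that by (metis Re_complex_of_real, metis of_real_eq_0_iff less_irrefl)
  show "A \<subseteq> {x. 0 \<le> Re (det_ratio (f x) (g x)) \<or> Im (det_ratio (f x) (g x)) \<noteq> 0}"
    using pos(1) by (auto simp: less_imp_le)
  show "0 < Re b" if "x \<in> A" "det_ratio (f x) (g x) = 0" for x using pos(2) that by blast
  have "det (f x + g x) \<noteq> 0" if "x \<in> A" for x
    using hpd_invertible[OF hpd_add[OF assms(3,4)]] that by (simp add: invertible_det_nz)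
  then show "continuous_on A (\<lambda>x. det_ratio (f x) (g x))"
    unfolding det_ratio_def by (intro continuous_intros assms) auto
qed simp

text \<open>Used to see that the constant in front of the kernel is real, as Hermitian symmetry
  demands.\<close>

lemma Gamma_M_real: "Gamma_M (\<chi> k::'n::{finite,linorder}. complex_of_real c) =
  complex_of_real ((2 * pi) ^ (CARD('n) * (CARD('n) - 1) div 2) * (\<Prod>k::'n\<in>UNIV. Gamma (c - real (card {..k}) + 1)))"
proof -
  have "Gamma (complex_of_real c - of_nat (card {..k}) + 1) = complex_of_real (Gamma (c - real (card {..k}) + 1))" for k :: 'n
    using Gamma_complex_of_real[of "c - real (card {..k}) + 1"] by simp
  then show ?thesis by (simp add: Gamma_M_def)
qed

lemma hermitian_psd_cong:
  assumes "\<And>i j. i < n \<Longrightarrow> j < n \<Longrightarrow> a i j = b i j"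
  shows "hermitian_psd n a \<longleftrightarrow> hermitian_psd n b"
proof -
  have "(\<Sum>i<n. \<Sum>j<n. cnj (c i) * a i j * c j) = (\<Sum>i<n. \<Sum>j<n. cnj (c i) * b i j * c j)" for c
    by (intro sum.cong refl) (simp add: assms)
  then show ?thesis unfolding hermitian_psd_def by (simp add: assms)
qed

lemma hermitian_psd_det_ratio:
  fixes x :: "nat \<Rightarrow> 'n::{finite,linorder} cmat"
  assumes a: "real CARD('n) - 1 < a" and x: "\<And>i. i < n \<Longrightarrow> x i \<in> hpd"
  shows "hermitian_psd n (\<lambda>i j. Gamma_M (\<chi> k::'n. of_real (2 * a)) * det_ratio (x i) (x j) powr of_real a)"
  unfolding hermitian_psd_def
proof (intro conjI allI impI)
  let ?G = "Gamma_M (\<chi> k::'n. complex_of_real (2 * a))"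
  let ?k = "\<lambda>i j. ?G * det_ratio (x i) (x j) powr of_real a"
  show "?k j i = cnj (?k i j)" if "i < n" "j < n" for i j
  proof -
    obtain p where "0 < p" "det_ratio (x i) (x j) = complex_of_real p"
      using det_ratio_pos x \<open>i < n\<close> \<open>j < n\<close> by metis
    then show ?thesis
      by (simp add: det_ratio_commute[of "x j"] of_real_powr Gamma_M_real exp_of_real[symmetric] exp_cnj del: of_real_mult)
  qed
  fix c :: "nat \<Rightarrow> complex"
  define d where "d = (\<lambda>i. det (x i) powr of_real a)"
  define e where "e = (\<lambda>i z. exp (- trace (x i ** z)))"
  define w where "w = (\<lambda>z :: 'n cmat. det z powr of_real (2 * a))"
  have b: "real CARD('n) - 1 < Re (complex_of_real (2 * a))"
  proof -
    have "1 \<le> real CARD('n)" by (simp add: Suc_leI)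
    then have "real CARD('n) - 1 < 2 * a" using a by linarith
    then show ?thesis by simp
  qed
  have sum: "exp (- trace ((x i + x j) ** z)) = e i z * e j z" for i j z
    by (simp add: e_def matrix_add_rdistrib trace_add exp_add[symmetric])
  have int: "integrable vol (\<lambda>z. e i z * e j z * w z)" if "i < n" "j < n" for i j
    using integrable_Gamma_det[OF hpd_add[OF x x] b, OF that] unfolding w_def sum .
  have k: "?k i j = d i * d j * (\<integral>z. e i z * e j z * w z \<partial>vol)" if "i < n" "j < n" for i j
    using integral_Gamma_det[OF hpd_add[OF x x] b, OF that] unfolding w_def sum
    by (simp add: det_ratio_powr x that d_def mult_ac)
  have d: "cnj (d i) = d i" if i: "i < n" for i
  proof -
    obtain p where "0 < p" "det (x i) = complex_of_real p" by (rule hpd_det_obtain[OF x[OF i]])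
    then show ?thesis by (simp add: d_def of_real_powr exp_cnj)
  qed
  have "(\<Sum>i<n. \<Sum>j<n. cnj (c i) * ?k i j * c j) = (\<Sum>i<n. \<Sum>j<n. \<integral>z. cnj (c i) * d i * d j * c j * (e i z * e j z * w z) \<partial>vol)"
  proof (intro sum.cong refl)
    fix i j assume "i \<in> {..<n}" "j \<in> {..<n}"
    then have "cnj (c i) * ?k i j * c j = cnj (c i) * d i * d j * c j * (\<integral>z. e i z * e j z * w z \<partial>vol)"
      unfolding lessThan_iff by (subst k) (simp_all only: mult_ac)
    also have "\<dots> = (\<integral>z. cnj (c i) * d i * d j * c j * (e i z * e j z * w z) \<partial>vol)"
      by (rule integral_mult_right_zero[symmetric])
    finally show "cnj (c i) * ?k i j * c j = \<dots>" .
  qed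
  also have "\<dots> = (\<integral>z. (\<Sum>i<n. \<Sum>j<n. cnj (c i) * d i * d j * c j * (e i z * e j z * w z)) \<partial>vol)"
  proof -
    have gi: "integrable vol (\<lambda>z. cnj (c i) * d i * d j * c j * (e i z * e j z * w z))" if "i \<in> {..<n}" "j \<in> {..<n}" for i j
      using that by (intro integrable_mult_right int) auto
    then have "(\<Sum>i<n. \<Sum>j<n. \<integral>z. cnj (c i) * d i * d j * c j * (e i z * e j z * w z) \<partial>vol)
      = (\<Sum>i<n. \<integral>z. (\<Sum>j<n. cnj (c i) * d i * d j * c j * (e i z * e j z * w z)) \<partial>vol)"
      by (intro sum.cong refl Bochner_Integration.integral_sum[symmetric])
    also have "\<dots> = (\<integral>z. (\<Sum>i<n. \<Sum>j<n. cnj (c i) * d i * d j * c j * (e i z * e j z * w z)) \<partial>vol)"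
      by (intro Bochner_Integration.integral_sum[symmetric] Bochner_Integration.integrable_sum gi)
    finally show ?thesis .
  qed
  also have "Re \<dots> = (\<integral>z. Re (\<Sum>i<n. \<Sum>j<n. cnj (c i) * d i * d j * c j * (e i z * e j z * w z)) \<partial>vol)"
    using int by (intro integral_Re[symmetric] Bochner_Integration.integrable_sum integrable_mult_right) auto
  also have "0 \<le> \<dots>"
  proof (rule Bochner_Integration.integral_nonneg)
    fix z :: "'n cmat" assume "z \<in> space vol"
    then have z: "z \<in> hpd" by simp
    \<comment> \<open>The determinant powers d and the exponentials e are real, so the double sum at
      z is |S|^2 times the positive weight w z.\<close>
    define S where "S = (\<Sum>j<n. c j * d j * e j z)"
    have e: "cnj (e i z) = e i z" if "i < n" for i
    proof -
      have "complex_of_real (norm (e i z)) = e i z"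
        unfolding e_def by (rule norm_exp_trace[OF hpd_ctranspose[OF x[OF that]] hpd_ctranspose[OF z]])
      then show ?thesis by (metis complex_cnj_complex_of_real)
    qed
    obtain p where p: "0 < p" "det z = complex_of_real p" by (rule hpd_det_obtain[OF z])
    have wz: "w z = of_real (p powr (2 * a))"
      unfolding w_def p(2) using p(1) by (intro powr_of_real) simp
    have "cnj S = (\<Sum>i<n. cnj (c i) * d i * e i z)"
      by (simp add: S_def cnj_sum d e)
    then have "cnj S * S = (\<Sum>i<n. \<Sum>j<n. (cnj (c i) * d i * e i z) * (c j * d j * e j z))"
      by (simp only: sum_product) (simp only: S_def sum_product)
    then have "cnj S * S * w z = (\<Sum>i<n. \<Sum>j<n. (cnj (c i) * d i * e i z) * (c j * d j * e j z) * w z)"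
      by (simp only: sum_distrib_right)
    then have "(\<Sum>i<n. \<Sum>j<n. cnj (c i) * d i * d j * c j * (e i z * e j z * w z)) = cnj S * S * w z"
      by (simp only: mult_ac)
    also have "\<dots> = of_real ((cmod S)\<^sup>2 * p powr (2 * a))"
      using complex_norm_square[of S] by (simp add: wz mult.commute)
    finally show "0 \<le> Re (\<Sum>i<n. \<Sum>j<n. cnj (c i) * d i * d j * c j * (e i z * e j z * w z))"
      by (simp only: Re_complex_of_real) simp
  qed
  finally show "0 \<le> Re (\<Sum>i<n. \<Sum>j<n. cnj (c i) * ?k i j * c j)" .
qed

section \<open>Averaging over the unitary group\<close>

lemma Delta_gen_add:
  assumes "x \<in> hpd"
  shows "Delta_gen (s + t) x = Delta_gen s x * Delta_gen t x"
proof -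
  have "gap (s + t) k = gap s k + gap t k" for k by (simp add: gap_def)
  then show ?thesis
    by (simp add: Delta_gen_eq powr_add prod.distrib)
qed

text \<open>All differences of exponents vanish except at the last index, where the leading minor is
  the full determinant.\<close>

lemma Delta_gen_const:
  fixes x :: "'n::{finite,linorder} cmat"
  assumes "x \<in> hpd"
  shows "Delta_gen (\<chi> k. c) x = det x powr c"
proof -
  let ?m = "Max (UNIV :: 'n set)"
  have max: "{k<..} = {} \<longleftrightarrow> k = ?m" for k :: 'n
  proof
    assume "{k<..} = {}"
    then have "i \<le> k" for i using not_le by blast
    then show "k = ?m" by (intro Max_eqI[symmetric]) auto
  next
    assume "k = ?m"
    then show "{k<..} = {}" by (auto simp: not_less[symmetric] leD)
  qed
  have nz: "principal_minor S x \<noteq> 0" for S using principal_minor_pos[OF assms, of S] by auto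
  have "Delta_gen (\<chi> k. c) x = (\<Prod>k\<in>UNIV. if k = ?m then principal_minor {..?m} x powr c else 1)"
    unfolding Delta_gen_eq by (intro prod.cong refl) (simp add: gap_def max nz)
  also have "\<dots> = principal_minor {..?m} x powr c" by simp
  also have "{..?m} = UNIV" by auto
  also have "principal_minor UNIV x = det x" by (simp add: principal_minor_def det_def)
  finally show ?thesis .
qed

lemma haar_unitary_prob_space:
  "prob_space haar_unitary" "space haar_unitary = unitary_group"
  "sets haar_unitary = sets (restrict_space borel unitary_group)"
  using is_haar_prob_space[OF is_haar_haar_unitary] by auto

lemma measurable_act_pair:
  "(\<lambda>p. act (fst p) (snd p)) \<in> measurable (haar_unitary \<Otimes>\<^sub>M vol) (vol :: 'n::{finite,linorder} cmat measure)"
proof -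
  have "(\<lambda>v. v $ i $ j) \<in> borel_measurable (haar_unitary :: 'n cmat measure)" for i j
    unfolding measurable_cong_sets[OF haar_unitary_prob_space(3) refl]
    by (auto intro!: measurable_restrict_space1 borel_measurable_continuous_onI continuous_intros)
  note measurable_compose[OF measurable_fst this, measurable] measurable_compose[OF measurable_snd borel_measurable_vol_entry, measurable]
  have "(\<lambda>p. act (fst p) (snd p)) \<in> borel_measurable (haar_unitary \<Otimes>\<^sub>M (vol :: 'n cmat measure))"
    by (rule borel_measurable_matrixI) (simp add: act_nth)
  then have "(\<lambda>p. act (fst p) (snd p)) \<in> measurable (haar_unitary \<Otimes>\<^sub>M (vol :: 'n cmat measure)) (restrict_space borel hpd)"
    by (rule measurable_restrict_space2[rotated])
      (auto simp: space_pair_measure haar_unitary_prob_space(2) intro!: act_hpd unitary_groupD(3))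
  then show ?thesis by (simp add: measurable_cong_sets[OF refl sets_vol])
qed

text \<open>Invariance of f allows x to be replaced by \<open>act u x\<close> in f as well, and the
  volume is invariant. The map h is later the norm, for absolute integrability, and the identity,
  for the value.\<close>

lemma integral_vol_U_shift:
  fixes h :: "complex \<Rightarrow> 'b::{banach,second_countable_topology}"
  assumes U: "U_invariant f" and u: "u \<in> unitary_group"
    and fD: "(\<lambda>x. f x * Delta_gen s x) \<in> borel_measurable vol" and h: "h \<in> borel_measurable borel"
  shows "(\<integral>x. h (f x * Delta_gen s (act u x)) \<partial>vol) = (\<integral>x. h (f x * Delta_gen s x) \<partial>vol)"
proof -
  have "(\<integral>x. h (f x * Delta_gen s (act u x)) \<partial>vol) = (\<integral>x. (\<lambda>x. h (f x * Delta_gen s x)) (act u x) \<partial>vol)"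
    using U u by (intro Bochner_Integration.integral_cong refl) (simp add: U_invariant_def)
  also have "\<dots> = (\<integral>x. h (f x * Delta_gen s x) \<partial>vol)"
    by (rule integral_vol_act[OF unitary_groupD(3)[OF u]]) (rule measurable_compose[OF fD h])
  finally show ?thesis .
qed

text \<open>After exchanging the integrals, the integral over x is the same for every u, and Haar
  measure has total mass 1.\<close>

lemma spherical_transform_eq:
  fixes f :: "'n::{finite,linorder} cmat \<Rightarrow> complex" and t :: "(real,'n) vec"
  defines "s \<equiv> \<chi> k. - \<i> * of_real (t $ k) + of_real (delta $ k)"
  assumes U: "U_invariant f" and f: "f \<in> borel_measurable vol"
    and int: "integrable vol (\<lambda>x. f x * Delta_gen s x)"
  shows "spherical_transform f t = (\<integral>x. f x * Delta_gen s x \<partial>vol)"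
proof -
  interpret haar: prob_space "haar_unitary :: 'n cmat measure" by (rule haar_unitary_prob_space)
  interpret vol: sigma_finite_measure "vol :: 'n cmat measure" by (rule sigma_finite_vol)
  interpret pair_sigma_finite "haar_unitary :: 'n cmat measure" "vol :: 'n cmat measure" ..
  let ?g = "\<lambda>u x. f x * Delta_gen s (act u x)"
  have fD: "(\<lambda>x. f x * Delta_gen s x) \<in> borel_measurable vol"
    using int by (rule borel_measurable_integrable)
  have g: "?g u x = f (act u x) * Delta_gen s (act u x)" if "u \<in> unitary_group" "x \<in> hpd" for u x
    using U that by (simp add: U_invariant_def)
  have m: "case_prod ?g \<in> borel_measurable (haar_unitary \<Otimes>\<^sub>M vol)"
    unfolding case_prod_unfold
    by (intro borel_measurable_times measurable_compose[OF measurable_snd f]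
        measurable_compose[OF measurable_act_pair borel_measurable_Delta_gen])
  note inner = integral_vol_U_shift[OF U _ fD]
  have "integrable (haar_unitary \<Otimes>\<^sub>M vol) (case_prod ?g)"
  proof (rule Fubini_integrable[OF m])
    \<comment> \<open>The integral of the norm over x does not depend on u, and constants are
      integrable over a probability measure.\<close>
    have "integrable haar_unitary (\<lambda>u::'n cmat. \<integral>x. norm (f x * Delta_gen s x) \<partial>vol)"
      by simp
    also have "?this \<longleftrightarrow> integrable haar_unitary (\<lambda>u. \<integral>x. norm (?g u x) \<partial>vol)"
      by (intro Bochner_Integration.integrable_cong refl)
        (use inner[where h = norm] in \<open>simp add: haar_unitary_prob_space(2)\<close>)
    finally show "integrable haar_unitary (\<lambda>u. \<integral>x. norm (case_prod ?g (u, x)) \<partial>vol)" by simp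
    show "AE u in haar_unitary. integrable vol (\<lambda>x. case_prod ?g (u, x))"
    proof (rule AE_I2)
      fix u :: "'n cmat" assume "u \<in> space haar_unitary"
      then have u: "u \<in> unitary_group" by (simp add: haar_unitary_prob_space(2))
      have "integrable vol (\<lambda>x. f (act u x) * Delta_gen s (act u x))"
        using integrable_vol_act[OF unitary_groupD(3)[OF u] fD] int by simp
      also have "?this \<longleftrightarrow> integrable vol (?g u)"
        by (intro Bochner_Integration.integrable_cong refl) (simp add: g u)
      finally show "integrable vol (\<lambda>x. case_prod ?g (u, x))" by simp
    qed
  qed
  then have "(\<integral>x. (\<integral>u. ?g u x \<partial>haar_unitary) \<partial>vol) = (\<integral>u. (\<integral>x. ?g u x \<partial>vol) \<partial>haar_unitary)"
    by (rule Fubini_integral)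
  also have "\<dots> = (\<integral>u. (\<integral>x. f x * Delta_gen s x \<partial>vol) \<partial>(haar_unitary :: 'n cmat measure))"
    by (rule Bochner_Integration.integral_cong[OF refl])
      (use inner[where h = "\<lambda>x. x"] in \<open>simp add: haar_unitary_prob_space(2)\<close>)
  also have "\<dots> = (\<integral>x. f x * Delta_gen s x \<partial>vol)"
    by (simp add: haar.prob_space)
  finally show ?thesis
    by (simp add: spherical_transform_def spherical_fun_def s_def)
qed

theorem mainTheorem4:
  fixes \<alpha> :: real
    and f :: "complex^'n::{finite,linorder}^'n::{finite,linorder} \<Rightarrow> complex"
    and K :: "complex^'n::{finite,linorder}^'n::{finite,linorder} \<Rightarrow> complex^'n::{finite,linorder}^'n::{finite,linorder} \<Rightarrow> complex"
  assumes "\<alpha> > real CARD('n) - 1"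
    and "\<And>x. x \<in> hpd \<Longrightarrow>
      f x = Gamma_M (\<chi> k::'n. of_real (2 * \<alpha>)) *
            Delta_pow \<alpha> (x ** matrix_inv ((mat 1 + x) ** (mat 1 + x)))"
    and "\<And>x y. x \<in> hpd \<Longrightarrow> y \<in> hpd \<Longrightarrow> K x y = f (inv_sqrt y ** x ** inv_sqrt y)"
  shows "U_invariant f \<and> integrable vol f \<and> positive_definite_fun f \<and>
    (\<forall>t. spherical_transform f t =
       of_real ((cmod (Gamma_M (\<chi> k. of_real (\<alpha> + delta $ k) + \<i> * of_real (t $ k))))\<^sup>2)) \<and>
    invariant_kernel K \<and>
    (\<forall>x\<in>hpd. \<forall>y\<in>hpd.
       K x y = Gamma_M (\<chi> k::'n. of_real (2 * \<alpha>)) *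
               (det x * det y / (det (x + y))\<^sup>2) powr of_real \<alpha>)"
proof -
  let ?G = "Gamma_M (\<chi> k::'n. complex_of_real (2 * \<alpha>))"
  have N: "1 \<le> real CARD('n)" by (simp add: Suc_leI)
  then have "0 < \<alpha>" using assms(1) by linarith
  have f: "f x = ?G * det_ratio x (mat 1) powr of_real \<alpha>" if x: "x \<in> hpd" for x
  proof -
    let ?A = "(mat 1 + x) ** (mat 1 + x)"
    have "invertible (mat 1 + x)" by (intro hpd_invertible hpd_add mat_1_hpd x)
    then have nz: "det (mat 1 + x) \<noteq> 0" and "invertible ?A" by (simp_all add: invertible_det_nz det_mul)
    then have "det ?A * det (matrix_inv ?A) = 1"
      by (metis det_I det_mul matrix_inv_mult(1))
    then have "det (matrix_inv ?A) = 1 / (det (mat 1 + x))\<^sup>2"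
      using nz by (simp add: det_mul power2_eq_square field_simps)
    then show ?thesis
      using assms(2)[OF x] by (simp add: Delta_pow_def det_mul det_ratio_def add.commute)
  qed
  have f': "f x = det x powr of_real \<alpha> * (?G * det (mat 1 + x) powr (- of_real (2 * \<alpha>)))" if "x \<in> hpd" for x
    using that by (simp add: f det_ratio_powr powr_def[of 1] add.commute)
  have K: "f (inv_sqrt y ** x ** inv_sqrt y) = ?G * det_ratio x y powr of_real \<alpha>" if x: "x \<in> hpd" and y: "y \<in> hpd" for x y
  proof -
    note i = inv_sqrt[OF y]
    have "inv_sqrt y ** x ** inv_sqrt y = act (inv_sqrt y) x"
      by (simp add: act_def hpd_ctranspose[OF i(1)])
    moreover have "det_ratio (act (inv_sqrt y) x) (act (inv_sqrt y) y) = det_ratio x y"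
      by (rule det_ratio_act[OF hpd_invertible[OF i(1)]])
    ultimately show ?thesis
      using f[OF act_hpd[OF x hpd_invertible[OF i(1)]]] by (simp add: i(2))
  qed
  have U: "U_invariant f"
    unfolding U_invariant_def
  proof (intro ballI)
    fix u x :: "'n cmat" assume u: "u \<in> unitary_group" and x: "x \<in> hpd"
    have "act u (mat 1) = mat 1" using unitary_groupD(2)[OF u] by (simp add: act_def)
    then have "det_ratio (act u x) (mat 1) = det_ratio x (mat 1)"
      using det_ratio_act[OF unitary_groupD(3)[OF u], of x "mat 1"] by simp
    then show "f (act u x) = f x"
      using act_hpd[OF x unitary_groupD(3)[OF u]] x by (simp add: f)
  qed
  have cont: "continuous_on hpd f"
  proof (rule continuous_on_cong[THEN iffD1, OF refl])
    show "continuous_on hpd (\<lambda>x. ?G * det_ratio x (mat 1) powr of_real \<alpha>)"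
      by (intro continuous_intros continuous_on_det_ratio_powr) auto
  qed (simp add: f)
  \<comment> \<open>Multiplication by det(x)^\<alpha> shifts every component of s by \<alpha>, so
    this is the Beta integrand with b = 2 \<alpha>.\<close>
  have beta: "f x * Delta_gen s x = Delta_gen (s + (\<chi> k. of_real \<alpha>)) x * (?G * det (mat 1 + x) powr (- of_real (2 * \<alpha>)))"
    if "x \<in> hpd" for s x
    using that by (simp add: f' Delta_gen_add Delta_gen_const)
  have b: "real CARD('n) - 1 < Re (of_real (2 * \<alpha>))"
  proof -
    have "real CARD('n) - 1 < 2 * \<alpha>" using assms(1) N by linarith
    then show ?thesis by simp
  qed
  have int: "integrable vol (\<lambda>x. f x * Delta_gen s x)"
    and val: "(\<integral>x. f x * Delta_gen s x \<partial>vol) = Gamma_M (s + (\<chi> k. of_real \<alpha>)) * of_real (2 * pi) ^ (CARD('n) * (CARD('n) - 1) div 2) *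
      (\<Prod>k\<in>UNIV. Gamma (of_real (2 * \<alpha>) - (s + (\<chi> k. of_real \<alpha>)) $ k + of_nat (card {..k}) - of_nat CARD('n)))"
    if s: "\<And>k. real (card {..k}) - 1 < Re (s $ k) + \<alpha>" "\<And>k. Re (s $ k) < \<alpha> + real (card {..k}) - real CARD('n)" for s
  proof -
    have s': "real (card {..k}) - 1 < Re ((s + (\<chi> k. of_real \<alpha>)) $ k)"
      "Re ((s + (\<chi> k. of_real \<alpha>)) $ k) < Re (of_real (2 * \<alpha>)) + real (card {..k}) - real CARD('n)" for k
      using s[of k] by simp_all
    show "integrable vol (\<lambda>x. f x * Delta_gen s x)"
      by (rule Bochner_Integration.integrable_cong[THEN iffD2, OF refl _ integrable_Beta[OF b s']]) (simp add: beta)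
    show "(\<integral>x. f x * Delta_gen s x \<partial>vol) = Gamma_M (s + (\<chi> k. of_real \<alpha>)) * of_real (2 * pi) ^ (CARD('n) * (CARD('n) - 1) div 2) *
      (\<Prod>k\<in>UNIV. Gamma (of_real (2 * \<alpha>) - (s + (\<chi> k. of_real \<alpha>)) $ k + of_nat (card {..k}) - of_nat CARD('n)))"
      unfolding integral_Beta[OF b s', symmetric]
      by (intro Bochner_Integration.integral_cong refl) (simp add: beta)
  qed
  have card: "1 \<le> real (card {..k})" "real (card {..k}) \<le> real CARD('n)" for k :: 'n
    using card_atMost_pos[of k] card_atMost_le[of k] by (auto simp: Suc_leI)
  have integrable: "integrable vol f"
  proof -
    have "integrable vol (\<lambda>x. f x * Delta_gen (0 :: (complex,'n) vec) x)"
    proof (rule int)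
      fix k :: 'n
      show "real (card {..k}) - 1 < Re ((0 :: (complex,'n) vec) $ k) + \<alpha>"
        "Re ((0 :: (complex,'n) vec) $ k) < \<alpha> + real (card {..k}) - real CARD('n)"
        using card[of k] assms(1) by auto
    qed
    moreover have "Delta_gen (0 :: (complex,'n) vec) x = 1" if "x \<in> hpd" for x
      using Delta_gen_const[OF that, of 0] hpd_invertible[OF that]
      by (simp add: invertible_det_nz zero_vec_def)
    ultimately show ?thesis
      by (subst (asm) Bochner_Integration.integrable_cong[OF refl, of _ _ f]) auto
  qed
  have psd: "hermitian_psd n (\<lambda>i j. ?G * det_ratio (x i) (x j) powr of_real \<alpha>)"
    if "\<forall>i<n. x i \<in> hpd" for n and x :: "nat \<Rightarrow> 'n cmat"
    using that by (intro hermitian_psd_det_ratio assms(1)) auto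
  have pd: "positive_definite_fun f"
    unfolding positive_definite_fun_def
  proof (intro conjI allI impI cont)
    fix n and x :: "nat \<Rightarrow> 'n cmat" assume x: "\<forall>i<n. x i \<in> hpd"
    \<comment> \<open>The definition of positive definiteness puts the inverse roots of x_i around
      x_j, which is the kernel at (x_j, x_i); the symmetry of \<open>det_ratio\<close> restores the
      order.\<close>
    have "f (inv_sqrt (x i) ** x j ** inv_sqrt (x i)) = ?G * det_ratio (x i) (x j) powr of_real \<alpha>" if "i < n" "j < n" for i j
      using K[of "x j" "x i"] x that by (simp add: det_ratio_commute)
    then show "hermitian_psd n (\<lambda>i j. f (inv_sqrt (x i) ** x j ** inv_sqrt (x i)))"
      using psd[OF x] by (subst hermitian_psd_cong)
  qed
  have st: "spherical_transform f t = of_real ((cmod (Gamma_M (\<chi> k. of_real (\<alpha> + delta $ k) + \<i> * of_real (t $ k))))\<^sup>2)" for t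
  proof -
    define s where "s = (\<chi> k. - \<i> * of_real (t $ k) + complex_of_real (delta $ k))"
    let ?P = "complex_of_real (2 * pi) ^ (CARD('n) * (CARD('n) - 1) div 2)"
    \<comment> \<open>Inserting s_k = \<delta>_k - i t_k, the arguments of the two Gamma products
      are \<alpha> - (N - 1)/2 - i t_k and \<alpha> - (N - 1)/2 + i t_k. The shift \<delta> removes
      the explicit k from both, so the products are complex conjugates and their product is a
      squared modulus.\<close>
    let ?z = "\<lambda>k. complex_of_real (\<alpha> - (real CARD('n) - 1) / 2) + \<i> * of_real (t $ k)"
    have s: "real (card {..k}) - 1 < Re (s $ k) + \<alpha>" "Re (s $ k) < \<alpha> + real (card {..k}) - real CARD('n)" for k
      using assms(1) \<open>0 < \<alpha>\<close> by (auto simp: s_def delta_def field_simps)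
    have "f \<in> borel_measurable vol" by (rule borel_measurable_vol_continuous[OF cont])
    then have "spherical_transform f t = (\<integral>x. f x * Delta_gen s x \<partial>vol)"
      using spherical_transform_eq[OF U, of t] int[OF s] unfolding s_def by blast
    also have "\<dots> = Gamma_M (s + (\<chi> k. of_real \<alpha>)) * ?P * (\<Prod>k\<in>UNIV. Gamma (of_real (2 * \<alpha>) - (s + (\<chi> k. of_real \<alpha>)) $ k + of_nat (card {..k}) - of_nat CARD('n)))"
      by (rule val[OF s])
    also have "Gamma_M (s + (\<chi> k. of_real \<alpha>)) = ?P * (\<Prod>k\<in>UNIV. Gamma (cnj (?z k)))"
    proof -
      have "(s + (\<chi> k. of_real \<alpha>)) $ k - of_nat (card {..k}) + 1 = cnj (?z k)" for k
        by (simp add: s_def delta_def complex_eq_iff field_simps)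
      then show ?thesis by (simp only: Gamma_M_def)
    qed
    also have "(\<Prod>k\<in>UNIV. Gamma (of_real (2 * \<alpha>) - (s + (\<chi> k. of_real \<alpha>)) $ k + of_nat (card {..k}) - of_nat CARD('n))) = (\<Prod>k\<in>UNIV. Gamma (?z k))"
    proof -
      have "of_real (2 * \<alpha>) - (s + (\<chi> k. of_real \<alpha>)) $ k + of_nat (card {..k}) - of_nat CARD('n) = ?z k" for k
        by (simp add: s_def delta_def complex_eq_iff field_simps)
      then show ?thesis by (simp only:)
    qed
    also have "?P * (\<Prod>k\<in>UNIV. Gamma (cnj (?z k))) * ?P * (\<Prod>k\<in>UNIV. Gamma (?z k)) = cnj (?P * (\<Prod>k\<in>UNIV. Gamma (?z k))) * (?P * (\<Prod>k\<in>UNIV. Gamma (?z k)))"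
      by (simp only: cnj_Gamma complex_cnj_mult complex_cnj_power complex_cnj_complex_of_real cnj_prod mult_ac)
    also have "?P * (\<Prod>k\<in>UNIV. Gamma (?z k)) = Gamma_M (\<chi> k. of_real (\<alpha> + delta $ k) + \<i> * of_real (t $ k))"
    proof -
      have "(\<chi> k. of_real (\<alpha> + delta $ k) + \<i> * of_real (t $ k)) $ k - of_nat (card {..k}) + 1 = ?z k" for k
        by (simp add: delta_def complex_eq_iff field_simps)
      then show ?thesis by (simp only: Gamma_M_def)
    qed
    finally show ?thesis
      by (simp only: complex_norm_square mult.commute)
  qed
  have inv: "invariant_kernel K"
    unfolding invariant_kernel_def is_kernel_def
  proof (intro conjI allI impI)
    show "continuous_on (hpd \<times> hpd) (\<lambda>(x, y). K x y)"
    proof (rule continuous_on_cong[THEN iffD1, OF refl])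
      show "continuous_on (hpd \<times> hpd) (\<lambda>p. ?G * det_ratio (fst p) (snd p) powr of_real \<alpha>)"
        by (intro continuous_intros continuous_on_det_ratio_powr) auto
    qed (auto simp: assms(3) K)
    show "hermitian_psd n (\<lambda>i j. K (x i) (x j))" if "\<forall>i<n. x i \<in> hpd" for n x
      using psd[OF that] by (rule hermitian_psd_cong[THEN iffD1, rotated]) (simp add: assms(3) K that)
    show "K (act g x) (act g y) = K x y" if "invertible g" "x \<in> hpd" "y \<in> hpd" for g x y
      using that by (simp add: assms(3) K act_hpd det_ratio_act)
  qed
  show ?thesis
    using U integrable pd st inv by (simp add: assms(3) K det_ratio_def)
qed

end
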